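(* Let $\iota\in[K]$ be the initial colour of an edge iterated graph system whose degree matrix $\mathbf N$ and mass matrix $\mathbf M$ are primitive-Frobenius, and let $(\Xi_\iota,\hat\deg_{\Xi_\iota})$ be its degree scaling limit. If $\Lambda_{\mathcal U_\iota}>1$, then $\Xi_\iota$ is scale-free if and only if $\Xi_\iota$ does not satisfy the BEDM condition and $\max_{Q\in\mathscr K_{\deg}(\iota)}\Lambda_{\mathbf M}^{\deg,\mathrm{eff}}(Q)>1$. In that case \[ \dim_\mathrm{D}(\Xi_\iota,\hat\deg_{\Xi_\iota})=\frac{\log\max_{Q\in\mathscr K_{\deg}(\iota)}\Lambda_{\mathbf M}^{\deg,\mathrm{eff}}(Q)}{\log\Lambda_{\mathcal U_\iota}}. \]
   Context: Conventions: $[N]=\{1,\dots,N\}$; $\boldsymbol\xi_a$ standard basis row vectors; $\|\cdot\|_1$ the $\ell^1$ norm; $\rho$ spectral radius; $f\asymp g$ means $f(m)/g(m)$ converges to a constant in $(0,\infty)$. EIGS: $K\ge1$ colours; for $i\in[K]$, $R_i$ is a finite connected directed graph with edges coloured in $[K]$ and planting vertices $\beta_i^+,\beta_i^-$ at undirected distance $\ge2$. $\Xi_\iota^0$ is a single directed edge of colour $\iota$; $\Xi_\iota^{n+1}$ replaces each edge $(a,b)$ of colour $i$ of $\Xi_\iota^n$ by a fresh copy of $R_i$ with $\beta_i^+=a$, $\beta_i^-=b$. Vertex sets are nested; a vertex is born in generation $m$ if it first appears in $\Xi_\iota^m$. Matrices: $[\mathbf M]_{ik}$ = number of colour-$k$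 edges in $R_i$. For a vertex $v$ of a coloured digraph $G$, $\boldsymbol\kappa_G(v)\in\mathbb N^{1\times 2K}$ has entry $2i-1$ = number of outgoing colour-$i$ edges at $v$ and entry $2i$ = number of incoming colour-$i$ edges. $\mathbf N\in\mathbb N^{2K\times 2K}$ has rows $2i-1,2i$ equal to $\boldsymbol\kappa_{R_i}(\beta_i^+),\boldsymbol\kappa_{R_i}(\beta_i^-)$. Frobenius notions (for nonnegative square $\mathbf X$ on index set $I$): $a\rightsquigarrow b$ iff $[\mathbf X^n]_{ab}>0$ for some $n\ge0$; $\mathfrak r_{\mathbf X}(a)$ the set of indices reachable from $a$; blocks = mutual-reachability classes, diagonal blocks $\mathbf B_k(\mathbf X)$; $\mathfrak R_{\mathbf X}(a)$ = set of blocks reachable from the block of $a$; primitive-Frobenius means every diagonal block is primitive. $\varkappa_{\mathbf X}(a)$ is the maximum, over chains of distinct blocks $k_0,k_1,\dots,k_L$ with $k_0$ the block of $a$ and each $k_{r}$ reaching $k_{r+1}$, of the number of $r$ with $\rho(\mathbf B_{k_r}(\mathbf X))=\max_{\ell\in\mathfrak R_{\mathbf X}(a)}\rho(\mathbf B_\ell(\mathbf X))$. Birth types: $\mathcal U_\iota=\{\boldsymbol\kappa_{\Xi_\iota^0}(v):v\in V(\Xi_\iota^0)\}\cup\bigcup_{j\in\mathfrak r_{\mathbf M}(\iota)}\{\boldsymbol\kappa_{R_j}(w):w\in V(R_j)\setminus\{\beta_j^\pm\}\}$. The birth type $\mathbf u(v)$ of a vertex born in generation $m$ is $\boldsymbol\kappa_{\Xi_\iota^m}(v)$.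 For nonzero $\mathbf u$: $\lambda(\mathbf u)=\max_{a:[\mathbf u]_a>0}\max_{\ell\in\mathfrak R_{\mathbf N}(a)}\rho(\mathbf B_\ell(\mathbf N))$; $\tau(\mathbf u)=\max\{\varkappa_{\mathbf N}(a):[\mathbf u]_a>0,\ \max_{\ell\in\mathfrak R_{\mathbf N}(a)}\rho(\mathbf B_\ell(\mathbf N))=\lambda(\mathbf u)\}$; $\Lambda_{\mathcal U_\iota}=\max_{\mathbf u\in\mathcal U_\iota}\lambda(\mathbf u)$; $\tau_{\deg}(\iota)=\max\{\tau(\mathbf u):\lambda(\mathbf u)=\Lambda_{\mathcal U_\iota}\}$. $c_{\deg}(\mathbf u)=\lim_n\|\mathbf u\mathbf N^n\|_1/(n^{\tau(\mathbf u)-1}\lambda(\mathbf u)^n)\in(0,\infty)$ (this limit exists). Degree scaling limit: $\Delta(G)$ is the maximum degree; for $v\in\bigcup_nV(\Xi_\iota^n)$, $\hat\deg_{\Xi_\iota}(v)=\lim_n\deg_{\Xi_\iota^n}(v)/\Delta(\Xi_\iota^n)$ (exists when $\Lambda_{\mathcal U_\iota}>1$). $P(\ell)=|\{v:\hat\deg_{\Xi_\iota}(v)=\ell\}|$. Classes: for $\mathbf u\in\mathcal U_\iota$, $B_{\mathbf u}(m)$ is the number of vertices born in generation $m$ with birth type $\mathbf u$. $I_{\mathrm{deg,surv}}(\iota)$ = set of nonzero $\mathbf u\in\mathcal U_\iota$ with $\lambda(\mathbf u)=\Lambda_{\mathcal U_\iota}$, $\tau(\mathbf u)=\tau_{\deg}(\iota)$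 and $B_{\mathbf u}(m)>0$ for arbitrarily large $m$. For such $\mathbf u$, $\Lambda^{\deg}_{\mathbf M}(\mathbf u)>0$ is the number such that $B_{\mathbf u}(m)\asymp m^{q-1}\Lambda_{\mathbf M}^{\deg}(\mathbf u)^m$ for some integer $q\ge1$. $\mathbf u\sim_{\deg}\mathbf v$ iff $c_{\deg}(\mathbf u)/c_{\deg}(\mathbf v)\in\Lambda_{\mathcal U_\iota}^{\mathbb Z}$; $\mathscr K_{\deg}(\iota)$ is the set of equivalence classes; for a class $Q$, $\Lambda_{\mathbf M}^{\deg,\mathrm{eff}}(Q)=\max_{\mathbf u\in Q}\Lambda_{\mathbf M}^{\deg}(\mathbf u)$. BEDM condition: there exist classes $Q_1,Q_2$ with $\Lambda_{\mathbf M}^{\deg,\mathrm{eff}}(Q_1)\ne\Lambda_{\mathbf M}^{\deg,\mathrm{eff}}(Q_2)$. Scale-free: the limit $\dim_\mathrm{D}=\lim_{\ell\to0}\log P(\ell)/(-\log\ell)$, taken over positive $\ell$ with $P(\ell)>0$, exists and is positive; it is then the degree dimension. *)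

theory Defs
  imports
    "Graph_Theory.Digraph_Component"
    "Graph_Theory.Shortest_Path"
    "Jordan_Normal_Form.Spectral_Radius"
    "Jordan_Normal_Form.DL_Submatrix"
begin

section \<open>Edge iterated graph systems\<close>

record ('a, 'b) coloured_digraph = "('a, 'b) pre_digraph" +
  colour :: "'b \<Rightarrow> nat"

abbreviation uncoloured ::
    "('a, 'b, 'c) pre_digraph_scheme \<Rightarrow> ('a, 'b) pre_digraph" where
  "uncoloured G \<equiv> pre_digraph.truncate G"

text \<open>Colours are numbered from 0: the colour set is \<open>{..<num_colours S}\<close>.\<close>

record ('v, 'e) edge_igs =
  num_colours :: nat
  rule_graph :: "nat \<Rightarrow> ('v, 'e) coloured_digraph"
  plant_pos :: "nat \<Rightarrow> 'v"
  plant_neg :: "nat \<Rightarrow> 'v"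

definition undirected_dist :: "('a, 'b) pre_digraph \<Rightarrow> 'a \<Rightarrow> 'a \<Rightarrow> ereal" where
  "undirected_dist G u v = wf_digraph.\<mu> (with_proj (mk_symmetric G)) (\<lambda>_. 1) u v"

text \<open>
  Loops are excluded, because a copy of a rule graph, whose planting vertices are distinct,
  cannot be planted on a loop. Parallel edges are permitted; if no rule graph has any, then
  neither has any of the iterated graphs.
\<close>

definition is_edge_igs :: "('v, 'e) edge_igs \<Rightarrow> bool" where
  "is_edge_igs S \<longleftrightarrow> 1 \<le> num_colours S \<and>
    (\<forall>i < num_colours S.
       fin_digraph (uncoloured (rule_graph S i)) \<and>
       loopfree_digraph (uncoloured (rule_graph S i)) \<and>
       connected (uncoloured (rule_graph S i)) \<and>
       (\<forall>e \<in> arcs (rule_graph S i). colour (rule_graph S i) e < num_colours S) \<and>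
       plant_pos S i \<in> verts (rule_graph S i) \<and>
       plant_neg S i \<in> verts (rule_graph S i) \<and>
       2 \<le> undirected_dist (uncoloured (rule_graph S i)) (plant_pos S i) (plant_neg S i))"

definition interior_verts :: "('v, 'e) edge_igs \<Rightarrow> nat \<Rightarrow> 'v set" where
  "interior_verts S i = verts (rule_graph S i) - {plant_pos S i, plant_neg S i}"

text \<open>
  An edge of the \<open>n\<close>-th iterate is named by the list of the \<open>n\<close> rule-graph edges chosen on the
  way to it, latest first: edge \<open>e\<close> of the copy replacing edge \<open>p\<close> is \<open>e # p\<close>. The interior
  vertex \<open>w\<close> of the copy replacing \<open>p\<close> is \<open>Fresh p w\<close>; since \<open>p\<close> records the generation, these
  names are new in every step and the vertex sets are literally nested.
\<close>

datatype ('v, 'e) xvertex = Source | Sink | Fresh "'e list" 'v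

type_synonym ('v, 'e) xgraph = "(('v, 'e) xvertex, 'e list) coloured_digraph"

definition planted ::
    "('v, 'e) edge_igs \<Rightarrow> ('v, 'e) xgraph \<Rightarrow> 'e list \<Rightarrow> 'v \<Rightarrow> ('v, 'e) xvertex" where
  "planted S G p w =
    (if w = plant_pos S (colour G p) then tail G p
     else if w = plant_neg S (colour G p) then head G p
     else Fresh p w)"

definition substitute :: "('v, 'e) edge_igs \<Rightarrow> ('v, 'e) xgraph \<Rightarrow> ('v, 'e) xgraph" where
  "substitute S G = \<lparr>
     verts = verts G \<union> {Fresh p w | p w. p \<in> arcs G \<and> w \<in> interior_verts S (colour G p)},
     arcs = {e # p | p e. p \<in> arcs G \<and> e \<in> arcs (rule_graph S (colour G p))},
     tail = (\<lambda>q. planted S G (tl q) (tail (rule_graph S (colour G (tl q))) (hd q))),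
     head = (\<lambda>q. planted S G (tl q) (head (rule_graph S (colour G (tl q))) (hd q))),
     colour = (\<lambda>q. colour (rule_graph S (colour G (tl q))) (hd q))\<rparr>"

primrec Xi :: "('v, 'e) edge_igs \<Rightarrow> nat \<Rightarrow> nat \<Rightarrow> ('v, 'e) xgraph" where
  "Xi S \<iota> 0 = \<lparr>verts = {Source, Sink}, arcs = {[]},
     tail = (\<lambda>_. Source), head = (\<lambda>_. Sink), colour = (\<lambda>_. \<iota>)\<rparr>"
| "Xi S \<iota> (Suc n) = substitute S (Xi S \<iota> n)"

definition Xi_verts :: "('v, 'e) edge_igs \<Rightarrow> nat \<Rightarrow> ('v, 'e) xvertex set" where
  "Xi_verts S \<iota> = (\<Union>n. verts (Xi S \<iota> n))"


section \<open>Mass matrix and degree matrix\<close>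

definition mass_matrix :: "('v, 'e) edge_igs \<Rightarrow> real mat" where
  "mass_matrix S = mat (num_colours S) (num_colours S)
    (\<lambda>(i, k). real (card {e \<in> arcs (rule_graph S i). colour (rule_graph S i) e = k}))"

text \<open>
  The row vector of coloured degrees of \<open>v\<close>, as a matrix with one row and \<open>2 * K\<close> columns:
  with colours and columns numbered from 0, column \<open>2 * i\<close> counts the outgoing and column
  \<open>2 * i + 1\<close> the incoming edges of colour \<open>i\<close>. The rows of \<open>degree_matrix\<close> follow the same
  pattern.
\<close>

definition kappa :: "nat \<Rightarrow> ('a, 'b) coloured_digraph \<Rightarrow> 'a \<Rightarrow> nat mat" where
  "kappa K G v = mat 1 (2 * K) (\<lambda>(_, a).
     if even a then card {e \<in> arcs G. tail G e = v \<and> colour G e = a div 2}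
     else card {e \<in> arcs G. head G e = v \<and> colour G e = a div 2})"

definition degree_matrix :: "('v, 'e) edge_igs \<Rightarrow> real mat" where
  "degree_matrix S = mat (2 * num_colours S) (2 * num_colours S) (\<lambda>(a, b).
     let i = a div 2; \<beta> = (if even a then plant_pos S i else plant_neg S i)
     in real (kappa (num_colours S) (rule_graph S i) \<beta> $$ (0, b)))"


section \<open>Frobenius notions for nonnegative square matrices\<close>

definition reach :: "real mat \<Rightarrow> nat \<Rightarrow> nat set" where
  "reach X a = {b. b < dim_row X \<and> (\<exists>n. (X ^\<^sub>m n) $$ (a, b) > 0)}"

definition block_of :: "real mat \<Rightarrow> nat \<Rightarrow> nat set" where
  "block_of X a = {b \<in> reach X a. a \<in> reach X b}"

definition blocks :: "real mat \<Rightarrow> nat set set" where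
  "blocks X = block_of X ` {..<dim_row X}"

definition block_reaches :: "real mat \<Rightarrow> nat set \<Rightarrow> nat set \<Rightarrow> bool" where
  "block_reaches X B C \<longleftrightarrow> (\<exists>a \<in> B. \<exists>b \<in> C. b \<in> reach X a)"

definition reach_blocks :: "real mat \<Rightarrow> nat \<Rightarrow> nat set set" where
  "reach_blocks X a = {B \<in> blocks X. block_reaches X (block_of X a) B}"

definition diag_block :: "real mat \<Rightarrow> nat set \<Rightarrow> real mat" where
  "diag_block X B = submatrix X B B"

definition block_radius :: "real mat \<Rightarrow> nat set \<Rightarrow> real" where
  "block_radius X B = spectral_radius (map_mat complex_of_real (diag_block X B))"

text \<open>As usual the exponent is positive, so the one-by-one zero matrix is not primitive.\<close>

definition primitive_mat :: "real mat \<Rightarrow> bool" where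
  "primitive_mat X \<longleftrightarrow>
    (\<exists>n \<ge> 1. \<forall>i < dim_row X. \<forall>j < dim_col X. (X ^\<^sub>m n) $$ (i, j) > 0)"

definition primitive_Frobenius :: "real mat \<Rightarrow> bool" where
  "primitive_Frobenius X \<longleftrightarrow> (\<forall>B \<in> blocks X. primitive_mat (diag_block X B))"

definition reach_radius :: "real mat \<Rightarrow> nat \<Rightarrow> real" where
  "reach_radius X a = Max (block_radius X ` reach_blocks X a)"

definition block_chains :: "real mat \<Rightarrow> nat \<Rightarrow> nat set list set" where
  "block_chains X a = {Bs. Bs \<noteq> [] \<and> hd Bs = block_of X a \<and> set Bs \<subseteq> blocks X \<and> distinct Bs \<and>
     (\<forall>r. Suc r < length Bs \<longrightarrow> block_reaches X (Bs ! r) (Bs ! Suc r))}"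

definition varkappa :: "real mat \<Rightarrow> nat \<Rightarrow> nat" where
  "varkappa X a =
    Max ((\<lambda>Bs. card {r. r < length Bs \<and> block_radius X (Bs ! r) = reach_radius X a}) ` block_chains X a)"


section \<open>Birth types\<close>

definition type_set :: "('v, 'e) edge_igs \<Rightarrow> nat \<Rightarrow> nat mat set" where
  "type_set S \<iota> =
     kappa (num_colours S) (Xi S \<iota> 0) ` verts (Xi S \<iota> 0) \<union>
     (\<Union>j \<in> reach (mass_matrix S) \<iota>. kappa (num_colours S) (rule_graph S j) ` interior_verts S j)"

definition birth_generation :: "('v, 'e) edge_igs \<Rightarrow> nat \<Rightarrow> ('v, 'e) xvertex \<Rightarrow> nat" where
  "birth_generation S \<iota> v = (LEAST m. v \<in> verts (Xi S \<iota> m))"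

definition birth_type :: "('v, 'e) edge_igs \<Rightarrow> nat \<Rightarrow> ('v, 'e) xvertex \<Rightarrow> nat mat" where
  "birth_type S \<iota> v = kappa (num_colours S) (Xi S \<iota> (birth_generation S \<iota> v)) v"

definition supp :: "('v, 'e) edge_igs \<Rightarrow> nat mat \<Rightarrow> nat set" where
  "supp S u = {a. a < 2 * num_colours S \<and> u $$ (0, a) > 0}"

definition type_rate :: "('v, 'e) edge_igs \<Rightarrow> nat mat \<Rightarrow> real" where
  "type_rate S u = Max (reach_radius (degree_matrix S) ` supp S u)"

definition type_order :: "('v, 'e) edge_igs \<Rightarrow> nat mat \<Rightarrow> nat" where
  "type_order S u =
     Max (varkappa (degree_matrix S) ` {a \<in> supp S u. reach_radius (degree_matrix S) a = type_rate S u})"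

definition Lambda_U :: "('v, 'e) edge_igs \<Rightarrow> nat \<Rightarrow> real" where
  "Lambda_U S \<iota> = Max (type_rate S ` type_set S \<iota>)"

definition tau_deg :: "('v, 'e) edge_igs \<Rightarrow> nat \<Rightarrow> nat" where
  "tau_deg S \<iota> = Max (type_order S ` {u \<in> type_set S \<iota>. type_rate S u = Lambda_U S \<iota>})"

definition l1_norm :: "real mat \<Rightarrow> real" where
  "l1_norm x = (\<Sum>a < dim_col x. \<bar>x $$ (0, a)\<bar>)"

definition c_deg :: "('v, 'e) edge_igs \<Rightarrow> nat mat \<Rightarrow> real" where
  "c_deg S u = lim (\<lambda>n. l1_norm (map_mat real u * degree_matrix S ^\<^sub>m n) /
     (real n ^ (type_order S u - 1) * type_rate S u ^ n))"


section \<open>Degree scaling limit\<close>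

definition deg :: "('a, 'b) coloured_digraph \<Rightarrow> 'a \<Rightarrow> nat" where
  "deg G v = in_degree (uncoloured G) v + out_degree (uncoloured G) v"

definition max_deg :: "('a, 'b) coloured_digraph \<Rightarrow> nat" where
  "max_deg G = Max (deg G ` verts G)"

definition deg_hat :: "('v, 'e) edge_igs \<Rightarrow> nat \<Rightarrow> ('v, 'e) xvertex \<Rightarrow> real" where
  "deg_hat S \<iota> v = lim (\<lambda>n. real (deg (Xi S \<iota> n) v) / real (max_deg (Xi S \<iota> n)))"

definition deg_count :: "('v, 'e) edge_igs \<Rightarrow> nat \<Rightarrow> real \<Rightarrow> nat" where
  "deg_count S \<iota> l = card {v \<in> Xi_verts S \<iota>. deg_hat S \<iota> v = l}"


section \<open>Classes of birth types and the BEDM condition\<close>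

definition births :: "('v, 'e) edge_igs \<Rightarrow> nat \<Rightarrow> nat mat \<Rightarrow> nat \<Rightarrow> nat" where
  "births S \<iota> u m =
     card {v \<in> Xi_verts S \<iota>. birth_generation S \<iota> v = m \<and> birth_type S \<iota> v = u}"

definition I_deg_surv :: "('v, 'e) edge_igs \<Rightarrow> nat \<Rightarrow> nat mat set" where
  "I_deg_surv S \<iota> = {u \<in> type_set S \<iota>. u \<noteq> 0\<^sub>m 1 (2 * num_colours S) \<and>
     type_rate S u = Lambda_U S \<iota> \<and> type_order S u = tau_deg S \<iota> \<and>
     (\<forall>n. \<exists>m \<ge> n. births S \<iota> u m > 0)}"

definition asymp_const :: "(nat \<Rightarrow> real) \<Rightarrow> (nat \<Rightarrow> real) \<Rightarrow> bool" where
  "asymp_const f g \<longleftrightarrow> (\<exists>c > 0. (\<lambda>m. f m / g m) \<longlonglongrightarrow> c)"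

definition Lambda_M_deg :: "('v, 'e) edge_igs \<Rightarrow> nat \<Rightarrow> nat mat \<Rightarrow> real" where
  "Lambda_M_deg S \<iota> u = (THE L. L > 0 \<and>
     (\<exists>q::nat. q \<ge> 1 \<and> asymp_const (\<lambda>m. real (births S \<iota> u m)) (\<lambda>m. real m ^ (q - 1) * L ^ m)))"

definition sim_deg :: "('v, 'e) edge_igs \<Rightarrow> nat \<Rightarrow> (nat mat \<times> nat mat) set" where
  "sim_deg S \<iota> = {(u, v). u \<in> I_deg_surv S \<iota> \<and> v \<in> I_deg_surv S \<iota> \<and>
     (\<exists>k::int. c_deg S u / c_deg S v = Lambda_U S \<iota> powi k)}"

definition K_deg :: "('v, 'e) edge_igs \<Rightarrow> nat \<Rightarrow> nat mat set set" where
  "K_deg S \<iota> = I_deg_surv S \<iota> // sim_deg S \<iota>"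

definition Lambda_M_deg_eff :: "('v, 'e) edge_igs \<Rightarrow> nat \<Rightarrow> nat mat set \<Rightarrow> real" where
  "Lambda_M_deg_eff S \<iota> Q = Max (Lambda_M_deg S \<iota> ` Q)"

definition BEDM :: "('v, 'e) edge_igs \<Rightarrow> nat \<Rightarrow> bool" where
  "BEDM S \<iota> \<longleftrightarrow> (\<exists>Q1 \<in> K_deg S \<iota>. \<exists>Q2 \<in> K_deg S \<iota>.
     Lambda_M_deg_eff S \<iota> Q1 \<noteq> Lambda_M_deg_eff S \<iota> Q2)"


section \<open>Scale-freeness\<close>

definition attained_degs :: "('v, 'e) edge_igs \<Rightarrow> nat \<Rightarrow> real set" where
  "attained_degs S \<iota> = {l. l > 0 \<and> deg_count S \<iota> l > 0}"

definition log_ratio :: "('v, 'e) edge_igs \<Rightarrow> nat \<Rightarrow> real \<Rightarrow> real" where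
  "log_ratio S \<iota> l = ln (real (deg_count S \<iota> l)) / (- ln l)"

text \<open>
  A limit as \<open>l\<close> tends to 0 within a set only makes sense if 0 is an accumulation point of that
  set; the first conjunct rules out the vacuous limits along the trivial filter.
\<close>

definition scale_free :: "('v, 'e) edge_igs \<Rightarrow> nat \<Rightarrow> bool" where
  "scale_free S \<iota> \<longleftrightarrow> at 0 within attained_degs S \<iota> \<noteq> bot \<and>
     (\<exists>d > 0. (log_ratio S \<iota> \<longlongrightarrow> d) (at 0 within attained_degs S \<iota>))"

definition degree_dimension :: "('v, 'e) edge_igs \<Rightarrow> nat \<Rightarrow> real" where
  "degree_dimension S \<iota> = Lim (at 0 within attained_degs S \<iota>) (log_ratio S \<iota>)"

end

theory Submission
  imports Defs "HOL-Analysis.Uniform_Limit" "HOL-Real_Asymp.Real_Asymp"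
begin

text \<open>
  The degree of a vertex of birth type \<open>u\<close>, \<open>k\<close> generations after its birth, is the \<open>\<ell>\<^sup>1\<close> norm of
  \<open>u N\<^sup>k\<close>, and the number of births of a given type is a row of \<open>M\<^sup>m\<close> applied to a nonnegative vector. For a
  primitive-Frobenius matrix such quantities are asymptotic to \<open>c n\<^sup>q L\<^sup>n\<close>: this holds inside a primitive
  block by the Perron-Frobenius theorem, and splitting a walk at the step by which it leaves its first block
  turns the general case into convolutions, where \<open>q\<close> increases by one exactly when two equal rates meet.
  Since \<open>\<Lambda> > 1\<close>, the maximal degree grows like the degree of a single vertex, so a vertex of top type
  \<open>u\<close> born in generation \<open>m\<close> has limit degree \<open>c\<^sub>u / (D \<Lambda>\<^sup>m)\<close> and all others have limit degree 0. Hence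
  a small attained degree belongs to exactly one class \<open>Q\<close>, where it is attained by as many vertices as
  are born, with types in \<open>Q\<close>, in generations of bounded distance from \<open>m\<close>. Along \<open>Q\<close> the
  logarithmic ratio therefore tends to \<open>log \<Lambda>\<^sub>M(Q) / log \<Lambda>\<close>.
\<close>

section \<open>Sequences with polynomial-exponential growth\<close>

text \<open>Primitivity asks for a positive exponent, so even a diagonal block of size one has
  positive spectral radius. Hence every index recurs and no rate is 0: a row of the powers applied
  to a nonnegative vector either vanishes identically or, suitably rescaled, has a positive limit. A
  type born once after generation 0 is therefore born in all late generations.

  The two matrices are needed with different precision. For degrees the polynomial exponent must be
  identified with \<open>varkappa N a - 1\<close>, because \<open>c_deg\<close> and the comparison
  of types refer to it. For births the existence of some exponent suffices: only the exponential
  rate enters \<open>Lambda_M_deg_eff\<close>, that rate is unique, and the logarithm forgets the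
  rest.

  True limits rather than two-sided bounds are required on the degree side because limit degrees are
  compared for equality: two surviving types share arbitrarily small degrees exactly when the
  quotient of their constants is an integer power of \<Lambda>.\<close>

text \<open>The shift from \<open>n\<close> to \<open>Suc n\<close> does not change the asymptotics and keeps the sequence positive.\<close>

definition pexp :: "nat \<Rightarrow> real \<Rightarrow> nat \<Rightarrow> real" where
  "pexp q L n = real (Suc n) ^ q * L ^ n"

text \<open>An exponent \<open>q\<close> here corresponds to the order \<open>q + 1\<close> in
  \<open>type_order\<close> and in the description of \<open>Lambda_M_deg\<close>.\<close>

definition asy :: "(nat \<Rightarrow> real) \<Rightarrow> nat \<Rightarrow> real \<Rightarrow> bool" where
  "asy f q L \<longleftrightarrow> L > 0 \<and> asymp_const f (pexp q L)"

lemma pexp_pos: "L > 0 \<Longrightarrow> pexp q L n > 0"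
  by (simp add: pexp_def)

lemma Suc_ratio_tendsto: "(\<lambda>n. real (Suc n + k) / real (Suc n)) \<longlonglongrightarrow> 1"
  by real_asymp

lemma asyI:
  assumes "L > 0" "c > 0" "(\<lambda>n. f n / pexp q L n) \<longlonglongrightarrow> c"
  shows "asy f q L"
  using assms by (auto simp: asy_def asymp_const_def)

lemma asyE:
  assumes "asy f q L"
  obtains c where "L > 0" "c > 0" "(\<lambda>n. f n / pexp q L n) \<longlonglongrightarrow> c"
  using assms by (auto simp: asy_def asymp_const_def)

lemma asy_eventually_pos:
  assumes "asy f q L" shows "eventually (\<lambda>n. f n > 0) sequentially"
proof -
  from assms obtain c where c: "L > 0" "c > 0" "(\<lambda>n. f n / pexp q L n) \<longlonglongrightarrow> c"
    by (rule asyE)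
  from order_tendstoD(1)[OF c(3) c(2)] show ?thesis
  proof eventually_elim
    case (elim n)
    then show ?case using pexp_pos[OF c(1), of q n] by (simp add: zero_less_divide_iff)
  qed
qed

lemma pexp_shift_ratio:
  assumes "L > 0"
  shows "(\<lambda>n. pexp q L (n + k) / pexp q L n) \<longlonglongrightarrow> L ^ k"
proof -
  have "(\<lambda>n. (real (Suc n + k) / real (Suc n)) ^ q * L ^ k) \<longlonglongrightarrow> 1 ^ q * L ^ k"
    by (intro tendsto_intros Suc_ratio_tendsto)
  moreover have "(real (Suc n + k) / real (Suc n)) ^ q * L ^ k = pexp q L (n + k) / pexp q L n" for n
    using assms by (simp add: pexp_def power_divide power_add field_simps)
  ultimately show ?thesis by simp
qed

text \<open>A shift by \<open>k\<close> only multiplies the limit by \<open>L ^ k\<close>. This is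
  needed because the matrix formula for births starts in generation 1 and because a convolution over
  walks loses one step at the exit.\<close>

lemma asy_shift_iff: "asy (\<lambda>n. f (n + k)) q L \<longleftrightarrow> asy f q L"
proof
  assume "asy f q L"
  then obtain c where c: "L > 0" "c > 0" "(\<lambda>n. f n / pexp q L n) \<longlonglongrightarrow> c"
    by (rule asyE)
  have "(\<lambda>n. f (n + k) / pexp q L (n + k) * (pexp q L (n + k) / pexp q L n)) \<longlonglongrightarrow> c * L ^ k"
    by (intro tendsto_mult pexp_shift_ratio c LIMSEQ_ignore_initial_segment[OF c(3)])
  moreover have "f (n + k) / pexp q L (n + k) * (pexp q L (n + k) / pexp q L n) = f (n + k) / pexp q L n" for n
    using pexp_pos[OF c(1), of q "n + k"] by simp
  ultimately have "(\<lambda>n. f (n + k) / pexp q L n) \<longlonglongrightarrow> c * L ^ k" by (simp only:)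
  then show "asy (\<lambda>n. f (n + k)) q L" using c by (intro asyI[of _ "c * L ^ k"]) simp_all
next
  assume "asy (\<lambda>n. f (n + k)) q L"
  then obtain c where c: "L > 0" "c > 0" "(\<lambda>n. f (n + k) / pexp q L n) \<longlonglongrightarrow> c"
    by (rule asyE)
  have "(\<lambda>n. f (n + k) / pexp q L n / (pexp q L (n + k) / pexp q L n)) \<longlonglongrightarrow> c / L ^ k"
    using c by (intro tendsto_divide pexp_shift_ratio c) simp
  moreover have "f (n + k) / pexp q L n / (pexp q L (n + k) / pexp q L n) = f (n + k) / pexp q L (n + k)" for n
    using pexp_pos[OF c(1), of q n] by simp
  ultimately have "(\<lambda>n. f (n + k) / pexp q L (n + k)) \<longlonglongrightarrow> c / L ^ k" by (simp only:)
  then have "(\<lambda>n. f n / pexp q L n) \<longlonglongrightarrow> c / L ^ k" by (rule LIMSEQ_offset)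
  then show "asy f q L" using c by (intro asyI[of _ "c / L ^ k"]) simp_all
qed

lemma asy_scale:
  assumes "asy f q L" "x > 0" shows "asy (\<lambda>n. x * f n) q L"
proof -
  from assms(1) obtain c where c: "L > 0" "c > 0" "(\<lambda>n. f n / pexp q L n) \<longlonglongrightarrow> c"
    by (rule asyE)
  from tendsto_mult_left[OF c(3), of x] show ?thesis
    using c assms(2) by (intro asyI[of _ "x * c"]) simp_all
qed

section \<open>Comparison and addition of growth types\<close>

lemma summable_poly_geometric:
  fixes r :: real
  assumes "0 \<le> r" "r < 1"
  shows "summable (\<lambda>n. real (Suc n) ^ q * r ^ n)"
proof (cases "r = 0")
  case True
  then show ?thesis by (intro summable_finite[of "{0}"]) (auto simp: power_0_left)
next
  case False
  \<comment> \<open>Half of the decay, one factor \<open>s ^ n\<close>, absorbs the polynomial; the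
    other half remains for the geometric comparison.\<close>
  define s where "s = sqrt r"
  have s: "0 < s" "s < 1" "r = s * s" using assms False by (auto simp: s_def)
  obtain p where p: "\<And>x. s ^ x * real x ^ q \<le> p" using poly_exp_bound[OF s(1,2), of q] by auto
  have bd: "real (Suc n) ^ q * r ^ n \<le> (p / s) * s ^ n" for n
    using mult_right_mono[OF p[of "Suc n"], of "s ^ n / s"] s by (simp add: field_simps power_mult_distrib)
  show ?thesis
    by (rule summable_comparison_test'[of "\<lambda>n. (p / s) * s ^ n" 0])
       (use bd assms s in \<open>auto intro!: summable_mult summable_geometric\<close>)
qed

text \<open>Lexicographic domination, rate before exponent. It is a total relation on growth types,
  so a finite sum always has a leading summand.\<close>

definition grows_le :: "nat \<Rightarrow> real \<Rightarrow> nat \<Rightarrow> real \<Rightarrow> bool" where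
  "grows_le q L q' L' \<longleftrightarrow> L < L' \<or> L = L' \<and> q \<le> q'"

lemma pexp_ratio_null:
  assumes "L > 0" "L < L' \<or> L = L' \<and> q < q'"
  shows "(\<lambda>n. pexp q L n / pexp q' L' n) \<longlonglongrightarrow> 0"
proof (cases "L < L'")
  case True
  have "(\<lambda>n. real (Suc n) ^ q * (L / L') ^ n) \<longlonglongrightarrow> 0"
    using assms True by (intro summable_LIMSEQ_zero summable_poly_geometric) auto
  then show ?thesis
  proof (rule Lim_null_comparison[rotated], intro always_eventually allI)
    fix n
    have "1 \<le> real (Suc n) ^ q'" by (intro one_le_power) simp
    then have "pexp q L n / pexp q' L' n \<le> pexp q L n / L' ^ n"
      using assms True by (intro divide_left_mono) (auto simp: pexp_def)
    then show "norm (pexp q L n / pexp q' L' n) \<le> real (Suc n) ^ q * (L / L') ^ n"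
      using assms True by (simp add: pexp_def power_divide abs_mult)
  qed
next
  case False
  then have e: "L' = L" "q < q'" using assms by auto
  have eq: "pexp q L n / pexp q' L' n = (1 / real (Suc n)) ^ (q' - q)" for n
    using assms e by (simp add: pexp_def power_diff power_divide field_simps)
  have "(\<lambda>n. (1 / real (Suc n)) ^ (q' - q)) \<longlonglongrightarrow> 0 ^ (q' - q)"
    by (intro tendsto_power) real_asymp
  then show ?thesis unfolding eq using e by (simp add: power_0_left)
qed

lemma pexp_ratio_convergent:
  assumes "L > 0" "grows_le q L q' L'"
  shows "\<exists>c \<ge> 0. (\<lambda>n. pexp q L n / pexp q' L' n) \<longlonglongrightarrow> c"
proof (cases "L = L' \<and> q = q'")
  case True
  then show ?thesis using pexp_pos[OF assms(1), of q] by (intro exI[of _ 1]) (simp add: less_imp_neq[symmetric])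
next
  case False
  then have "L < L' \<or> L = L' \<and> q < q'" using assms(2) by (auto simp: grows_le_def)
  from pexp_ratio_null[OF assms(1) this] show ?thesis by auto
qed

lemma asy_ratio_null:
  assumes "asy f q L" "L < L' \<or> L = L' \<and> q < q'"
  shows "(\<lambda>n. f n / pexp q' L' n) \<longlonglongrightarrow> 0"
proof -
  from assms(1) obtain c where c: "L > 0" "c > 0" "(\<lambda>n. f n / pexp q L n) \<longlonglongrightarrow> c"
    by (rule asyE)
  have "f n / pexp q L n * (pexp q L n / pexp q' L' n) = f n / pexp q' L' n" for n
    using pexp_pos[OF c(1), of q n] by simp
  then show ?thesis using tendsto_mult[OF c(3) pexp_ratio_null[OF c(1) assms(2)]] by (simp only: mult_zero_right)
qed

lemma asy_ratio_convergent:
  assumes "asy f q L" "grows_le q L q' L'"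
  shows "\<exists>c \<ge> 0. (\<lambda>n. f n / pexp q' L' n) \<longlonglongrightarrow> c"
proof -
  from assms(1) obtain c where c: "L > 0" "c > 0" "(\<lambda>n. f n / pexp q L n) \<longlonglongrightarrow> c"
    by (rule asyE)
  from pexp_ratio_convergent[OF c(1) assms(2)] obtain d where
    d: "d \<ge> 0" "(\<lambda>n. pexp q L n / pexp q' L' n) \<longlonglongrightarrow> d" by auto
  have "f n / pexp q L n * (pexp q L n / pexp q' L' n) = f n / pexp q' L' n" for n
    using pexp_pos[OF c(1), of q n] by simp
  then have "(\<lambda>n. f n / pexp q' L' n) \<longlonglongrightarrow> c * d" using tendsto_mult[OF c(3) d(2)] by (simp only:)
  then show ?thesis using c d by (intro exI[of _ "c * d"]) simp
qed

text \<open>All rescaled limits are nonnegative, so nothing cancels: dominated summands can only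
  increase the constant of the leading one.\<close>

lemma asy_add_sum:
  assumes "asy f q L" "finite J"
    and "\<And>j. j \<in> J \<Longrightarrow> \<exists>q' L'. asy (g j) q' L' \<and> grows_le q' L' q L"
  shows "asy (\<lambda>n. f n + (\<Sum>j\<in>J. g j n)) q L"
proof -
  from assms(1) obtain c where c: "L > 0" "c > 0" "(\<lambda>n. f n / pexp q L n) \<longlonglongrightarrow> c"
    by (rule asyE)
  have "\<exists>d. \<forall>j\<in>J. d j \<ge> 0 \<and> (\<lambda>n. g j n / pexp q L n) \<longlonglongrightarrow> d j"
    using assms(3) asy_ratio_convergent by (intro bchoice) metis
  then obtain d where d: "\<And>j. j \<in> J \<Longrightarrow> d j \<ge> 0" "\<And>j. j \<in> J \<Longrightarrow> (\<lambda>n. g j n / pexp q L n) \<longlonglongrightarrow> d j"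
    by auto
  have "(\<lambda>n. f n / pexp q L n + (\<Sum>j\<in>J. g j n / pexp q L n)) \<longlonglongrightarrow> c + sum d J"
    by (intro tendsto_intros c d)
  moreover have "c + sum d J > 0" using c(2) sum_nonneg[of J d] d(1) by fastforce
  ultimately show ?thesis
    using c(1) by (intro asyI[of _ "c + sum d J"]) (simp_all add: add_divide_distrib sum_divide_distrib)
qed

lemma asy_add:
  assumes "asy f q L" "asy g q' L'" "grows_le q' L' q L"
  shows "asy (\<lambda>n. f n + g n) q L"
  using asy_add_sum[of f q L "{()}" "\<lambda>_. g"] assms by auto

text \<open>The leading summand has the largest rate and, among those of that rate, the largest
  exponent. This two-stage maximum is the pattern of \<open>type_rate\<close> and
  \<open>type_order\<close>.\<close>

lemma asy_sum_Max:
  fixes q :: "'j \<Rightarrow> nat"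
  assumes "finite J" "J \<noteq> {}" "\<And>j. j \<in> J \<Longrightarrow> asy (g j) (q j) (L j)"
  shows "asy (\<lambda>n. \<Sum>j\<in>J. g j n) (Max (q ` {j \<in> J. L j = Max (L ` J)})) (Max (L ` J))"
proof -
  let ?T = "{j \<in> J. L j = Max (L ` J)}"
  have "Max (L ` J) \<in> L ` J" using assms by (intro Max_in) auto
  then have "?T \<noteq> {}" by auto
  then have "Max (q ` ?T) \<in> q ` ?T" using assms by (intro Max_in) auto
  then obtain i where i: "i \<in> J" "L i = Max (L ` J)" "q i = Max (q ` ?T)" by auto
  have "asy (\<lambda>n. g i n + (\<Sum>j\<in>J - {i}. g j n)) (q i) (L i)"
  proof (rule asy_add_sum)
    show "asy (g i) (q i) (L i)" by (rule assms(3)[OF i(1)])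
    fix j assume j: "j \<in> J - {i}"
    have "grows_le (q j) (L j) (q i) (L i)"
    proof (cases "L j = L i")
      case True
      then have "q j \<in> q ` ?T" using i j by auto
      then have "q j \<le> q i" unfolding i(3) using assms(1) by (intro Max_ge) auto
      then show ?thesis using True by (simp add: grows_le_def)
    next
      case False
      have "L j \<le> L i" unfolding i(2) using assms(1) j by (intro Max_ge) auto
      then show ?thesis using False by (simp add: grows_le_def)
    qed
    then show "\<exists>q' L'. asy (g j) q' L' \<and> grows_le q' L' (q i) (L i)" using assms(3) j by auto
  qed (use assms(1) in simp)
  moreover have "(\<lambda>n. g i n + (\<Sum>j\<in>J - {i}. g j n)) = (\<lambda>n. \<Sum>j\<in>J. g j n)"
    using assms(1) i(1) by (simp add: sum.remove)
  ultimately show ?thesis by (simp only: i)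
qed

section \<open>Weighted means and convolutions of growing sequences\<close>

text \<open>Toeplitz's theorem on regular summation, for nonnegative weights: each fixed index loses
  its weight, so only the tail of \<open>x\<close> matters, and there \<open>x\<close> is close to
  \<open>l\<close>.\<close>

lemma toeplitz:
  fixes w :: "nat \<Rightarrow> nat \<Rightarrow> real"
  assumes "\<And>n k. w n k \<ge> 0" "(\<lambda>n. \<Sum>k\<le>n. w n k) \<longlonglongrightarrow> W" "\<And>k. (\<lambda>n. w n k) \<longlonglongrightarrow> 0" "x \<longlonglongrightarrow> l"
  shows "(\<lambda>n. \<Sum>k\<le>n. w n k * x k) \<longlonglongrightarrow> W * l"
proof -
  define y where "y = (\<lambda>k. x k - l)"
  have y0: "y \<longlonglongrightarrow> 0" using assms(4) unfolding y_def by (simp add: LIM_zero)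
  then obtain M where M: "M > 0" "\<And>k. \<bar>y k\<bar> \<le> M"
    using convergent_imp_Bseq[OF convergentI[OF y0]] unfolding Bseq_def by auto
  obtain C where C: "C > 0" "\<And>n. \<bar>\<Sum>k\<le>n. w n k\<bar> \<le> C"
    using convergent_imp_Bseq[OF convergentI[OF assms(2)]] unfolding Bseq_def by auto
  have "(\<lambda>n. \<Sum>k\<le>n. w n k * y k) \<longlonglongrightarrow> 0"
  proof (rule LIMSEQ_I)
    fix e :: real assume e: "e > 0"
    \<comment> \<open>\<open>C\<close> bounds the total weight, so the indices from \<open>K\<close>
      on contribute at most \<open>e / 2\<close>; the finitely many earlier ones get the other half
      through \<open>N\<close>.\<close>
    have "e / (2 * C) > 0" using e C by simp
    from LIMSEQ_D[OF y0 this] obtain K where K: "\<And>k. k \<ge> K \<Longrightarrow> \<bar>y k\<bar> < e / (2 * C)" by auto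
    have "(\<lambda>n. M * (\<Sum>k<K. w n k)) \<longlonglongrightarrow> M * (\<Sum>k<K. 0)"
      by (intro tendsto_intros assms(3))
    from LIMSEQ_D[OF this, of "e / 2"] e obtain N where
      N: "\<And>n. n \<ge> N \<Longrightarrow> \<bar>M * (\<Sum>k<K. w n k)\<bar> < e / 2" by auto
    have "norm ((\<Sum>k\<le>n. w n k * y k) - 0) < e" if n: "n \<ge> N" for n
    proof -
      have "\<bar>\<Sum>k\<le>n. w n k * y k\<bar> \<le> (\<Sum>k\<le>n. w n k * \<bar>y k\<bar>)"
        by (rule order_trans[OF sum_abs]) (simp add: abs_mult assms(1))
      also have "\<dots> \<le> (\<Sum>k\<le>n. (if k < K then w n k * M else 0) + w n k * (e / (2 * C)))"
      proof (rule sum_mono)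
        fix k
        show "w n k * \<bar>y k\<bar> \<le> (if k < K then w n k * M else 0) + w n k * (e / (2 * C))"
        proof (cases "k < K")
          case True
          have "w n k * \<bar>y k\<bar> \<le> w n k * M" by (intro mult_left_mono M assms)
          moreover have "0 \<le> w n k * (e / (2 * C))" using assms(1) e C by simp
          ultimately show ?thesis using True by simp
        next
          case False
          then have "w n k * \<bar>y k\<bar> \<le> w n k * (e / (2 * C))"
            using K[of k] by (intro mult_left_mono assms(1)) auto
          then show ?thesis using False by simp
        qed
      qed
      also have "\<dots> = (\<Sum>k\<in>{..n} \<inter> {..<K}. w n k * M) + (\<Sum>k\<le>n. w n k) * (e / (2 * C))"
        unfolding sum.distrib sum_distrib_right
        by (simp add: sum.inter_restrict[of "{..n}" _ "{..<K}"])
      also have "(\<Sum>k\<in>{..n} \<inter> {..<K}. w n k * M) \<le> (\<Sum>k<K. w n k * M)"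
        by (rule sum_mono2) (use assms(1) M in auto)
      also have "(\<Sum>k<K. w n k * M) = M * (\<Sum>k<K. w n k)" by (simp add: sum_distrib_left mult.commute)
      also have "\<dots> \<le> \<bar>M * (\<Sum>k<K. w n k)\<bar>" by simp
      also have "(\<Sum>k\<le>n. w n k) * (e / (2 * C)) \<le> C * (e / (2 * C))"
        using C(2)[of n] e C(1) by (intro mult_right_mono) auto
      also have "C * (e / (2 * C)) = e / 2" using C by simp
      also have "\<bar>M * (\<Sum>k<K. w n k)\<bar> + e / 2 < e" using N[OF n] by simp
      finally show ?thesis by simp
    qed
    then show "\<exists>no. \<forall>n\<ge>no. norm ((\<Sum>k\<le>n. w n k * y k) - 0) < e" by auto
  qed
  moreover have "(\<lambda>n. (\<Sum>k\<le>n. w n k) * l) \<longlonglongrightarrow> W * l"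
    by (intro tendsto_intros assms)
  ultimately have "(\<lambda>n. (\<Sum>k\<le>n. w n k * y k) + (\<Sum>k\<le>n. w n k) * l) \<longlonglongrightarrow> 0 + W * l"
    by (rule tendsto_add)
  moreover have "(\<Sum>k\<le>n. w n k * y k) + (\<Sum>k\<le>n. w n k) * l = (\<Sum>k\<le>n. w n k * x k)" for n
    unfolding y_def sum_distrib_right sum.distrib[symmetric] by (simp add: right_diff_distrib)
  ultimately show ?thesis by simp
qed

text \<open>The discrete form of integrating \<open>x ^ q\<close>: each summand is compared with a
  difference of consecutive powers of exponent \<open>Suc q\<close>, and the differences
  telescope.\<close>

lemma power_sum_bounds:
  "real (Suc q) * (\<Sum>k\<le>n. real (Suc k) ^ q) \<ge> real (Suc n) ^ Suc q"
  "real (Suc q) * (\<Sum>k\<le>n. real (Suc k) ^ q) \<le> real (Suc (Suc n)) ^ Suc q"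
proof -
  have lo: "real (Suc k) ^ Suc q - real k ^ Suc q \<le> real (Suc q) * real (Suc k) ^ q" for k
  proof -
    have "real (Suc k) ^ Suc q - real k ^ Suc q =
        (real (Suc k) - real k) * (\<Sum>i<Suc q. real (Suc k) ^ i * real k ^ (q - i))"
      by (rule diff_power_eq_sum)
    also have "\<dots> = (\<Sum>i<Suc q. real (Suc k) ^ i * real k ^ (q - i))" by simp
    also have "\<dots> \<le> (\<Sum>i<Suc q. real (Suc k) ^ i * real (Suc k) ^ (q - i))"
      by (intro sum_mono mult_left_mono power_mono) auto
    also have "\<dots> = (\<Sum>i<Suc q. real (Suc k) ^ q)"
      by (intro sum.cong refl) (simp flip: power_add del: of_nat_Suc)
    finally show ?thesis by simp
  qed
  have hi: "real (Suc q) * real k ^ q \<le> real (Suc k) ^ Suc q - real k ^ Suc q" for k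
  proof -
    have "real (Suc q) * real k ^ q = (\<Sum>i<Suc q. real k ^ q)" by simp
    also have "\<dots> = (\<Sum>i<Suc q. real k ^ i * real k ^ (q - i))"
      by (intro sum.cong refl) (simp flip: power_add)
    also have "\<dots> \<le> (\<Sum>i<Suc q. real (Suc k) ^ i * real k ^ (q - i))"
      by (intro sum_mono mult_right_mono power_mono) auto
    also have "\<dots> = (real (Suc k) - real k) * (\<Sum>i<Suc q. real (Suc k) ^ i * real k ^ (q - i))" by simp
    also have "\<dots> = real (Suc k) ^ Suc q - real k ^ Suc q"
      by (rule diff_power_eq_sum[symmetric])
    finally show ?thesis .
  qed
  have "real (Suc n) ^ Suc q = (\<Sum>k\<le>n. real (Suc k) ^ Suc q - real k ^ Suc q)"
    by (induction n) auto
  also have "\<dots> \<le> (\<Sum>k\<le>n. real (Suc q) * real (Suc k) ^ q)" by (intro sum_mono lo)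
  finally show "real (Suc q) * (\<Sum>k\<le>n. real (Suc k) ^ q) \<ge> real (Suc n) ^ Suc q"
    by (simp only: sum_distrib_left)
  have "real (Suc q) * (\<Sum>k\<le>n. real (Suc k) ^ q) \<le> (\<Sum>k\<le>n. real (Suc (Suc k)) ^ Suc q - real (Suc k) ^ Suc q)"
    unfolding sum_distrib_left by (intro sum_mono hi)
  also have "\<dots> = real (Suc (Suc n)) ^ Suc q - 1" by (induction n) auto
  finally show "real (Suc q) * (\<Sum>k\<le>n. real (Suc k) ^ q) \<le> real (Suc (Suc n)) ^ Suc q" by simp
qed

lemma power_sum_tendsto:
  "(\<lambda>n. (\<Sum>k\<le>n. real (Suc k) ^ q) / real (Suc n) ^ Suc q) \<longlonglongrightarrow> 1 / real (Suc q)"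
proof (rule real_tendsto_sandwich)
  show "\<forall>\<^sub>F n in sequentially. 1 / real (Suc q) \<le> (\<Sum>k\<le>n. real (Suc k) ^ q) / real (Suc n) ^ Suc q"
    using power_sum_bounds(1)[where q = q] by (intro always_eventually allI) (simp add: field_simps del: of_nat_Suc power_Suc)
  show "\<forall>\<^sub>F n in sequentially. (\<Sum>k\<le>n. real (Suc k) ^ q) / real (Suc n) ^ Suc q
      \<le> (real (Suc n + 1) / real (Suc n)) ^ Suc q / real (Suc q)"
    using power_sum_bounds(2)[where q = q]
    by (intro always_eventually allI) (simp add: field_simps power_divide del: of_nat_Suc power_Suc)
  have "(\<lambda>n. (real (Suc n + 1) / real (Suc n)) ^ Suc q / real (Suc q)) \<longlonglongrightarrow> 1 ^ Suc q / real (Suc q)"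
    by (intro tendsto_intros Suc_ratio_tendsto) auto
  then show "(\<lambda>n. (real (Suc n + 1) / real (Suc n)) ^ Suc q / real (Suc q)) \<longlonglongrightarrow> 1 / real (Suc q)" by simp
qed simp

text \<open>The resonant case. After division by \<open>r ^ n\<close> the factor \<open>f\<close>,
  which stands for walks inside one primitive block, tends to a constant, while \<open>g\<close>
  behaves like \<open>k ^ q\<close>, whose sums have order \<open>n ^ Suc q\<close>. Toeplitz's
  theorem is applied twice: first to sum \<open>g\<close>, then with the reversed values of
  \<open>g\<close> as weights for \<open>f\<close>.\<close>

lemma asy_convolution_eq:
  assumes "asy f 0 r" "asy g q r" "\<And>n. g n \<ge> 0"
  shows "asy (\<lambda>n. \<Sum>k\<le>n. f k * g (n - k)) (Suc q) r"
proof -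
  from assms(1) obtain \<alpha> where \<alpha>: "r > 0" "\<alpha> > 0" "(\<lambda>n. f n / pexp 0 r n) \<longlonglongrightarrow> \<alpha>"
    by (rule asyE)
  from assms(2) obtain \<beta> where \<beta>: "r > 0" "\<beta> > 0" "(\<lambda>n. g n / pexp q r n) \<longlonglongrightarrow> \<beta>"
    by (rule asyE)
  note r = \<alpha>(1)
  define b where "b = (\<lambda>n. g n / r ^ n)"
  have b0: "b n \<ge> 0" for n using r assms(3) by (simp add: b_def)
  have inv0: "(\<lambda>n. 1 / real (Suc n)) \<longlonglongrightarrow> 0" by real_asymp
  have "(\<lambda>n. \<Sum>k\<le>n. real (Suc k) ^ q / real (Suc n) ^ Suc q * (g k / pexp q r k)) \<longlonglongrightarrow> 1 / real (Suc q) * \<beta>"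
  proof (rule toeplitz)
    show "(\<lambda>n. real (Suc k) ^ q / real (Suc n) ^ Suc q) \<longlonglongrightarrow> 0" for k
    proof -
      have "(\<lambda>n. real (Suc k) ^ q * (1 / real (Suc n)) ^ Suc q) \<longlonglongrightarrow> real (Suc k) ^ q * 0 ^ Suc q"
        by (intro tendsto_intros inv0)
      then show ?thesis by (simp add: power_divide del: of_nat_Suc power_Suc)
    qed
    show "(\<lambda>n. \<Sum>k\<le>n. real (Suc k) ^ q / real (Suc n) ^ Suc q) \<longlonglongrightarrow> 1 / real (Suc q)"
      using power_sum_tendsto[of q] by (simp only: sum_divide_distrib)
  qed (use \<beta> in auto)
  then have bsum: "(\<lambda>n. \<Sum>k\<le>n. b k / real (Suc n) ^ Suc q) \<longlonglongrightarrow> \<beta> / real (Suc q)"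
    by (simp add: b_def pexp_def mult.commute mult.left_commute del: of_nat_Suc power_Suc)
  have "(\<lambda>n. \<Sum>k\<le>n. b (n - k) / real (Suc n) ^ Suc q * (f k / pexp 0 r k)) \<longlonglongrightarrow> \<beta> / real (Suc q) * \<alpha>"
  proof (rule toeplitz)
    have "(\<Sum>k\<le>n. b (n - k) / real (Suc n) ^ Suc q) = (\<Sum>k\<le>n. b k / real (Suc n) ^ Suc q)" for n
      by (rule sum.reindex_bij_witness[of _ "\<lambda>k. n - k" "\<lambda>k. n - k"]) auto
    then show "(\<lambda>n. \<Sum>k\<le>n. b (n - k) / real (Suc n) ^ Suc q) \<longlonglongrightarrow> \<beta> / real (Suc q)"
      using bsum by simp
    show "(\<lambda>n. b (n - k) / real (Suc n) ^ Suc q) \<longlonglongrightarrow> 0" for k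
    proof (rule LIMSEQ_offset[of _ k])
      have "(\<lambda>n. (g n / pexp q r n) * (real (Suc n) / real (Suc n + k)) ^ q * (1 / real (Suc n + k))) \<longlonglongrightarrow> \<beta> * 1 ^ q * 0"
      proof (intro tendsto_intros \<beta>)
        show "(\<lambda>n. real (Suc n) / real (Suc n + k)) \<longlonglongrightarrow> 1" by real_asymp
        show "(\<lambda>n. 1 / real (Suc n + k)) \<longlonglongrightarrow> 0" by real_asymp
      qed
      moreover have "(g n / pexp q r n) * (real (Suc n) / real (Suc n + k)) ^ q * (1 / real (Suc n + k)) =
          b (n + k - k) / real (Suc (n + k)) ^ Suc q" for n
        by (simp add: b_def pexp_def power_divide del: of_nat_Suc)
      ultimately show "(\<lambda>n. b (n + k - k) / real (Suc (n + k)) ^ Suc q) \<longlonglongrightarrow> 0" by simp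
    qed
  qed (use b0 \<alpha> in auto)
  moreover have "(\<Sum>k\<le>n. b (n - k) / real (Suc n) ^ Suc q * (f k / pexp 0 r k)) =
      (\<Sum>k\<le>n. f k * g (n - k)) / pexp (Suc q) r n" for n
    unfolding sum_divide_distrib
  proof (rule sum.cong)
    fix k assume "k \<in> {..n}"
    then have "r ^ n = r ^ k * r ^ (n - k)" by (simp flip: power_add)
    then show "b (n - k) / real (Suc n) ^ Suc q * (f k / pexp 0 r k) = f k * g (n - k) / pexp (Suc q) r n"
      by (simp add: b_def pexp_def mult_ac)
  qed simp
  ultimately show ?thesis using \<alpha> \<beta> by (intro asyI[of _ "\<beta> / real (Suc q) * \<alpha>"]) auto
qed

lemma asy_bound:
  assumes "asy f q L"
  obtains C where "C > 0" "\<And>n. \<bar>f n\<bar> \<le> C * pexp q L n"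
proof -
  from assms obtain c where c: "L > 0" "(\<lambda>n. f n / pexp q L n) \<longlonglongrightarrow> c" by (rule asyE)
  obtain C where C: "C > 0" "\<And>n. \<bar>f n / pexp q L n\<bar> \<le> C"
    using convergent_imp_Bseq[OF convergentI[OF c(2)]] unfolding Bseq_def by auto
  have "\<bar>f n\<bar> \<le> C * pexp q L n" for n
    using C(2)[of n] pexp_pos[OF c(1), of q n] by (simp add: field_simps)
  with C(1) show ?thesis by (rule that)
qed

text \<open>The slower factor is summable after division by \<open>L ^ k\<close>, so the convolution
  follows \<open>g\<close> up to the constant \<open>\<Sum>k. f k / L ^ k\<close>. Tannery's theorem
  justifies exchanging limit and sum.\<close>

lemma asy_convolution_less:
  assumes "asy f p r" "asy g q L" "r < L" "\<And>n. f n \<ge> 0" "\<And>n. g n \<ge> 0"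
  shows "asy (\<lambda>n. \<Sum>k\<le>n. f k * g (n - k)) q L"
proof -
  from assms(1) have r: "r > 0" by (simp add: asy_def)
  from assms(2) obtain \<beta> where \<beta>: "L > 0" "\<beta> > 0" "(\<lambda>n. g n / pexp q L n) \<longlonglongrightarrow> \<beta>"
    by (rule asyE)
  obtain A where A: "A > 0" "\<And>n. \<bar>f n\<bar> \<le> A * pexp p r n" by (rule asy_bound[OF assms(1)]) blast
  obtain C where C: "C > 0" "\<And>n. \<bar>g n\<bar> \<le> C * pexp q L n" by (rule asy_bound[OF assms(2)]) blast
  \<comment> \<open>Extending by 0 beyond \<open>n\<close> turns the finite convolution into a
    series over a fixed index set, as Tannery's theorem requires.\<close>
  define a where "a = (\<lambda>k n. if k \<le> n then f k * g (n - k) / pexp q L n else 0)"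
  define h where "h = (\<lambda>k. f k / L ^ k)"
  define M where "M = (\<lambda>k. A * C * (real (Suc k) ^ p * (r / L) ^ k))"
  have lim: "((\<lambda>n. a k n) \<longlongrightarrow> h k * \<beta>) sequentially" for k
  proof -
    have "(\<lambda>n. f k * (g n / pexp q L n) / (pexp q L (n + k) / pexp q L n)) \<longlonglongrightarrow> f k * \<beta> / L ^ k"
      using \<beta> by (intro tendsto_intros pexp_shift_ratio) auto
    moreover have "f k * (g n / pexp q L n) / (pexp q L (n + k) / pexp q L n) = a k (n + k)" for n
      using pexp_pos[OF \<beta>(1), of q n] by (simp add: a_def)
    ultimately have "(\<lambda>n. a k (n + k)) \<longlonglongrightarrow> h k * \<beta>" by (simp add: h_def)
    then show ?thesis by (rule LIMSEQ_offset)
  qed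
  have bd: "norm (a k n) \<le> M k" for k n
  proof (cases "k \<le> n")
    case True
    \<comment> \<open>Enlarging the polynomial factor to its value at \<open>n\<close> makes it
      cancel against \<open>pexp q L n\<close>, which leaves a bound independent of
      \<open>n\<close>.\<close>
    have "pexp q L (n - k) \<le> real (Suc n) ^ q * L ^ (n - k)"
      unfolding pexp_def using \<beta> by (intro mult_right_mono power_mono) auto
    then have "\<bar>g (n - k)\<bar> \<le> C * (real (Suc n) ^ q * L ^ (n - k))"
      using C(1) by (intro order_trans[OF C(2)] mult_left_mono) auto
    then have "\<bar>f k\<bar> * \<bar>g (n - k)\<bar> \<le> (A * pexp p r k) * (C * (real (Suc n) ^ q * L ^ (n - k)))"
      using A r pexp_pos[OF r, of p k] by (intro mult_mono A) (auto simp: less_imp_le)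
    also have "\<dots> = M k * pexp q L n"
    proof -
      have "L ^ n = L ^ k * L ^ (n - k)" using True by (simp flip: power_add)
      then show ?thesis using \<beta>(1) by (simp add: M_def pexp_def power_divide field_simps)
    qed
    finally show ?thesis using True pexp_pos[OF \<beta>(1), of q n] by (simp add: a_def field_simps abs_mult)
  next
    case False
    then show ?thesis using A C r \<beta> by (simp add: a_def M_def)
  qed
  have sM: "summable M" unfolding M_def
    using assms(3) r by (intro summable_mult summable_poly_geometric) auto
  have "\<forall>\<^sub>F (k, n) in sequentially \<times>\<^sub>F sequentially. norm (a k n) \<le> M k"
    using bd by (intro always_eventually) auto
  from tannerys_theorem[OF lim this sM]
  have T: "summable (\<lambda>k. norm (h k * \<beta>))" "(\<lambda>n. \<Sum>k. a k n) \<longlonglongrightarrow> (\<Sum>k. h k * \<beta>)"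
    by auto
  have suma: "(\<Sum>k. a k n) = (\<Sum>k\<le>n. f k * g (n - k)) / pexp q L n" for n
    by (subst suminf_finite[of "{..n}"]) (auto simp: a_def sum_divide_distrib)
  from eventually_happens[OF asy_eventually_pos[OF assms(1)]] obtain i where i: "f i > 0" by auto
  have "(\<Sum>k. h k * \<beta>) > 0"
    by (rule suminf_pos2[of _ i])
       (use i assms(4) \<beta> T(1) in \<open>auto simp: h_def intro: summable_norm_cancel\<close>)
  with T(2) suma \<beta> show ?thesis by (intro asyI[of _ "\<Sum>k. h k * \<beta>"]) auto
qed

lemma convolution_commute:
  fixes f g :: "nat \<Rightarrow> real"
  shows "(\<Sum>k\<le>n. f k * g (n - k)) = (\<Sum>k\<le>n. g k * f (n - k))"
  by (rule sum.reindex_bij_witness[of _ "\<lambda>k. n - k" "\<lambda>k. n - k"]) auto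

text \<open>The index \<open>n - 1 - k\<close> arises because a walk spends one step on leaving its
  block. When \<open>r > L\<close> the two factors exchange roles and the exponent 0 of
  \<open>f\<close> survives.\<close>

lemma asy_convolution:
  assumes "asy f 0 r" "asy g q L" "\<And>n. f n \<ge> 0" "\<And>n. g n \<ge> 0"
  shows "asy (\<lambda>n. \<Sum>k<n. f k * g (n - 1 - k))
    (if r > L then 0 else if r = L then Suc q else q) (max r L)"
proof -
  have "asy (\<lambda>n. \<Sum>k\<le>n. f k * g (n - k)) (if r > L then 0 else if r = L then Suc q else q) (max r L)"
  proof -
    consider "r > L" | "r = L" | "r < L" by linarith
    then show ?thesis
    proof cases
      case 1
      then show ?thesis using asy_convolution_less[OF assms(2,1) 1 assms(4,3)]
        by (simp add: convolution_commute[of f g])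
    next
      case 2
      then show ?thesis using asy_convolution_eq[of f r g q] assms by simp
    next
      case 3
      then show ?thesis using asy_convolution_less[OF assms(1,2) 3 assms(3,4)] by simp
    qed
  qed
  then show ?thesis
    using asy_shift_iff[of "\<lambda>n. \<Sum>k<n. f k * g (n - 1 - k)" 1] by (simp add: lessThan_Suc_atMost)
qed

section \<open>Uniqueness of the rate and passage to logarithms\<close>

text \<open>A rate strictly between two different rates absorbs every polynomial factor of the
  smaller one and is still negligible against the larger. This makes the definite description in
  \<open>Lambda_M_deg\<close> meaningful.\<close>

lemma asy_growth_unique:
  assumes "asy f q L" "asy f q' L'" shows "L = L'"
proof -
  have False if "asy f q L" "asy f q' L'" "L < L'" for q L q' L'
  proof -
    from that(2) obtain c where c: "L' > 0" "c > 0" "(\<lambda>n. f n / pexp q' L' n) \<longlonglongrightarrow> c"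
      by (rule asyE)
    define K where "K = (L + L') / 2"
    have K: "L > 0" "L < K" "K < L'" using that by (auto simp: K_def asy_def)
    from that(1) K have "\<exists>d\<ge>0. (\<lambda>n. f n / pexp 0 K n) \<longlonglongrightarrow> d"
      by (intro asy_ratio_convergent) (auto simp: grows_le_def)
    then obtain d where d: "(\<lambda>n. f n / pexp 0 K n) \<longlonglongrightarrow> d" by auto
    have "(\<lambda>n. (K / L') ^ n) \<longlonglongrightarrow> 0" using K by (intro LIMSEQ_realpow_zero) auto
    from tendsto_mult[OF d this] have "(\<lambda>n. f n / pexp 0 L' n) \<longlonglongrightarrow> 0"
      using K by (simp add: pexp_def power_divide)
    then have "(\<lambda>n. norm (f n / pexp 0 L' n)) \<longlonglongrightarrow> 0" by (rule tendsto_norm_zero)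
    then have "(\<lambda>n. f n / pexp q' L' n) \<longlonglongrightarrow> 0"
    proof (rule Lim_null_comparison[rotated], intro always_eventually allI)
      fix n
      have "1 * L' ^ n \<le> pexp q' L' n" unfolding pexp_def
        using c by (intro mult_right_mono one_le_power) auto
      then show "norm (f n / pexp q' L' n) \<le> norm (f n / pexp 0 L' n)"
        using c(1) pexp_pos[OF c(1), of q' n] by (simp add: pexp_def[of 0] divide_left_mono)
    qed
    from LIMSEQ_unique[OF c(3) this] c show False by simp
  qed
  with assms show ?thesis by (metis linorder_neqE)
qed

text \<open>Translates to the normalisation of \<open>c_deg\<close> and \<open>Lambda_M_deg\<close>,
  whose denominator may vanish at \<open>n = 0\<close>; the two quotients differ by a factor tending
  to 1.\<close>

lemma pexp_limit_iff:
  assumes "L > 0"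
  shows "(\<lambda>n. f n / (real n ^ q * L ^ n)) \<longlonglongrightarrow> c \<longleftrightarrow> (\<lambda>n. f n / pexp q L n) \<longlonglongrightarrow> c"
proof -
  have lim: "(\<lambda>n. (real n / real (Suc n)) ^ q) \<longlonglongrightarrow> 1 ^ q" by (intro tendsto_power) real_asymp
  have lim': "(\<lambda>n. (real (Suc n) / real n) ^ q) \<longlonglongrightarrow> 1 ^ q" by (intro tendsto_power) real_asymp
  show ?thesis
  proof
    assume "(\<lambda>n. f n / (real n ^ q * L ^ n)) \<longlonglongrightarrow> c"
    from tendsto_mult[OF this lim]
    have "(\<lambda>n. f n / (real n ^ q * L ^ n) * (real n / real (Suc n)) ^ q) \<longlonglongrightarrow> c" by simp
    then show "(\<lambda>n. f n / pexp q L n) \<longlonglongrightarrow> c"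
      by (rule Lim_transform_eventually)
         (use eventually_gt_at_top[of 0] in eventually_elim, simp add: pexp_def power_divide)
  next
    assume "(\<lambda>n. f n / pexp q L n) \<longlonglongrightarrow> c"
    from tendsto_mult[OF this lim']
    have "(\<lambda>n. f n / pexp q L n * (real (Suc n) / real n) ^ q) \<longlonglongrightarrow> c" by simp
    then show "(\<lambda>n. f n / (real n ^ q * L ^ n)) \<longlonglongrightarrow> c"
      by (rule Lim_transform_eventually)
         (use eventually_gt_at_top[of 0] in eventually_elim, simp add: pexp_def power_divide)
  qed
qed

lemma asymp_const_iff_asy:
  "L > 0 \<Longrightarrow> asymp_const f (\<lambda>m. real m ^ q * L ^ m) \<longleftrightarrow> asy f q L"
  by (simp add: asymp_const_def asy_def pexp_limit_iff)

lemma asy_cong: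
  assumes "eventually (\<lambda>n. f n = g n) sequentially"
  shows "asy f q L \<longleftrightarrow> asy g q L"
proof -
  have "eventually (\<lambda>n. f n / pexp q L n = g n / pexp q L n) sequentially"
    using assms by eventually_elim simp
  from tendsto_cong[OF this] show ?thesis by (simp add: asy_def asymp_const_def)
qed

text \<open>Types of one class reach the same limit degree at integer offsets, possibly negative
  ones; truncation by \<open>nat\<close> then affects only finitely many terms.\<close>

lemma asy_int_shift:
  assumes "asy f q L"
  shows "asy (\<lambda>m. f (nat (int m + k))) q L"
proof (cases "k \<ge> 0")
  case True
  then have "(\<lambda>m. f (nat (int m + k))) = (\<lambda>m. f (m + nat k))"
    by (simp add: nat_add_distrib)
  then show ?thesis using assms by (simp add: asy_shift_iff)
next
  case False
  then have "(\<lambda>m. f (nat (int (m + nat (- k)) + k))) = f" by simp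
  then show ?thesis using assms asy_shift_iff[of "\<lambda>m. f (nat (int m + k))" "nat (- k)"] by simp
qed

text \<open>On the logarithmic scale the constant and the exponent disappear, so the dimension
  depends on rates alone.\<close>

lemma asy_ln_tendsto:
  assumes "asy f q L"
  shows "(\<lambda>n. ln (f n) / real n) \<longlonglongrightarrow> ln L"
proof -
  from assms obtain c where c: "L > 0" "c > 0" "(\<lambda>n. f n / pexp q L n) \<longlonglongrightarrow> c"
    by (rule asyE)
  have "(\<lambda>n. ln (f n / pexp q L n)) \<longlonglongrightarrow> ln c" using c by (intro tendsto_ln) auto
  moreover have "(\<lambda>n. 1 / real n) \<longlonglongrightarrow> 0" by real_asymp
  ultimately have 1: "(\<lambda>n. ln (f n / pexp q L n) * (1 / real n)) \<longlonglongrightarrow> ln c * 0" by (rule tendsto_mult)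
  have "(\<lambda>n. real q * (ln (real (Suc n)) / real n) + ln L) \<longlonglongrightarrow> real q * 0 + ln L"
    by (intro tendsto_intros) real_asymp
  from tendsto_add[OF 1 this]
  have "(\<lambda>n. ln (f n / pexp q L n) * (1 / real n) + (real q * (ln (real (Suc n)) / real n) + ln L)) \<longlonglongrightarrow> ln L"
    by simp
  then show ?thesis
  proof (rule Lim_transform_eventually)
    show "\<forall>\<^sub>F n in sequentially. ln (f n / pexp q L n) * (1 / real n) + (real q * (ln (real (Suc n)) / real n) + ln L) = ln (f n) / real n"
      using asy_eventually_pos[OF assms] eventually_gt_at_top[of 0]
    proof eventually_elim
      case (elim n)
      have "ln (f n / pexp q L n) = ln (f n) - (real q * ln (real (Suc n)) + real n * ln L)"
        using elim c(1) pexp_pos[OF c(1), of q n]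
        by (subst ln_div) (simp_all add: pexp_def ln_mult ln_realpow del: of_nat_Suc)
      then show ?case using elim by (simp add: field_simps)
    qed
  qed
qed

section \<open>Powers of primitive matrices\<close>

lemma pow_mat_Suc_left:
  assumes "A \<in> carrier_mat n n"
  shows "A ^\<^sub>m Suc k = A * A ^\<^sub>m k"
proof (induction k)
  case 0
  show ?case using assms by simp
next
  case (Suc k)
  have "A ^\<^sub>m Suc (Suc k) = (A * A ^\<^sub>m k) * A" using Suc by simp
  also have "\<dots> = A * (A ^\<^sub>m k * A)" using assms by (intro assoc_mult_mat) auto
  finally show ?case by simp
qed

lemma pow_mat_add:
  assumes "A \<in> carrier_mat n n"
  shows "A ^\<^sub>m (k + l) = A ^\<^sub>m k * A ^\<^sub>m l"
proof (induction l)
  case 0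
  show ?case using assms pow_carrier_mat[OF assms, of k] by simp
next
  case (Suc l)
  then have "A ^\<^sub>m (k + Suc l) = (A ^\<^sub>m k * A ^\<^sub>m l) * A" by simp
  also have "\<dots> = A ^\<^sub>m k * (A ^\<^sub>m l * A)"
    using assms pow_carrier_mat[OF assms] by (intro assoc_mult_mat) auto
  finally show ?case by simp
qed

lemma pow_mat_0_index:
  assumes "A \<in> carrier_mat n n" "i < n" "j < n"
  shows "(A ^\<^sub>m 0) $$ (i, j) = (if i = j then 1 else 0)"
  using assms by simp

lemma pow_mat_Suc_left_index:
  fixes A :: "'a :: comm_ring_1 mat"
  assumes "A \<in> carrier_mat n n" "i < n" "j < n"
  shows "(A ^\<^sub>m Suc k) $$ (i, j) = (\<Sum>l<n. A $$ (i, l) * (A ^\<^sub>m k) $$ (l, j))"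
  using assms pow_carrier_mat[OF assms(1), of k]
  by (simp add: pow_mat_Suc_left[OF assms(1)] scalar_prod_def atLeast0LessThan del: pow_mat.simps)

lemma pow_mat_add_index:
  fixes A :: "'a :: comm_ring_1 mat"
  assumes "A \<in> carrier_mat n n" "i < n" "j < n"
  shows "(A ^\<^sub>m (k + m)) $$ (i, j) = (\<Sum>l<n. (A ^\<^sub>m k) $$ (i, l) * (A ^\<^sub>m m) $$ (l, j))"
  using assms pow_carrier_mat[OF assms(1), of k] pow_carrier_mat[OF assms(1), of m]
  by (simp add: pow_mat_add[OF assms(1)] scalar_prod_def atLeast0LessThan)

lemma pow_mat_nonneg:
  fixes A :: "real mat"
  assumes "A \<in> carrier_mat n n" "\<And>i j. i < n \<Longrightarrow> j < n \<Longrightarrow> A $$ (i, j) \<ge> 0" "i < n" "j < n"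
  shows "(A ^\<^sub>m k) $$ (i, j) \<ge> 0"
  using assms(3)
proof (induction k arbitrary: i)
  case 0
  then show ?case using assms by (simp add: pow_mat_0_index)
next
  case (Suc k)
  then show ?case
    unfolding pow_mat_Suc_left_index[OF assms(1) Suc.prems assms(4)]
    by (intro sum_nonneg mult_nonneg_nonneg assms) auto
qed

section \<open>Perron eigenvectors and convergence of rescaled powers\<close>

lemma pow_mat_mult_eq_scale:
  fixes A :: "real mat"
  assumes "A \<in> carrier_mat n n" "\<And>i. i < n \<Longrightarrow> (\<Sum>j<n. A $$ (i, j) * z j) = r * z i" "i < n"
  shows "(\<Sum>j<n. (A ^\<^sub>m k) $$ (i, j) * z j) = r ^ k * z i"
  using assms(3)
proof (induction k arbitrary: i)
  case 0
  have "(\<Sum>j<n. (A ^\<^sub>m 0) $$ (i, j) * z j) = (\<Sum>j<n. if i = j then z j else 0)"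
    using 0 assms(1) by (intro sum.cong) auto
  then show ?case using 0 by simp
next
  case (Suc k)
  have "(\<Sum>j<n. (A ^\<^sub>m Suc k) $$ (i, j) * z j) =
      (\<Sum>j<n. \<Sum>l<n. A $$ (i, l) * ((A ^\<^sub>m k) $$ (l, j) * z j))"
    using Suc.prems by (intro sum.cong refl)
      (simp add: pow_mat_Suc_left_index[OF assms(1)] sum_distrib_right mult.assoc del: pow_mat.simps)
  also have "\<dots> = (\<Sum>l<n. A $$ (i, l) * (\<Sum>j<n. (A ^\<^sub>m k) $$ (l, j) * z j))"
    by (subst sum.swap) (simp add: sum_distrib_left)
  also have "\<dots> = (\<Sum>l<n. r ^ k * (A $$ (i, l) * z l))" by (intro sum.cong refl) (simp add: Suc.IH)
  also have "\<dots> = r ^ Suc k * z i" using assms(2)[OF Suc.prems] by (simp flip: sum_distrib_left)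
  finally show ?case .
qed

text \<open>The modulus of an eigenvector for an eigenvalue of maximal modulus.\<close>

lemma subinvariant_vector_exists:
  fixes A :: "real mat"
  assumes A: "A \<in> carrier_mat n n" and n: "n > 0"
    and nonneg: "\<And>i j. i < n \<Longrightarrow> j < n \<Longrightarrow> A $$ (i, j) \<ge> 0"
  obtains z :: "nat \<Rightarrow> real" where "\<And>i. i < n \<Longrightarrow> z i \<ge> 0" "\<exists>i<n. z i > 0"
    "\<And>i. i < n \<Longrightarrow> spectral_radius (map_mat complex_of_real A) * z i \<le> (\<Sum>j<n. A $$ (i, j) * z j)"
proof -
  let ?C = "map_mat complex_of_real A"
  let ?r = "spectral_radius ?C"
  have C: "?C \<in> carrier_mat n n" using A by simp
  from spectral_radius_mem_max(1)[OF C n] obtain ev v where ev: "eigenvector ?C v ev" "norm ev = ?r"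
    by (auto simp: spectrum_def eigenvalue_def)
  then have v: "v \<in> carrier_vec n" "v \<noteq> 0\<^sub>v n" "?C *\<^sub>v v = ev \<cdot>\<^sub>v v"
    using A by (auto simp: eigenvector_def)
  show ?thesis
  proof
    show "0 \<le> norm (v $ i)" for i by simp
    show "\<exists>i<n. norm (v $ i) > 0"
    proof (rule ccontr)
      assume "\<not> ?thesis"
      then have "v = 0\<^sub>v n" using v(1) by (intro eq_vecI) auto
      with v(2) show False by simp
    qed
    fix i assume i: "i < n"
    have "ev * v $ i = (?C *\<^sub>v v) $ i" using v i by simp
    also have "\<dots> = (\<Sum>j<n. complex_of_real (A $$ (i, j)) * v $ j)"
      using v(1) i A by (simp add: scalar_prod_def atLeast0LessThan)
    finally have "?r * norm (v $ i) = norm (\<Sum>j<n. complex_of_real (A $$ (i, j)) * v $ j)"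
      by (simp flip: ev(2) norm_mult)
    also have "\<dots> \<le> (\<Sum>j<n. A $$ (i, j) * norm (v $ j))"
      by (rule order_trans[OF norm_sum]) (use nonneg[OF i] in \<open>auto simp: norm_mult\<close>)
    finally show "?r * norm (v $ i) \<le> (\<Sum>j<n. A $$ (i, j) * norm (v $ j))" .
  qed
qed

text \<open>One half of the Collatz-Wielandt characterisation. If the radius were below some
  \<open>t < s\<close>, the powers of \<open>A / t\<close> would stay bounded by the Jordan normal
  form estimate, whereas \<open>w\<close> forces them to grow like
  \<open>(s / t) ^ k\<close>.\<close>

lemma spectral_radius_ge_of_superinvariant:
  fixes A :: "real mat"
  assumes A: "A \<in> carrier_mat n n" and n: "n > 0"
    and nonneg: "\<And>i j. i < n \<Longrightarrow> j < n \<Longrightarrow> A $$ (i, j) \<ge> 0"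
    and w: "\<And>i. i < n \<Longrightarrow> w i > 0" "\<And>i. i < n \<Longrightarrow> s * w i \<le> (\<Sum>j<n. A $$ (i, j) * w j)"
    and s: "s > 0"
  shows "spectral_radius (map_mat complex_of_real A) \<ge> s"
proof (rule ccontr)
  let ?C = "map_mat complex_of_real A"
  assume "\<not> ?thesis"
  then obtain t where t: "spectral_radius ?C < t" "t < s" "t > 0"
    using s dense[of "max 0 (spectral_radius ?C)" s] by auto
  define B where "B = (1 / t) \<cdot>\<^sub>m A"
  have B: "B \<in> carrier_mat n n" using A by (simp add: B_def)
  let ?D = "map_mat complex_of_real B"
  have D: "?D \<in> carrier_mat n n" using B by simp
  have "spectral_radius ?D < 1"
  proof -
    from spectral_radius_mem_max(1)[OF D n] obtain ev v where
      ev: "eigenvector ?D v ev" "norm ev = spectral_radius ?D"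
      by (auto simp: spectrum_def eigenvalue_def)
    have v: "v \<in> carrier_vec n" "v \<noteq> 0\<^sub>v n" "?D *\<^sub>v v = ev \<cdot>\<^sub>v v"
      using ev(1) B by (auto simp: eigenvector_def)
    have "?C = complex_of_real t \<cdot>\<^sub>m ?D" using t A by (intro eq_matI) (auto simp: B_def)
    then have "?C *\<^sub>v v = complex_of_real t \<cdot>\<^sub>v (?D *\<^sub>v v)"
      using v(1) D by (intro eq_vecI) (simp_all add: scalar_prod_def sum_distrib_left mult.assoc)
    also have "\<dots> = (complex_of_real t * ev) \<cdot>\<^sub>v v" unfolding v(3) by (simp add: smult_smult_assoc)
    finally have "eigenvector ?C v (complex_of_real t * ev)"
      using v A by (simp add: eigenvector_def)
    then have "norm (complex_of_real t * ev) \<in> norm ` spectrum ?C"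
      unfolding spectrum_def eigenvalue_def by blast
    from spectral_radius_mem_max(2)[OF _ n this] A have "t * norm ev \<le> spectral_radius ?C"
      using t by (simp add: norm_mult)
    then have "t * norm ev < t * 1" using t(1) by linarith
    then have "norm ev < 1" using t(3) by (simp only: mult_less_cancel_left_pos)
    then show ?thesis using ev(2) by simp
  qed
  from spectral_radius_jnf_norm_bound_less_1_upper_triangular[OF D this] obtain c where
    c: "\<And>k. norm_bound (?D ^\<^sub>m k) c" by auto
  have "?D ^\<^sub>m k = map_mat complex_of_real (B ^\<^sub>m k)" for k
    by (rule of_real_hom.mat_hom_pow[OF B, symmetric])
  with c have bd: "\<bar>(B ^\<^sub>m k) $$ (i, j)\<bar> \<le> c" if "i < n" "j < n" for i j k
    using that B pow_carrier_mat[OF B, of k] unfolding norm_bound_def by simp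
  have B0: "B $$ (i, j) \<ge> 0" if "i < n" "j < n" for i j
    using that A t nonneg by (simp add: B_def)
  have sup: "(s / t) ^ k * w i \<le> (\<Sum>j<n. (B ^\<^sub>m k) $$ (i, j) * w j)" if "i < n" for i k
    using that
  proof (induction k arbitrary: i)
    case 0
    have "(\<Sum>j<n. (B ^\<^sub>m 0) $$ (i, j) * w j) = (\<Sum>j<n. if i = j then w j else 0)"
      using 0 B by (intro sum.cong) auto
    then show ?case using 0 by simp
  next
    case (Suc k)
    have "(s / t) ^ Suc k * w i = (s / t) ^ k * (s * w i / t)" by simp
    also have "\<dots> \<le> (s / t) ^ k * ((\<Sum>l<n. A $$ (i, l) * w l) / t)"
      using w(2)[OF Suc.prems] s t by (intro mult_left_mono divide_right_mono) auto
    also have "\<dots> = (\<Sum>l<n. B $$ (i, l) * ((s / t) ^ k * w l))"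
      using A Suc.prems by (simp add: B_def sum_distrib_left sum_divide_distrib mult_ac)
    also have "\<dots> \<le> (\<Sum>l<n. B $$ (i, l) * (\<Sum>j<n. (B ^\<^sub>m k) $$ (l, j) * w j))"
      using Suc by (intro sum_mono mult_left_mono B0) auto
    also have "\<dots> = (\<Sum>j<n. \<Sum>l<n. B $$ (i, l) * ((B ^\<^sub>m k) $$ (l, j) * w j))"
      by (subst sum.swap) (simp add: sum_distrib_left)
    also have "\<dots> = (\<Sum>j<n. (B ^\<^sub>m Suc k) $$ (i, j) * w j)"
      using Suc.prems by (intro sum.cong refl)
        (simp add: pow_mat_Suc_left_index[OF B] sum_distrib_right mult.assoc del: pow_mat.simps)
    finally show ?case .
  qed
  have "(s / t) ^ k * w 0 \<le> c * (\<Sum>j<n. w j)" for k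
  proof -
    have "(\<Sum>j<n. (B ^\<^sub>m k) $$ (0, j) * w j) \<le> (\<Sum>j<n. c * w j)"
    proof (intro sum_mono mult_right_mono)
      fix j assume j: "j \<in> {..<n}"
      show "(B ^\<^sub>m k) $$ (0, j) \<le> c" using bd[of 0 j k] j n by auto
      show "0 \<le> w j" using w(1)[of j] j by simp
    qed
    then show ?thesis using sup[of 0 k] n by (simp add: sum_distrib_left)
  qed
  then have "(s / t) ^ k \<le> c * (\<Sum>j<n. w j) / w 0" for k
    using w(1)[of 0] n by (simp add: field_simps)
  moreover obtain k where "c * (\<Sum>j<n. w j) / w 0 < (s / t) ^ k"
    using real_arch_pow[of "s / t" "c * (\<Sum>j<n. w j) / w 0"] t by auto
  ultimately show False by (meson not_le)
qed

text \<open>The defect \<open>y\<close> of the subinvariant vector \<open>z\<close> is nonnegative.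
  If it were nonzero, the positive power would spread it to all coordinates, so \<open>w\<close>,
  the image of \<open>z\<close> under that power, would satisfy a superinvariance with a constant
  exceeding the spectral radius. Hence \<open>z\<close> is an eigenvector, and comparison with
  \<open>w > 0\<close> makes both the radius and \<open>z\<close> positive.\<close>

lemma primitive_mat_positive_eigenvector:
  fixes A :: "real mat"
  assumes A: "A \<in> carrier_mat n n" and n: "n > 0"
    and nonneg: "\<And>i j. i < n \<Longrightarrow> j < n \<Longrightarrow> A $$ (i, j) \<ge> 0"
    and N: "\<And>i j. i < n \<Longrightarrow> j < n \<Longrightarrow> (A ^\<^sub>m N) $$ (i, j) > 0" "N \<ge> 1"
  obtains z :: "nat \<Rightarrow> real" where "spectral_radius (map_mat complex_of_real A) > 0"
    "\<And>i. i < n \<Longrightarrow> z i > 0"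
    "\<And>i. i < n \<Longrightarrow> (\<Sum>j<n. A $$ (i, j) * z j) = spectral_radius (map_mat complex_of_real A) * z i"
proof -
  let ?r = "spectral_radius (map_mat complex_of_real A)"
  obtain z where z: "\<And>i. i < n \<Longrightarrow> z i \<ge> 0" "\<exists>i<n. z i > 0"
    "\<And>i. i < n \<Longrightarrow> ?r * z i \<le> (\<Sum>j<n. A $$ (i, j) * z j)"
    using subinvariant_vector_exists[OF A n nonneg] by blast
  define y where "y = (\<lambda>i. (\<Sum>j<n. A $$ (i, j) * z j) - ?r * z i)"
  have y0: "y i \<ge> 0" if "i < n" for i using z(3)[OF that] by (simp add: y_def)
  define w where "w = (\<lambda>i. \<Sum>j<n. (A ^\<^sub>m N) $$ (i, j) * z j)"
  have w0: "w i > 0" if "i < n" for i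
  proof -
    from z(2) obtain j where j: "j < n" "z j > 0" by auto
    show ?thesis unfolding w_def
      by (rule sum_pos2[of _ j]) (use j that N z in \<open>auto simp: less_imp_le\<close>)
  qed
  have comm: "(\<Sum>j<n. A $$ (i, j) * w j) = ?r * w i + (\<Sum>j<n. (A ^\<^sub>m N) $$ (i, j) * y j)" if "i < n" for i
  proof -
    have "(\<Sum>j<n. A $$ (i, j) * w j) = (\<Sum>l<n. (A ^\<^sub>m Suc N) $$ (i, l) * z l)"
      unfolding w_def sum_distrib_left
      by (subst sum.swap, intro sum.cong refl)
        (simp add: pow_mat_Suc_left_index[OF A that] sum_distrib_right mult.assoc del: pow_mat.simps)
    also have "\<dots> = (\<Sum>l<n. (\<Sum>j<n. (A ^\<^sub>m N) $$ (i, j) * A $$ (j, l)) * z l)"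
    proof (intro sum.cong refl)
      fix l assume "l \<in> {..<n}"
      then show "(A ^\<^sub>m Suc N) $$ (i, l) * z l = (\<Sum>j<n. (A ^\<^sub>m N) $$ (i, j) * A $$ (j, l)) * z l"
        using pow_mat_add_index[OF A that, of l N 1] A by simp
    qed
    also have "\<dots> = (\<Sum>j<n. (A ^\<^sub>m N) $$ (i, j) * (\<Sum>l<n. A $$ (j, l) * z l))"
      unfolding sum_distrib_left sum_distrib_right by (subst sum.swap) (simp add: mult.assoc)
    also have "\<dots> = (\<Sum>j<n. ?r * ((A ^\<^sub>m N) $$ (i, j) * z j) + (A ^\<^sub>m N) $$ (i, j) * y j)"
      by (intro sum.cong refl) (simp add: y_def algebra_simps)
    finally show ?thesis by (simp add: w_def sum.distrib sum_distrib_left)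
  qed
  have r0: "?r \<ge> 0"
  proof -
    have "?r \<in> norm ` spectrum (map_mat complex_of_real A)"
      by (rule spectral_radius_mem_max(1)[OF _ n]) (use A in simp)
    then show ?thesis by auto
  qed
  have "y i = 0" if i: "i < n" for i
  proof (rule ccontr)
    assume "y i \<noteq> 0"
    with y0[OF i] have yi: "y i > 0" by simp
    \<comment> \<open>The least relative defect of \<open>w\<close>, by which the superinvariance
      constant exceeds the radius.\<close>
    define e where "e = Min ((\<lambda>j. (\<Sum>l<n. (A ^\<^sub>m N) $$ (j, l) * y l) / w j) ` {..<n})"
    have e0: "e > 0"
      unfolding e_def
    proof (subst Min_gr_iff; (use n in fastforce)?; clarsimp)
      fix j assume j: "j < n"
      have "(\<Sum>l<n. (A ^\<^sub>m N) $$ (j, l) * y l) > 0"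
        by (rule sum_pos2[of _ i]) (use i yi j N(1) y0 in \<open>auto simp: less_imp_le\<close>)
      then show "0 < (\<Sum>l<n. (A ^\<^sub>m N) $$ (j, l) * y l) / w j" using w0[OF j] by simp
    qed
    have ge: "(?r + e) * w j \<le> (\<Sum>l<n. A $$ (j, l) * w l)" if j: "j < n" for j
    proof -
      have "e \<le> (\<Sum>l<n. (A ^\<^sub>m N) $$ (j, l) * y l) / w j"
        unfolding e_def using j by (intro Min_le) auto
      then have "e * w j \<le> (\<Sum>l<n. (A ^\<^sub>m N) $$ (j, l) * y l)" using w0[OF j] by (simp add: field_simps)
      then show ?thesis using comm[OF j] by (simp add: algebra_simps)
    qed
    have "?r + e \<le> ?r"
      by (rule spectral_radius_ge_of_superinvariant[OF A n nonneg w0 ge]) (use r0 e0 in auto)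
    with e0 show False by simp
  qed
  then have zeq: "(\<Sum>j<n. A $$ (i, j) * z j) = ?r * z i" if "i < n" for i
    using that by (simp add: y_def)
  have pw: "w i = ?r ^ N * z i" if "i < n" for i
    unfolding w_def by (rule pow_mat_mult_eq_scale[OF A zeq that])
  have "?r \<noteq> 0" using pw[OF n] w0[OF n] N(2) by (intro notI) (simp add: power_0_left)
  with r0 have rpos: "?r > 0" by simp
  moreover have "z i > 0" if "i < n" for i
    using pw[OF that] w0[OF that] rpos z(1)[OF that] by (simp add: zero_less_mult_iff)
  ultimately show ?thesis using zeq by (rule that)
qed

text \<open>Doeblin's argument: a stochastic matrix with a positive power contracts the oscillation of vectors.\<close>

lemma stochastic_power_convergent:
  fixes P :: "real mat"
  assumes P: "P \<in> carrier_mat n n" and n: "n > 0"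
    and nonneg: "\<And>i j. i < n \<Longrightarrow> j < n \<Longrightarrow> P $$ (i, j) \<ge> 0"
    and stoch: "\<And>i. i < n \<Longrightarrow> (\<Sum>j<n. P $$ (i, j)) = 1"
    and N: "\<And>i j. i < n \<Longrightarrow> j < n \<Longrightarrow> (P ^\<^sub>m N) $$ (i, j) > 0" "N \<ge> 1"
    and l: "l < n"
  obtains p where "p > 0" "\<And>i. i < n \<Longrightarrow> (\<lambda>k. (P ^\<^sub>m k) $$ (i, l)) \<longlonglongrightarrow> p"
proof -
  define y where "y = (\<lambda>k i. (P ^\<^sub>m k) $$ (i, l))"
  define mx where "mx = (\<lambda>k. Max (y k ` {..<n}))"
  define mn where "mn = (\<lambda>k. Min (y k ` {..<n}))"
  have ne: "{..<n} \<noteq> {}" using n by auto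
  have mx: "y k i \<le> mx k" if "i < n" for k i using that by (auto simp: mx_def intro!: Max_ge)
  have mn: "mn k \<le> y k i" if "i < n" for k i using that by (auto simp: mn_def intro!: Min_le)
  have stochk: "(\<Sum>j<n. (P ^\<^sub>m k) $$ (i, j)) = 1" if "i < n" for i k
    using pow_mat_mult_eq_scale[OF P, of "\<lambda>_. 1" 1 i k] stoch that by simp
  have Pk0: "(P ^\<^sub>m k) $$ (i, j) \<ge> 0" if "i < n" "j < n" for i j k
    by (rule pow_mat_nonneg[OF P nonneg that])
  have step: "y (m + k) i = (\<Sum>j<n. (P ^\<^sub>m m) $$ (i, j) * y k j)" if "i < n" for m k i
    unfolding y_def by (rule pow_mat_add_index[OF P that l])
  have mx_attained: "\<exists>i<n. y k i = mx k" for k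
  proof -
    have "mx k \<in> y k ` {..<n}" unfolding mx_def using ne by (intro Max_in) auto
    then show ?thesis by auto
  qed
  have mn_attained: "\<exists>i<n. y k i = mn k" for k
  proof -
    have "mn k \<in> y k ` {..<n}" unfolding mn_def using ne by (intro Min_in) auto
    then show ?thesis by auto
  qed
  have mx_le: "mx (m + k) \<le> mx k" for m k
  proof -
    obtain i where i: "i < n" "y (m + k) i = mx (m + k)" using mx_attained by blast
    have "y (m + k) i \<le> (\<Sum>j<n. (P ^\<^sub>m m) $$ (i, j) * mx k)"
      unfolding step[OF i(1)] using i by (intro sum_mono mult_left_mono mx Pk0) auto
    then show ?thesis using i stochk[OF i(1), of m] by (simp flip: sum_distrib_right)
  qed
  have mn_ge: "mn k \<le> mn (m + k)" for m k
  proof -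
    obtain i where i: "i < n" "y (m + k) i = mn (m + k)" using mn_attained by blast
    have "y (m + k) i \<ge> (\<Sum>j<n. (P ^\<^sub>m m) $$ (i, j) * mn k)"
      unfolding step[OF i(1)] using i by (intro sum_mono mult_left_mono mn Pk0) auto
    then show ?thesis using i stochk[OF i(1), of m] by (simp flip: sum_distrib_right)
  qed
  define d where "d = Min ((\<lambda>(i, j). (P ^\<^sub>m N) $$ (i, j)) ` ({..<n} \<times> {..<n}))"
  have d0: "d > 0" unfolding d_def using ne N by (subst Min_gr_iff) auto
  have dle: "d \<le> (P ^\<^sub>m N) $$ (i, j)" if "i < n" "j < n" for i j
    unfolding d_def using that by (intro Min_le) auto
  have d1: "d \<le> 1"
  proof -
    have "(P ^\<^sub>m N) $$ (0, 0) \<le> (\<Sum>j<n. (P ^\<^sub>m N) $$ (0, j))"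
      by (rule member_le_sum) (use n Pk0 in auto)
    then show ?thesis using dle[OF n n] stochk[OF n, of N] by simp
  qed
  have mn_le_mx: "mn k \<le> mx k" for k using mx[OF n, of k] mn[OF n, of k] by simp
  \<comment> \<open>Every row of the positive power puts weight at least \<open>d\<close> on a
    coordinate where the minimum is attained. This lowers the maximum by at least \<open>d\<close>
    times the oscillation, while the minimum does not decrease.\<close>
  have contract: "mx (N + k) - mn (N + k) \<le> (1 - d) * (mx k - mn k)" for k
  proof -
    obtain i0 where i0: "i0 < n" "y k i0 = mn k" using mn_attained by blast
    obtain i where i: "i < n" "y (N + k) i = mx (N + k)" using mx_attained by blast
    have "mx k - y (N + k) i = (\<Sum>j<n. (P ^\<^sub>m N) $$ (i, j) * (mx k - y k j))"
      using stochk[OF i(1), of N] by (simp add: step[OF i(1)] right_diff_distrib sum_subtractf flip: sum_distrib_right)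
    moreover have "(P ^\<^sub>m N) $$ (i, i0) * (mx k - y k i0) \<le> (\<Sum>j<n. (P ^\<^sub>m N) $$ (i, j) * (mx k - y k j))"
      using i0 i mx by (intro member_le_sum) (auto intro!: mult_nonneg_nonneg Pk0)
    moreover have "d * (mx k - mn k) \<le> (P ^\<^sub>m N) $$ (i, i0) * (mx k - y k i0)"
      unfolding i0(2) using i i0 mn_le_mx[of k] by (intro mult_right_mono dle) auto
    ultimately have "mx (N + k) \<le> mx k - d * (mx k - mn k)" using i by simp
    then show ?thesis using mn_ge[of k N] by (simp add: algebra_simps)
  qed
  have geo: "mx (j * N) - mn (j * N) \<le> (1 - d) ^ j * (mx 0 - mn 0)" for j
  proof (induction j)
    case (Suc j)
    have "mx (N + j * N) - mn (N + j * N) \<le> (1 - d) * ((1 - d) ^ j * (mx 0 - mn 0))"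
      by (rule order_trans[OF contract]) (use Suc d1 in \<open>auto intro: mult_left_mono\<close>)
    then show ?case by (simp add: add.commute)
  qed simp
  have "decseq mx" by (rule decseq_SucI) (use mx_le[of 1] in simp)
  moreover have mxb: "mx k \<ge> mn 0" for k
    using mn_ge[of 0 k] mn_le_mx[of k] by (simp add: add.commute)
  ultimately obtain p where p: "mx \<longlonglongrightarrow> p" "\<And>k. p \<le> mx k"
    using decseq_convergent[of mx "mn 0"] by blast
  have "incseq mn" by (rule incseq_SucI) (use mn_ge[of _ 1] in simp)
  moreover have "mn k \<le> mx 0" for k
    using mx_le[of k 0] mn_le_mx[of k] by simp
  ultimately obtain q where q: "mn \<longlonglongrightarrow> q" "\<And>k. mn k \<le> q"
    using incseq_convergent[of mn "mx 0"] by blast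
  \<comment> \<open>The contraction controls only multiples of \<open>N\<close>; as
    \<open>mx\<close> and \<open>mn\<close> are monotone, their limits can be read off along this
    subsequence.\<close>
  have sm: "strict_mono (\<lambda>j. j * N)" using N(2) by (intro strict_monoI) simp
  have "(\<lambda>j. mx (j * N) - mn (j * N)) \<longlonglongrightarrow> p - q"
    using LIMSEQ_subseq_LIMSEQ[OF p(1) sm] LIMSEQ_subseq_LIMSEQ[OF q(1) sm]
    by (intro tendsto_diff) (simp_all add: o_def)
  moreover have "(\<lambda>j. (1 - d) ^ j * (mx 0 - mn 0)) \<longlonglongrightarrow> 0 * (mx 0 - mn 0)"
    using d0 d1 by (intro tendsto_intros LIMSEQ_realpow_zero) auto
  ultimately have "p - q \<le> 0"
    using geo by (intro LIMSEQ_le[of _ "p - q" _ 0]) auto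
  moreover have "q \<le> p" by (rule LIMSEQ_le[OF q(1) p(1)]) (use mn_le_mx in auto)
  ultimately have pq: "p = q" by simp
  \<comment> \<open>\<open>y N\<close> is a column of the positive power, so its minimum is
    positive, and the minima only increase towards \<open>p\<close>.\<close>
  have "p > 0"
  proof -
    obtain i where i: "i < n" "y (N + 0) i = mn (N + 0)" using mn_attained by blast
    then have "mn N > 0" using N(1)[OF i(1) l] by (simp add: y_def)
    then show ?thesis using q(2)[of N] pq by simp
  qed
  moreover have "(\<lambda>k. (P ^\<^sub>m k) $$ (i, l)) \<longlonglongrightarrow> p" if "i < n" for i
  proof (rule real_tendsto_sandwich[of mn _ _ mx])
    show "mn \<longlonglongrightarrow> p" using q pq by simp
  qed (use mx[OF that] mn[OF that] p in \<open>auto simp: y_def\<close>)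
  ultimately show ?thesis by (rule that)
qed

text \<open>Conjugation with the diagonal matrix of the Perron eigenvector and division by
  \<open>r\<close>, the Doob transform, produce a stochastic matrix with the same pattern of
  positive entries, to which the contraction argument applies.\<close>

lemma primitive_mat_power_asymptotics:
  fixes A :: "real mat"
  assumes A: "A \<in> carrier_mat n n" and n: "n > 0"
    and nonneg: "\<And>i j. i < n \<Longrightarrow> j < n \<Longrightarrow> A $$ (i, j) \<ge> 0"
    and prim: "primitive_mat A"
  defines "r \<equiv> spectral_radius (map_mat complex_of_real A)"
  shows "r > 0" and "\<And>i j. i < n \<Longrightarrow> j < n \<Longrightarrow> \<exists>p>0. (\<lambda>k. (A ^\<^sub>m k) $$ (i, j) / r ^ k) \<longlonglongrightarrow> p"
proof -
  from prim A obtain N where N: "N \<ge> 1" "\<And>i j. i < n \<Longrightarrow> j < n \<Longrightarrow> (A ^\<^sub>m N) $$ (i, j) > 0"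
    by (auto simp: primitive_mat_def)
  obtain z where z: "r > 0" "\<And>i. i < n \<Longrightarrow> z i > 0"
    "\<And>i. i < n \<Longrightarrow> (\<Sum>j<n. A $$ (i, j) * z j) = r * z i"
    using primitive_mat_positive_eigenvector[OF A n nonneg N(2,1)] unfolding r_def by blast
  show "r > 0" by fact
  define P where "P = Matrix.mat n n (\<lambda>(i, j). A $$ (i, j) * z j / (r * z i))"
  have P: "P \<in> carrier_mat n n" by (simp add: P_def)
  have Pk: "(P ^\<^sub>m k) $$ (i, j) = (A ^\<^sub>m k) $$ (i, j) * z j / (r ^ k * z i)" if "i < n" "j < n" for i j k
    using that(1)
  proof (induction k arbitrary: i)
    case 0
    then show ?case using A P that(2) z(2)[OF that(2)] by (cases "i = j") (simp_all add: pow_mat_0_index)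
  next
    case (Suc k)
    have "(P ^\<^sub>m Suc k) $$ (i, j) =
        (\<Sum>l<n. (A $$ (i, l) * z l / (r * z i)) * ((A ^\<^sub>m k) $$ (l, j) * z j / (r ^ k * z l)))"
      unfolding pow_mat_Suc_left_index[OF P Suc.prems that(2)]
      using Suc by (intro sum.cong refl) (simp add: P_def)
    also have "\<dots> = (\<Sum>l<n. (A $$ (i, l) * (A ^\<^sub>m k) $$ (l, j)) * (z j / (r ^ Suc k * z i)))"
    proof (intro sum.cong refl)
      fix l assume "l \<in> {..<n}"
      then have "z l \<noteq> 0" using z(2)[of l] by auto
      then show "(A $$ (i, l) * z l / (r * z i)) * ((A ^\<^sub>m k) $$ (l, j) * z j / (r ^ k * z l)) =
          (A $$ (i, l) * (A ^\<^sub>m k) $$ (l, j)) * (z j / (r ^ Suc k * z i))" by (simp add: mult_ac)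
    qed
    also have "\<dots> = (A ^\<^sub>m Suc k) $$ (i, j) * z j / (r ^ Suc k * z i)"
      unfolding pow_mat_Suc_left_index[OF A Suc.prems that(2)] sum_distrib_right sum_divide_distrib by simp
    finally show ?case .
  qed
  fix i j assume ij: "i < n" "j < n"
  have "\<exists>p>0. (\<lambda>k. (P ^\<^sub>m k) $$ (i, j)) \<longlonglongrightarrow> p"
  proof (rule stochastic_power_convergent[OF P n _ _ _ N(1) ij(2)])
    show "P $$ (i, j) \<ge> 0" if "i < n" "j < n" for i j
      using that z nonneg by (simp add: P_def less_imp_le)
    show "(\<Sum>j<n. P $$ (i, j)) = 1" if "i < n" for i
      using that z(2)[OF that] z(1) z(3)[OF that] by (simp add: P_def flip: sum_divide_distrib)
    show "(P ^\<^sub>m N) $$ (i, j) > 0" if "i < n" "j < n" for i j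
      using that z N by (simp add: Pk)
  qed (use ij in blast)
  then obtain p where p: "p > 0" "(\<lambda>k. (P ^\<^sub>m k) $$ (i, j)) \<longlonglongrightarrow> p" by auto
  have zi: "z i > 0" "z j > 0" using z ij by auto
  have "(\<lambda>k. (P ^\<^sub>m k) $$ (i, j) * (z i / z j)) \<longlonglongrightarrow> p * (z i / z j)"
    by (intro tendsto_intros p)
  moreover have "(P ^\<^sub>m k) $$ (i, j) * (z i / z j) = (A ^\<^sub>m k) $$ (i, j) / r ^ k" for k
    using zi by (simp add: Pk[OF ij])
  ultimately show "\<exists>p>0. (\<lambda>k. (A ^\<^sub>m k) $$ (i, j) / r ^ k) \<longlonglongrightarrow> p"
    using p zi by (intro exI[of _ "p * (z i / z j)"]) auto
qed

section \<open>Powers of primitive-Frobenius matrices\<close>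

declare pow_mat.simps [simp del]

text \<open>\<open>submatrix\<close> numbers the rows of a block through \<open>pick\<close>; the
  bijection converts sums over positions into sums over the block.\<close>

lemma bij_betw_pick:
  assumes "finite B" shows "bij_betw (pick B) {..<card B} B"
proof -
  have "inj_on (pick B) {..<card B}"
    by (rule linorder_inj_onI') (metis lessThan_iff nat_neq_iff pick_mono_le)
  moreover have "pick B ` {..<card B} \<subseteq> B" by (auto intro: pick_in_set_le)
  ultimately show ?thesis
    using assms by (metis bij_betw_def card_image card_lessThan card_subset_eq)
qed

text \<open>Birth counts may vanish identically, hence the alternative. Exponent and rate stay
  existential because the rate is recovered from uniqueness.\<close>

definition zero_or_asy :: "(nat \<Rightarrow> real) \<Rightarrow> bool" where
  "zero_or_asy f \<longleftrightarrow> (\<forall>n. f n = 0) \<or> (\<exists>q L. asy f q L)"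

lemma zero_or_asy_sum:
  assumes "finite J" "\<And>j. j \<in> J \<Longrightarrow> zero_or_asy (g j)"
  shows "zero_or_asy (\<lambda>n. \<Sum>j\<in>J. g j n)"
proof -
  define J' where "J' = {j \<in> J. \<not> (\<forall>n. g j n = 0)}"
  have "\<forall>j\<in>J'. \<exists>x. asy (g j) (fst x) (snd x)"
    using assms(2) unfolding J'_def zero_or_asy_def by fastforce
  from bchoice[OF this] obtain x where x: "\<And>j. j \<in> J' \<Longrightarrow> asy (g j) (fst (x j)) (snd (x j))"
    by auto
  have eq: "(\<lambda>n. \<Sum>j\<in>J. g j n) = (\<lambda>n. \<Sum>j\<in>J'. g j n)"
    using assms(1) by (intro ext sum.mono_neutral_right) (auto simp: J'_def)
  show ?thesis
  proof (cases "J' = {}")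
    case True
    then show ?thesis unfolding eq by (simp add: zero_or_asy_def)
  next
    case False
    have "finite J'" using assms(1) by (simp add: J'_def)
    have "asy (\<lambda>n. \<Sum>j\<in>J'. g j n) (Max ((\<lambda>j. fst (x j)) ` {j \<in> J'. snd (x j) = Max ((\<lambda>j. snd (x j)) ` J')}))
        (Max ((\<lambda>j. snd (x j)) ` J'))"
      by (rule asy_sum_Max[OF \<open>finite J'\<close> False x])
    then show ?thesis unfolding eq zero_or_asy_def by blast
  qed
qed

lemma zero_or_asy_add:
  assumes "zero_or_asy f" "zero_or_asy g" shows "zero_or_asy (\<lambda>n. f n + g n)"
  using zero_or_asy_sum[of "UNIV :: bool set" "\<lambda>b. if b then f else g"] assms
  by (simp add: UNIV_bool add.commute)

lemma zero_or_asy_scale: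
  assumes "zero_or_asy f" "x \<ge> 0" shows "zero_or_asy (\<lambda>n. x * f n)"
proof (cases "x = 0")
  case False
  then show ?thesis using assms asy_scale[of f _ _ x] unfolding zero_or_asy_def
    by (metis less_eq_real_def mult_zero_right)
qed (simp add: zero_or_asy_def)

section \<open>Reachability and blocks\<close>

locale nonneg_square_mat =
  fixes X :: "real mat" and d :: nat
  assumes X: "X \<in> carrier_mat d d"
    and nonneg: "\<And>i j. i < d \<Longrightarrow> j < d \<Longrightarrow> X $$ (i, j) \<ge> 0"
begin

abbreviation entry :: "nat \<Rightarrow> nat \<Rightarrow> nat \<Rightarrow> real" where
  "entry n i j \<equiv> (X ^\<^sub>m n) $$ (i, j)"

lemma entry_nonneg: "i < d \<Longrightarrow> j < d \<Longrightarrow> entry n i j \<ge> 0"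
  by (rule pow_mat_nonneg[OF X nonneg])

lemma entry_Suc: "i < d \<Longrightarrow> j < d \<Longrightarrow> entry (Suc n) i j = (\<Sum>l<d. X $$ (i, l) * entry n l j)"
  by (rule pow_mat_Suc_left_index[OF X])

lemma entry_0: "i < d \<Longrightarrow> j < d \<Longrightarrow> entry 0 i j = (if i = j then 1 else 0)"
  by (rule pow_mat_0_index[OF X])

lemma reach_iff: "b \<in> reach X a \<longleftrightarrow> b < d \<and> (\<exists>n. entry n a b > 0)"
  using X by (auto simp: reach_def)

lemma reach_less: "b \<in> reach X a \<Longrightarrow> b < d"
  by (simp add: reach_iff)

lemma finite_reach: "finite (reach X a)"
  by (rule finite_subset[of _ "{..<d}"]) (auto simp: reach_iff)

lemma reach_refl: "a < d \<Longrightarrow> a \<in> reach X a"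
  by (auto simp: reach_iff entry_0 intro!: exI[of _ 0])

lemma reach_trans:
  assumes "a < d" "b \<in> reach X a" "c \<in> reach X b"
  shows "c \<in> reach X a"
proof -
  from assms obtain k m where km: "entry k a b > 0" "entry m b c > 0" "b < d" "c < d"
    by (auto simp: reach_iff)
  have "entry (k + m) a c = (\<Sum>l<d. entry k a l * entry m l c)"
    by (rule pow_mat_add_index[OF X]) (use assms km in auto)
  also have "\<dots> > 0"
    by (rule sum_pos2[of _ b]) (use km assms in \<open>auto intro: mult_nonneg_nonneg entry_nonneg\<close>)
  finally show ?thesis using km by (auto simp: reach_iff)
qed

lemma reach_step:
  assumes "a < d" "b < d" "X $$ (a, b) > 0" shows "b \<in> reach X a"
  unfolding reach_iff using assms X by (intro conjI exI[of _ 1]) (auto simp: pow_mat.simps)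

lemma reach_mono: "a < d \<Longrightarrow> b \<in> reach X a \<Longrightarrow> reach X b \<subseteq> reach X a"
  using reach_trans by blast

lemma block_of_refl: "a < d \<Longrightarrow> a \<in> block_of X a"
  by (simp add: block_of_def reach_refl)

lemma block_of_less: "b \<in> block_of X a \<Longrightarrow> b < d"
  by (auto simp: block_of_def dest: reach_less)

lemma finite_block_of: "finite (block_of X a)"
  by (rule finite_subset[of _ "{..<d}"]) (auto dest: block_of_less)

lemma block_of_eq:
  assumes "a < d" "b \<in> block_of X a" shows "block_of X b = block_of X a"
proof -
  have "b < d" using assms block_of_less by auto
  with assms show ?thesis
    by (auto simp: block_of_def) (meson reach_trans reach_less)+
qed

lemma block_of_eq_iff:
  "a < d \<Longrightarrow> b < d \<Longrightarrow> block_of X a = block_of X b \<longleftrightarrow> b \<in> reach X a \<and> a \<in> reach X b"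
  using block_of_eq[of a b] block_of_refl[of b] by (auto simp: block_of_def)

lemma blocks_eq: "blocks X = block_of X ` {..<d}"
  using X by (simp add: blocks_def)

lemma finite_blocks: "finite (blocks X)"
  by (simp add: blocks_eq)

lemma block_of_in_blocks: "a < d \<Longrightarrow> block_of X a \<in> blocks X"
  by (simp add: blocks_eq)

lemma block_reaches_iff:
  assumes "a < d" "b < d"
  shows "block_reaches X (block_of X a) (block_of X b) \<longleftrightarrow> b \<in> reach X a"
proof
  assume "block_reaches X (block_of X a) (block_of X b)"
  then obtain a' b' where "a' \<in> block_of X a" "b' \<in> block_of X b" "b' \<in> reach X a'"
    by (auto simp: block_reaches_def)
  then have "a' \<in> reach X a" "b' \<in> reach X a'" "b \<in> reach X b'" "a' < d" "b' < d"
    by (auto simp: block_of_def reach_less)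
  then show "b \<in> reach X a" using assms reach_trans by meson
qed (use assms block_of_refl in \<open>auto simp: block_reaches_def\<close>)

text \<open>A walk of positive weight is followed up to its first step out of the block. As long as
  it stays inside, the block of its current point is unchanged, so the induction hypothesis applies
  to the rest.\<close>

lemma exit_exists:
  assumes "a < d" "b \<in> reach X a" "b \<notin> block_of X a"
  obtains c e where "c \<in> block_of X a" "e < d" "e \<notin> block_of X a" "X $$ (c, e) > 0" "b \<in> reach X e"
proof -
  from assms(2) obtain n where n: "entry n a b > 0" "b < d" by (auto simp: reach_iff)
  have "\<exists>c e. c \<in> block_of X a \<and> e < d \<and> e \<notin> block_of X a \<and> X $$ (c, e) > 0 \<and> b \<in> reach X e"
    using assms(1,3) n(1)
  proof (induction n arbitrary: a)
    case 0
    then have "a = b" using n by (auto simp: entry_0 split: if_splits)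
    then show ?case using 0 block_of_refl by auto
  next
    case (Suc n)
    have "\<exists>l<d. X $$ (a, l) * entry n l b > 0"
    proof (rule ccontr)
      assume "\<not> ?thesis"
      then have "entry (Suc n) a b \<le> 0" unfolding entry_Suc[OF Suc.prems(1) n(2)]
        by (intro sum_nonpos) (meson lessThan_iff not_less)
      then show False using Suc.prems by simp
    qed
    then obtain l where l: "l < d" "X $$ (a, l) > 0" "entry n l b > 0"
      using nonneg[OF Suc.prems(1)] entry_nonneg[OF _ n(2)] by (force simp: zero_less_mult_iff)
    show ?case
    proof (cases "l \<in> block_of X a")
      case True
      then have eq: "block_of X l = block_of X a" by (rule block_of_eq[OF Suc.prems(1)])
      then show ?thesis using Suc.IH[OF l(1) _ l(3)] Suc.prems(2) by simp
    next
      case False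
      then show ?thesis using l n(2) Suc.prems(1) block_of_refl reach_iff by blast
    qed
  qed
  then show ?thesis using that by blast
qed

text \<open>From the target of an exit there is no way back to \<open>a\<close>. The strict
  inclusion is the measure for the inductions on \<open>card (reach X a)\<close>.\<close>

lemma reach_psubset_of_exit:
  assumes "a < d" "c \<in> block_of X a" "e < d" "e \<notin> block_of X a" "X $$ (c, e) > 0"
  shows "e \<in> reach X a" "reach X e \<subset> reach X a"
proof -
  have "c < d" "c \<in> reach X a" using assms by (auto simp: block_of_def reach_less)
  then show e: "e \<in> reach X a" using assms reach_trans reach_step by meson
  have "a \<notin> reach X e" using assms(4) e by (auto simp: block_of_def)
  then show "reach X e \<subset> reach X a" using reach_mono[OF assms(1) e] reach_refl[OF assms(1)] by auto
qed

text \<open>A walk between two members of a block cannot leave it: any point in between is reached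
  from one member and reaches the other. So the powers of \<open>X\<close>, restricted to a block,
  are the powers of the diagonal block.\<close>

lemma block_entry_Suc:
  assumes "a0 < d" "a \<in> block_of X a0" "c \<in> block_of X a0"
  shows "entry (Suc k) a c = (\<Sum>e\<in>block_of X a0. X $$ (a, e) * entry k e c)"
proof -
  have ac: "a < d" "c < d" using assms block_of_less by auto
  show ?thesis unfolding entry_Suc[OF ac]
  proof (rule sum.mono_neutral_right)
    show "\<forall>i\<in>{..<d} - block_of X a0. X $$ (a, i) * entry k i c = 0"
    proof (rule ballI, rule ccontr)
      fix i assume i: "i \<in> {..<d} - block_of X a0" and "X $$ (a, i) * entry k i c \<noteq> 0"
      then have "X $$ (a, i) > 0" "entry k i c > 0"
        using nonneg[OF ac(1), of i] entry_nonneg[OF _ ac(2), of i k] by (auto simp: less_le)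
      then have r: "i \<in> reach X a" "c \<in> reach X i" using i ac reach_step reach_iff by auto
      have "a \<in> reach X a0" "a0 \<in> reach X c" using assms by (auto simp: block_of_def)
      then have "i \<in> reach X a0" "a0 \<in> reach X i" using r assms i ac reach_trans by (meson DiffD1 lessThan_iff)+
      then show False using i by (simp add: block_of_def)
    qed
  qed (auto dest: block_of_less)
qed

section \<open>Diagonal blocks as submatrices\<close>

lemma diag_block_carrier:
  assumes "a0 < d"
  shows "diag_block X (block_of X a0) \<in> carrier_mat (card (block_of X a0)) (card (block_of X a0))"
proof -
  have "{i. i < d \<and> i \<in> block_of X a0} = block_of X a0" using block_of_less by auto
  then show ?thesis using X by (intro carrier_matI) (simp_all add: diag_block_def dim_submatrix)
qed

lemma diag_block_index:
  assumes "a0 < d" "i < card (block_of X a0)" "j < card (block_of X a0)"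
  shows "diag_block X (block_of X a0) $$ (i, j) = X $$ (pick (block_of X a0) i, pick (block_of X a0) j)"
proof -
  have "{i. i < d \<and> i \<in> block_of X a0} = block_of X a0" using block_of_less by auto
  then show ?thesis unfolding diag_block_def using X assms by (intro submatrix_index) auto
qed

lemma diag_block_pow_index:
  assumes "a0 < d" "i < card (block_of X a0)" "j < card (block_of X a0)"
  shows "(diag_block X (block_of X a0) ^\<^sub>m k) $$ (i, j) = entry k (pick (block_of X a0) i) (pick (block_of X a0) j)"
proof -
  let ?B = "block_of X a0"
  note bij = bij_betw_pick[OF finite_block_of[of a0]]
  have pick_B: "pick ?B i \<in> ?B" if "i < card ?B" for i using that by (rule pick_in_set_le)
  show ?thesis
    using assms(2)
  proof (induction k arbitrary: i)
    case 0
    have "pick ?B i = pick ?B j \<longleftrightarrow> i = j"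
      using bij 0 assms(3) by (auto simp: bij_betw_def inj_on_def)
    then show ?case using 0 assms(3) diag_block_carrier[OF assms(1)] pick_B[THEN block_of_less]
      by (simp add: pow_mat_0_index entry_0)
  next
    case (Suc k)
    have "(diag_block X ?B ^\<^sub>m Suc k) $$ (i, j) =
        (\<Sum>l<card ?B. X $$ (pick ?B i, pick ?B l) * entry k (pick ?B l) (pick ?B j))"
      unfolding pow_mat_Suc_left_index[OF diag_block_carrier[OF assms(1)] Suc.prems assms(3)]
      using Suc assms by (intro sum.cong refl) (simp add: diag_block_index)
    also have "\<dots> = (\<Sum>e\<in>?B. X $$ (pick ?B i, e) * entry k e (pick ?B j))"
      by (rule sum.reindex_bij_betw[OF bij])
    also have "\<dots> = entry (Suc k) (pick ?B i) (pick ?B j)"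
      using Suc.prems assms pick_B by (intro block_entry_Suc[symmetric]) auto
    finally show ?case .
  qed
qed

section \<open>Splitting walks at the exit from a block\<close>

text \<open>With \<open>y = 1\<close> this expresses degrees; with \<open>y\<close> counting
  interior vertices of a given type it expresses births.\<close>

abbreviation row_apply :: "(nat \<Rightarrow> real) \<Rightarrow> nat \<Rightarrow> nat \<Rightarrow> real" where
  "row_apply y a n \<equiv> \<Sum>j<d. entry n a j * y j"

lemma row_apply_nonneg:
  assumes "\<And>j. j < d \<Longrightarrow> y j \<ge> 0" "a < d" shows "row_apply y a n \<ge> 0"
  using assms by (intro sum_nonneg mult_nonneg_nonneg entry_nonneg) auto

lemma row_apply_Suc:
  assumes "a < d" shows "row_apply y a (Suc n) = (\<Sum>e<d. X $$ (a, e) * row_apply y e n)"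
proof -
  have "row_apply y a (Suc n) = (\<Sum>j<d. \<Sum>e<d. X $$ (a, e) * (entry n e j * y j))"
    using assms by (intro sum.cong refl) (simp add: entry_Suc sum_distrib_right mult.assoc)
  also have "\<dots> = (\<Sum>e<d. X $$ (a, e) * row_apply y e n)"
    by (subst sum.swap) (simp add: sum_distrib_left)
  finally show ?thesis .
qed

text \<open>Positivity of the entry makes every exit contribute a strictly positive multiple of a
  convolution and makes its target reachable.\<close>

definition exits :: "nat \<Rightarrow> (nat \<times> nat) set" where
  "exits a = {(c, e). c \<in> block_of X a \<and> e < d \<and> e \<notin> block_of X a \<and> X $$ (c, e) > 0}"

lemma finite_exits: "finite (exits a)"
  by (rule finite_subset[of _ "block_of X a \<times> {..<d}"]) (auto simp: exits_def finite_block_of)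

text \<open>A walk is split at the step by which it leaves the block of its starting point.\<close>

lemma row_apply_decomp:
  assumes a0: "a0 < d" and "a \<in> block_of X a0"
  shows "row_apply y a n = (\<Sum>c\<in>block_of X a0. entry n a c * y c) +
    (\<Sum>(c, e)\<in>exits a0. X $$ (c, e) * (\<Sum>k<n. entry k a c * row_apply y e (n - 1 - k)))"
proof -
  let ?B = "block_of X a0"
  let ?O = "{..<d} - ?B"
  have fin: "finite ?B" by (rule finite_block_of)
  have Bd: "b < d" if "b \<in> ?B" for b using that by (rule block_of_less)
  \<comment> \<open>The induction is carried out over all pairs of a point inside and a point
    outside; pairs with entry 0 are discarded afterwards.\<close>
  have full: "row_apply y a n = (\<Sum>c\<in>?B. entry n a c * y c) +
    (\<Sum>(c, e)\<in>?B \<times> ?O. X $$ (c, e) * (\<Sum>k<n. entry k a c * row_apply y e (n - 1 - k)))"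
    using assms(2)
  proof (induction n arbitrary: a)
    case 0
    have "row_apply y a 0 = (\<Sum>j<d. if a = j then y j else 0)"
      using Bd[OF 0] by (intro sum.cong refl) (simp add: entry_0)
    moreover have "(\<Sum>c\<in>?B. entry 0 a c * y c) = (\<Sum>c\<in>?B. if a = c then y c else 0)"
      using Bd 0 by (intro sum.cong refl) (simp add: entry_0)
    ultimately show ?case using Bd[OF 0] 0 fin by simp
  next
    case (Suc n)
    note a = Suc.prems
    have ad: "a < d" using Bd a by auto
    have split: "{..<d} = ?B \<union> ?O" using Bd by auto
    let ?U = "row_apply y"
    have "?U a (Suc n) = (\<Sum>b\<in>?B. X $$ (a, b) * ?U b n) + (\<Sum>e\<in>?O. X $$ (a, e) * ?U e n)"
      unfolding row_apply_Suc[OF ad] by (subst split, rule sum.union_disjoint) (auto simp: fin)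
    also have "(\<Sum>b\<in>?B. X $$ (a, b) * ?U b n) =
        (\<Sum>b\<in>?B. \<Sum>c\<in>?B. X $$ (a, b) * (entry n b c * y c)) +
        (\<Sum>b\<in>?B. \<Sum>(c, e)\<in>?B \<times> ?O. X $$ (a, b) * (X $$ (c, e) * (\<Sum>k<n. entry k b c * ?U e (n - 1 - k))))"
      unfolding sum.distrib[symmetric]
    proof (intro sum.cong refl)
      fix b assume "b \<in> ?B"
      from Suc.IH[OF this] show "X $$ (a, b) * ?U b n =
        (\<Sum>c\<in>?B. X $$ (a, b) * (entry n b c * y c)) +
        (\<Sum>(c, e)\<in>?B \<times> ?O. X $$ (a, b) * (X $$ (c, e) * (\<Sum>k<n. entry k b c * ?U e (n - 1 - k))))"
        by (simp only: distrib_left sum_distrib_left case_prod_unfold)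
    qed
    also have "(\<Sum>b\<in>?B. \<Sum>c\<in>?B. X $$ (a, b) * (entry n b c * y c)) = (\<Sum>c\<in>?B. entry (Suc n) a c * y c)"
      by (subst sum.swap, intro sum.cong refl)
        (simp add: block_entry_Suc[OF a0 a] sum_distrib_right mult.assoc)
    also have "(\<Sum>b\<in>?B. \<Sum>(c, e)\<in>?B \<times> ?O. X $$ (a, b) * (X $$ (c, e) * (\<Sum>k<n. entry k b c * ?U e (n - 1 - k)))) =
        (\<Sum>(c, e)\<in>?B \<times> ?O. X $$ (c, e) * (\<Sum>k<n. entry (Suc k) a c * ?U e (n - 1 - k)))"
      (is "?lhs = ?rhs")
    proof -
      have "?lhs = (\<Sum>p\<in>?B \<times> ?O. \<Sum>b\<in>?B. X $$ (a, b) *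
          (X $$ p * (\<Sum>k<n. entry k b (fst p) * ?U (snd p) (n - 1 - k))))"
        by (subst sum.swap) (simp add: case_prod_unfold)
      also have "\<dots> = ?rhs" unfolding case_prod_unfold
      proof (intro sum.cong refl)
        fix p assume p: "p \<in> ?B \<times> ?O"
        have "(\<Sum>b\<in>?B. X $$ (a, b) * (X $$ p * (\<Sum>k<n. entry k b (fst p) * ?U (snd p) (n - 1 - k)))) =
          X $$ p * (\<Sum>b\<in>?B. \<Sum>k<n. X $$ (a, b) * entry k b (fst p) * ?U (snd p) (n - 1 - k))"
          unfolding sum_distrib_left by (intro sum.cong refl) (simp only: ac_simps)
        also have "(\<Sum>b\<in>?B. \<Sum>k<n. X $$ (a, b) * entry k b (fst p) * ?U (snd p) (n - 1 - k)) =
          (\<Sum>k<n. (\<Sum>b\<in>?B. X $$ (a, b) * entry k b (fst p)) * ?U (snd p) (n - 1 - k))"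
          by (subst sum.swap) (simp only: sum_distrib_right)
        also have "\<dots> = (\<Sum>k<n. entry (Suc k) a (fst p) * ?U (snd p) (n - 1 - k))"
          using p by (intro sum.cong refl) (simp add: block_entry_Suc[OF a0 a] mem_Times_iff)
        finally show "(\<Sum>b\<in>?B. X $$ (a, b) * (X $$ p * (\<Sum>k<n. entry k b (fst p) * ?U (snd p) (n - 1 - k)))) =
          X $$ (fst p, snd p) * (\<Sum>k<n. entry (Suc k) a (fst p) * ?U (snd p) (n - 1 - k))" by simp
      qed
      finally show ?thesis .
    qed
    \<comment> \<open>A walk that leaves at its first step has spent 0 steps in the block;
      \<open>entry 0 a c\<close> selects \<open>c = a\<close>.\<close>
    also have "(\<Sum>e\<in>?O. X $$ (a, e) * ?U e n) = (\<Sum>(c, e)\<in>?B \<times> ?O. X $$ (c, e) * (entry 0 a c * ?U e n))"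
    proof -
      have "(\<Sum>(c, e)\<in>?B \<times> ?O. X $$ (c, e) * (entry 0 a c * ?U e n)) =
          (\<Sum>c\<in>?B. if a = c then (\<Sum>e\<in>?O. X $$ (c, e) * ?U e n) else 0)"
        unfolding sum.cartesian_product[symmetric]
        using Bd ad by (intro sum.cong refl) (auto simp: entry_0)
      then show ?thesis using a fin by simp
    qed
    also have "(\<Sum>c\<in>?B. entry (Suc n) a c * y c) +
        (\<Sum>(c, e)\<in>?B \<times> ?O. X $$ (c, e) * (\<Sum>k<n. entry (Suc k) a c * ?U e (n - 1 - k))) +
        (\<Sum>(c, e)\<in>?B \<times> ?O. X $$ (c, e) * (entry 0 a c * ?U e n)) =
        (\<Sum>c\<in>?B. entry (Suc n) a c * y c) +
        (\<Sum>(c, e)\<in>?B \<times> ?O. X $$ (c, e) * (\<Sum>k<Suc n. entry k a c * ?U e (Suc n - 1 - k)))"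
    proof -
      \<comment> \<open>The term \<open>k = 0\<close> is the immediate exit; the others are those of
        the induction hypothesis, prolonged by one step inside the block.\<close>
      have shift: "(\<Sum>k<Suc n. entry k a c * ?U e (Suc n - 1 - k)) =
          entry 0 a c * ?U e n + (\<Sum>k<n. entry (Suc k) a c * ?U e (n - 1 - k))" for c e
        by (subst sum.lessThan_Suc_shift) simp
      show ?thesis unfolding shift by (simp add: case_prod_unfold distrib_left sum.distrib add_ac)
    qed
    finally show ?case .
  qed
  have "(\<Sum>(c, e)\<in>?B \<times> ?O. X $$ (c, e) * (\<Sum>k<n. entry k a c * row_apply y e (n - 1 - k))) =
    (\<Sum>(c, e)\<in>exits a0. X $$ (c, e) * (\<Sum>k<n. entry k a c * row_apply y e (n - 1 - k)))"
    unfolding case_prod_unfold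
  proof (rule sum.mono_neutral_right)
    show "\<forall>p\<in>?B \<times> ?O - exits a0.
       X $$ (fst p, snd p) * (\<Sum>k<n. entry k a (fst p) * row_apply y (snd p) (n - 1 - k)) = 0"
    proof
      fix p assume "p \<in> ?B \<times> ?O - exits a0"
      then have "X $$ (fst p, snd p) = 0"
        using nonneg[OF Bd, of "fst p" "snd p"] by (auto simp: exits_def less_le)
      then show "X $$ (fst p, snd p) * (\<Sum>k<n. entry k a (fst p) * row_apply y (snd p) (n - 1 - k)) = 0"
        by simp
    qed
  qed (use fin in \<open>auto simp: exits_def\<close>)
  with full show ?thesis by (simp only:)
qed

section \<open>Maximal radii and chains of blocks\<close>

lemma reach_blocks_eq:
  assumes "a < d" shows "reach_blocks X a = block_of X ` reach X a"
  using assms by (auto simp: reach_blocks_def blocks_eq block_reaches_iff reach_less)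

abbreviation radius :: "nat \<Rightarrow> real" where
  "radius a \<equiv> block_radius X (block_of X a)"

lemma reach_radius_eq:
  assumes "a < d" shows "reach_radius X a = Max (radius ` reach X a)"
  by (simp add: reach_radius_def reach_blocks_eq[OF assms] image_image)

lemma radius_le_reach_radius: "a < d \<Longrightarrow> b \<in> reach X a \<Longrightarrow> radius b \<le> reach_radius X a"
  by (auto simp: reach_radius_eq finite_reach intro!: Max_ge)

lemma reach_radius_attained:
  assumes "a < d" obtains b where "b \<in> reach X a" "radius b = reach_radius X a"
proof -
  have "reach_radius X a \<in> radius ` reach X a"
    unfolding reach_radius_eq[OF assms] using reach_refl[OF assms] by (intro Max_in) (auto simp: finite_reach)
  then show ?thesis using that by auto
qed

lemma reach_radius_mono:
  assumes "a < d" "b \<in> reach X a" shows "reach_radius X b \<le> reach_radius X a"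
proof -
  have "b < d" using assms reach_less by auto
  then obtain c where "c \<in> reach X b" "radius c = reach_radius X b" by (rule reach_radius_attained)
  then show ?thesis using radius_le_reach_radius[OF assms(1)] reach_mono[OF assms] by fastforce
qed

text \<open>Membership in \<open>blocks X\<close> is built in so that the relation is transitive on
  arbitrary sets, as needed to treat chains as sorted lists.\<close>

abbreviation block_below :: "nat set \<Rightarrow> nat set \<Rightarrow> bool" where
  "block_below B C \<equiv> B \<in> blocks X \<and> C \<in> blocks X \<and> block_reaches X B C"

lemma transp_block_below: "transp block_below"
proof (rule transpI)
  fix B C D assume "block_below B C" "block_below C D"
  then obtain a b c where "B = block_of X a" "C = block_of X b" "D = block_of X c" "a < d" "b < d" "c < d"
    and "block_reaches X B C" "block_reaches X C D" by (auto simp: blocks_eq)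
  then show "block_below B D" using reach_trans by (auto simp: block_reaches_iff block_of_in_blocks)
qed

text \<open>By transitivity, reachability of consecutive blocks is the same as reachability of all
  later ones. In this form prepending a block or passing to a tail is immediate.\<close>

lemma block_chains_iff:
  "Bs \<in> block_chains X a \<longleftrightarrow> Bs \<noteq> [] \<and> hd Bs = block_of X a \<and> set Bs \<subseteq> blocks X \<and> distinct Bs \<and>
    sorted_wrt block_below Bs"
proof -
  have "(\<forall>r. Suc r < length Bs \<longrightarrow> block_reaches X (Bs ! r) (Bs ! Suc r)) \<longleftrightarrow> sorted_wrt block_below Bs"
    if "set Bs \<subseteq> blocks X"
  proof -
    have "Bs ! i \<in> blocks X" if "i < length Bs" for i using that nth_mem \<open>set Bs \<subseteq> blocks X\<close> by blast
    then show ?thesis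
      unfolding sorted_wrt_iff_nth_Suc_transp[OF transp_block_below] by (metis Suc_lessD)
  qed
  then show ?thesis by (auto simp: block_chains_def)
qed

lemma varkappa_eq:
  "varkappa X a = Max ((\<lambda>Bs. length (filter (\<lambda>B. block_radius X B = reach_radius X a) Bs)) ` block_chains X a)"
  by (simp add: varkappa_def length_filter_conv_card)

lemma finite_block_chains: "finite (block_chains X a)"
  by (rule finite_subset[OF _ finite_subset_distinct[OF finite_blocks]]) (auto simp: block_chains_def)

lemma varkappa_ge:
  "Bs \<in> block_chains X a \<Longrightarrow> length (filter (\<lambda>B. block_radius X B = reach_radius X a) Bs) \<le> varkappa X a"
  unfolding varkappa_eq by (intro Max_ge) (auto simp: finite_block_chains)

lemma singleton_block_chain: "a < d \<Longrightarrow> [block_of X a] \<in> block_chains X a"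
  by (simp add: block_chains_iff block_of_in_blocks)

lemma varkappa_attained:
  assumes "a < d"
  obtains Bs where "Bs \<in> block_chains X a"
    "length (filter (\<lambda>B. block_radius X B = reach_radius X a) Bs) = varkappa X a"
proof -
  have "varkappa X a \<in> (\<lambda>Bs. length (filter (\<lambda>B. block_radius X B = reach_radius X a) Bs)) ` block_chains X a"
    unfolding varkappa_eq using singleton_block_chain[OF assms]
    by (intro Max_in) (auto simp: finite_block_chains)
  then show ?thesis using that by auto
qed

text \<open>Inside one block the chains coincide. Otherwise the block of \<open>a\<close> is put in
  front of an optimal chain from \<open>e\<close>; the result stays distinct because nothing
  reachable from \<open>e\<close> returns to \<open>a\<close>, and the new block counts exactly if
  its radius is maximal.\<close>

lemma varkappa_mono:
  assumes "a < d" "e \<in> reach X a" "reach_radius X e = reach_radius X a"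
  shows "varkappa X e \<le> varkappa X a"
    and "e \<notin> block_of X a \<Longrightarrow> radius a = reach_radius X a \<Longrightarrow> Suc (varkappa X e) \<le> varkappa X a"
proof -
  have e: "e < d" using assms reach_less by auto
  have *: "(if radius a = reach_radius X a then 1 else 0) + varkappa X e \<le> varkappa X a" if "e \<notin> block_of X a"
  proof -
    obtain Ds where Ds: "Ds \<in> block_chains X e"
      "length (filter (\<lambda>B. block_radius X B = reach_radius X e) Ds) = varkappa X e"
      by (rule varkappa_attained[OF e])
    then obtain Ds' where Ds': "Ds = block_of X e # Ds'" by (cases Ds) (auto simp: block_chains_iff)
    have below: "block_below (block_of X a) C \<and> C \<noteq> block_of X a" if "C \<in> set Ds" for C
    proof -
      from that Ds(1) obtain c where c: "C = block_of X c" "c < d"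
        by (auto simp: block_chains_iff blocks_eq)
      have "c \<in> reach X e"
      proof (cases "C = block_of X e")
        case True
        then show ?thesis using c e block_of_eq_iff by simp
      next
        case False
        then have "block_below (block_of X e) C" using Ds(1) Ds' that by (auto simp: block_chains_iff)
        then show ?thesis using c e by (simp add: block_reaches_iff)
      qed
      then have ac: "c \<in> reach X a" by (rule reach_trans[OF assms(1,2)])
      have "a \<notin> reach X e" using \<open>e \<notin> block_of X a\<close> assms(2) by (auto simp: block_of_def)
      then have "a \<notin> reach X c" using reach_trans[OF e \<open>c \<in> reach X e\<close>] by blast
      then show ?thesis using c assms(1) ac
        by (simp add: block_of_eq_iff block_reaches_iff block_of_in_blocks)
    qed
    have "block_of X a # Ds \<in> block_chains X a"
      using Ds(1) below assms(1) unfolding block_chains_iff by (auto simp: block_of_in_blocks)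
    from varkappa_ge[OF this] Ds(2) assms(3) show ?thesis by (simp split: if_splits)
  qed
  show "varkappa X e \<le> varkappa X a"
  proof (cases "e \<in> block_of X a")
    case True
    then have "block_chains X e = block_chains X a"
      using block_of_eq[OF assms(1) True] by (auto simp: block_chains_iff)
    then show ?thesis using assms(3) by (simp add: varkappa_eq)
  qed (use * in simp)
  show "Suc (varkappa X e) \<le> varkappa X a" if "e \<notin> block_of X a" "radius a = reach_radius X a"
    using * that by simp
qed

text \<open>A block attaining the maximal radius is a chain with count 1, and monotonicity carries
  this count back to \<open>a\<close>.\<close>

lemma varkappa_pos:
  assumes "a < d" shows "varkappa X a \<ge> 1"
proof -
  obtain b where b: "b \<in> reach X a" "radius b = reach_radius X a" by (rule reach_radius_attained[OF assms])
  have bd: "b < d" using b reach_less by auto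
  have eq: "reach_radius X b = reach_radius X a"
    using reach_radius_mono[OF assms b(1)] radius_le_reach_radius[OF bd reach_refl[OF bd]] b(2) by simp
  have "1 \<le> varkappa X b" using varkappa_ge[OF singleton_block_chain[OF bd]] b(2) eq by simp
  also have "\<dots> \<le> varkappa X a" by (rule varkappa_mono(1)[OF assms b(1) eq])
  finally show ?thesis .
qed

text \<open>If an optimal chain counts anything after its first block, the way to its second block
  passes through an exit whose target has the same rate and at least the count of the tail. Together
  with \<open>varkappa_mono\<close> this is the recursion that the exponents of row sums
  obey.\<close>

lemma varkappa_le:
  assumes "a < d"
  defines "t \<equiv> (if radius a = reach_radius X a then 1 else 0)"
  shows "varkappa X a \<le> t \<or>
    (\<exists>(c, e)\<in>exits a. reach_radius X e = reach_radius X a \<and> varkappa X a \<le> t + varkappa X e)"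
proof -
  let ?cnt = "\<lambda>Bs. length (filter (\<lambda>B. block_radius X B = reach_radius X a) Bs)"
  obtain Bs where Bs: "Bs \<in> block_chains X a" "?cnt Bs = varkappa X a" by (rule varkappa_attained[OF assms(1)])
  then obtain Cs where Cs: "Bs = block_of X a # Cs" by (cases Bs) (auto simp: block_chains_iff)
  have cnt: "varkappa X a = t + ?cnt Cs"
    using Bs(2) Cs by (cases "radius a = reach_radius X a") (simp_all add: t_def)
  show ?thesis
  proof (cases "?cnt Cs = 0")
    case False
    then obtain C where C: "C \<in> set Cs" "block_radius X C = reach_radius X a"
      by (auto simp: filter_empty_conv)
    then obtain C1 Cs' where C1: "Cs = C1 # Cs'" by (cases Cs) auto
    have "C1 \<in> blocks X" "C \<in> blocks X" using Bs(1) Cs C1 C(1) by (auto simp: block_chains_iff)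
    then obtain b x where bx: "b < d" "C1 = block_of X b" "x < d" "C = block_of X x"
      unfolding blocks_eq by blast
    have ab: "b \<in> reach X a" "b \<notin> block_of X a"
      using Bs(1) Cs C1 bx assms(1) block_of_eq[OF assms(1), of b]
      by (auto simp: block_chains_iff block_reaches_iff)
    have xb: "x \<in> reach X b"
    proof (cases "C = C1")
      case True
      then show ?thesis using bx block_of_eq_iff by simp
    next
      case False
      then have "block_below C1 C" using Bs(1) Cs C1 C by (auto simp: block_chains_iff)
      then show ?thesis using bx by (simp add: block_reaches_iff)
    qed
    obtain c e where ce: "c \<in> block_of X a" "e < d" "e \<notin> block_of X a" "X $$ (c, e) > 0" "b \<in> reach X e"
      by (rule exit_exists[OF assms(1) ab])
    note ea = reach_psubset_of_exit[OF assms(1) ce(1-4)]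
    have Rb: "reach_radius X b = reach_radius X a"
      using reach_radius_mono[OF assms(1) ab(1)] radius_le_reach_radius[OF bx(1) xb] C bx by simp
    have Re: "reach_radius X e = reach_radius X a"
      using reach_radius_mono[OF assms(1) ea(1)] reach_radius_mono[OF ce(2,5)] Rb by simp
    have "Cs \<in> block_chains X b" using Bs(1) Cs C1 bx by (auto simp: block_chains_iff)
    from varkappa_ge[OF this] have "?cnt Cs \<le> varkappa X b" by (simp add: Rb)
    also have "\<dots> \<le> varkappa X e" by (rule varkappa_mono(1)[OF ce(2,5)]) (simp add: Rb Re)
    finally have "varkappa X a \<le> t + varkappa X e" by (simp add: cnt)
    moreover have "(c, e) \<in> exits a" using ce by (simp add: exits_def)
    ultimately show ?thesis using Re by blast
  qed (use cnt in simp)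
qed

end

section \<open>Growth of the rows of primitive-Frobenius matrices\<close>

locale primitive_Frobenius_mat = nonneg_square_mat +
  assumes prim: "primitive_Frobenius X"
begin

text \<open>Primitivity excludes periodicity, so all entries within a block have a genuine limit
  after division by powers of the same radius.\<close>

lemma asy_block_entry:
  assumes "a0 < d" "a \<in> block_of X a0" "c \<in> block_of X a0"
  shows "asy (\<lambda>k. entry k a c) 0 (radius a0)"
proof -
  let ?B = "block_of X a0"
  let ?A = "diag_block X ?B"
  have A: "?A \<in> carrier_mat (card ?B) (card ?B)" by (rule diag_block_carrier[OF assms(1)])
  have bij: "bij_betw (pick ?B) {..<card ?B} ?B" by (rule bij_betw_pick[OF finite_block_of])
  then obtain i j where ij: "i < card ?B" "pick ?B i = a" "j < card ?B" "pick ?B j = c"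
    using assms by (metis (no_types, lifting) bij_betw_def imageE lessThan_iff)
  have pos: "card ?B > 0" using ij by simp
  have A0: "?A $$ (i, j) \<ge> 0" if "i < card ?B" "j < card ?B" for i j
    unfolding diag_block_index[OF assms(1) that]
    using that by (intro nonneg block_of_less[OF pick_in_set_le])
  have pA: "primitive_mat ?A" using prim assms(1) by (auto simp: primitive_Frobenius_def blocks_eq)
  have "radius a0 > 0" unfolding block_radius_def
    by (rule primitive_mat_power_asymptotics(1)[OF A pos _ pA]) (rule A0)
  moreover have "\<exists>p>0. (\<lambda>k. (?A ^\<^sub>m k) $$ (i, j) / radius a0 ^ k) \<longlonglongrightarrow> p" unfolding block_radius_def
    by (rule primitive_mat_power_asymptotics(2)[OF A pos _ pA]) (rule A0 ij | assumption)+
  then obtain p where "p > 0" "(\<lambda>k. (?A ^\<^sub>m k) $$ (i, j) / radius a0 ^ k) \<longlonglongrightarrow> p" by blast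
  ultimately show ?thesis using ij
    by (intro asyI[of _ p]) (simp_all add: diag_block_pow_index[OF assms(1)] pexp_def)
qed

lemma asy_exit_term:
  assumes a: "a < d" and ce: "(c, e) \<in> exits a" and asy: "asy (row_apply y e) q L"
    and y: "\<And>j. j < d \<Longrightarrow> y j \<ge> 0"
  shows "asy (\<lambda>n. X $$ (c, e) * (\<Sum>k<n. entry k a c * row_apply y e (n - 1 - k)))
    (if radius a > L then 0 else if radius a = L then Suc q else q) (max (radius a) L)"
proof (intro asy_scale asy_convolution asy)
  have c: "c \<in> block_of X a" "e < d" "X $$ (c, e) > 0" using ce by (auto simp: exits_def)
  then show "asy (\<lambda>k. entry k a c) 0 (radius a)" using a block_of_refl by (intro asy_block_entry) auto
  show "entry n a c \<ge> 0" for n using c a block_of_less by (intro entry_nonneg) auto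
  show "row_apply y e n \<ge> 0" for n by (intro row_apply_nonneg y c)
  show "X $$ (c, e) > 0" by fact
qed

text \<open>Induction on the size of the reachable set. In the decomposition of walks every exit
  leads to a smaller set, and if the sequence at its target vanishes, so does the
  convolution.\<close>

lemma zero_or_asy_row_apply:
  assumes y: "\<And>j. j < d \<Longrightarrow> y j \<ge> 0" and "a < d"
  shows "zero_or_asy (row_apply y a)"
  using assms(2)
proof (induction "card (reach X a)" arbitrary: a rule: less_induct)
  case less
  note a = less.prems
  have exit: "zero_or_asy (\<lambda>n. X $$ (c, e) * (\<Sum>k<n. entry k a c * row_apply y e (n - 1 - k)))"
    if ce: "(c, e) \<in> exits a" for c e
  proof -
    have ce': "c \<in> block_of X a" "e < d" "e \<notin> block_of X a" "X $$ (c, e) > 0"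
      using ce by (auto simp: exits_def)
    note e = ce'(2) reach_psubset_of_exit(2)[OF a ce']
    then have "zero_or_asy (row_apply y e)"
      by (intro less.hyps psubset_card_mono finite_reach)
    then show ?thesis unfolding zero_or_asy_def using asy_exit_term[OF a ce _ y] by fastforce
  qed
  have block: "zero_or_asy (\<lambda>n. entry n a c * y c)" if "c \<in> block_of X a" for c
  proof -
    have "asy (\<lambda>n. entry n a c) 0 (radius a)"
      using that a block_of_refl by (intro asy_block_entry) auto
    then have "zero_or_asy (\<lambda>n. y c * entry n a c)"
      using y block_of_less[OF that] by (intro zero_or_asy_scale) (auto simp: zero_or_asy_def)
    then show ?thesis by (simp add: mult.commute)
  qed
  have "zero_or_asy (\<lambda>n. \<Sum>c\<in>block_of X a. entry n a c * y c)"
    "zero_or_asy (\<lambda>n. \<Sum>(c, e)\<in>exits a. X $$ (c, e) * (\<Sum>k<n. entry k a c * row_apply y e (n - 1 - k)))"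
    using zero_or_asy_sum[OF finite_block_of block]
      zero_or_asy_sum[OF finite_exits, of a "\<lambda>(c, e) n. X $$ (c, e) * (\<Sum>k<n. entry k a c * row_apply y e (n - 1 - k))"] exit
    by (auto simp: case_prod_unfold)
  then have "zero_or_asy (\<lambda>n. (\<Sum>c\<in>block_of X a. entry n a c * y c) +
      (\<Sum>(c, e)\<in>exits a. X $$ (c, e) * (\<Sum>k<n. entry k a c * row_apply y e (n - 1 - k))))"
    by (rule zero_or_asy_add)
  then show ?case by (subst row_apply_decomp[OF a block_of_refl[OF a]])
qed

abbreviation row_sum :: "nat \<Rightarrow> nat \<Rightarrow> real" where
  "row_sum a \<equiv> row_apply (\<lambda>_. 1) a"

text \<open>The same induction with the exponent tracked. By \<open>varkappa_mono\<close> no term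
  grows faster than claimed, and by \<open>varkappa_le\<close> either some exit term or the walks
  that stay in the block of \<open>a\<close> attain the claimed growth.\<close>

lemma asy_row_sum:
  assumes "a < d"
  shows "asy (row_sum a) (varkappa X a - 1) (reach_radius X a)"
  using assms
proof (induction "card (reach X a)" arbitrary: a rule: less_induct)
  case less
  note a = less.prems
  let ?R = "reach_radius X" and ?K = "varkappa X"
  let ?T = "\<lambda>n. \<Sum>c\<in>block_of X a. entry n a c * 1"
  let ?V = "\<lambda>(c, e) n. X $$ (c, e) * (\<Sum>k<n. entry k a c * row_sum e (n - 1 - k))"
  \<comment> \<open>The exponent that \<open>asy_convolution\<close> assigns to an exit with target
    \<open>e\<close>.\<close>
  define qV where "qV = (\<lambda>e. if radius a > ?R e then 0 else if radius a = ?R e then Suc (?K e - 1) else ?K e - 1)"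
  have decomp: "row_sum a = (\<lambda>n. ?T n + (\<Sum>p\<in>exits a. ?V p n))"
    by (intro ext, subst row_apply_decomp[OF a block_of_refl[OF a]]) (simp add: case_prod_unfold)
  have T: "asy ?T 0 (radius a)"
  proof -
    have "asy (\<lambda>n. \<Sum>c\<in>block_of X a. entry n a c * 1) (Max ((\<lambda>_. 0) ` {c \<in> block_of X a. radius a = Max ((\<lambda>_. radius a) ` block_of X a)})) (Max ((\<lambda>_. radius a) ` block_of X a))"
    proof (rule asy_sum_Max)
      show "block_of X a \<noteq> {}" using block_of_refl[OF a] by auto
      show "asy (\<lambda>n. entry n a c * 1) 0 (radius a)" if "c \<in> block_of X a" for c
        using asy_block_entry[OF a block_of_refl[OF a] that] by simp
    qed (rule finite_block_of)
    moreover have "(\<lambda>_. radius a) ` block_of X a = {radius a}" using block_of_refl[OF a] by auto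
    moreover have "(\<lambda>_. 0::nat) ` block_of X a = {0}" using block_of_refl[OF a] by auto
    ultimately show ?thesis by simp
  qed
  have exit: "e < d" "e \<in> reach X a" "e \<notin> block_of X a" "?R e \<le> ?R a" "asy (?V (c, e)) (qV e) (max (radius a) (?R e))"
    if ce: "(c, e) \<in> exits a" for c e
  proof -
    have ce': "c \<in> block_of X a" "e < d" "e \<notin> block_of X a" "X $$ (c, e) > 0"
      using ce by (auto simp: exits_def)
    note e = ce'(2,3) reach_psubset_of_exit[OF a ce']
    then show "e < d" "e \<in> reach X a" "e \<notin> block_of X a" "?R e \<le> ?R a"
      by (auto intro: reach_radius_mono[OF a])
    have "asy (row_sum e) (?K e - 1) (?R e)"
      using e by (intro less.hyps psubset_card_mono finite_reach)
    from asy_exit_term[OF a ce this] show "asy (?V (c, e)) (qV e) (max (radius a) (?R e))"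
      by (simp add: qV_def)
  qed
  have ra: "radius a \<le> ?R a" by (rule radius_le_reach_radius[OF a reach_refl[OF a]])
  have dom: "grows_le (qV e) (max (radius a) (?R e)) (?K a - 1) (?R a)" if ce: "(c, e) \<in> exits a" for c e
  proof (cases "?R e = ?R a")
    case True
    note ex = exit[OF ce]
    have mono: "?K e \<le> ?K a" "radius a = ?R a \<Longrightarrow> Suc (?K e) \<le> ?K a"
      using varkappa_mono[OF a ex(2) True] ex(3) by auto
    show ?thesis using True ra mono varkappa_pos[OF ex(1)] by (auto simp: grows_le_def qV_def max_def)
  next
    case False
    then show ?thesis using exit(4)[OF ce] ra by (auto simp: grows_le_def qV_def max_def)
  qed
  have dom_T: "grows_le 0 (radius a) (?K a - 1) (?R a)" using ra by (auto simp: grows_le_def)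
  show ?case
  proof (cases "\<exists>(c, e)\<in>exits a. ?R e = ?R a \<and> ?K a \<le> (if radius a = ?R a then 1 else 0) + ?K e")
    case True
    then obtain c e where ce: "(c, e) \<in> exits a" "?R e = ?R a"
      "?K a \<le> (if radius a = ?R a then 1 else 0) + ?K e" by auto
    note ex = exit[OF ce(1)]
    have mono: "?K e \<le> ?K a" "radius a = ?R a \<Longrightarrow> Suc (?K e) \<le> ?K a"
      using varkappa_mono[OF a ex(2) ce(2)] ex(3) by auto
    have "qV e = ?K a - 1" "max (radius a) (?R e) = ?R a"
      using mono ce ra varkappa_pos[OF ex(1)] by (auto simp: qV_def)
    then have V: "asy (?V (c, e)) (?K a - 1) (?R a)" using ex(5) by simp
    have "asy (\<lambda>n. ?V (c, e) n + (\<Sum>p\<in>exits a - {(c, e)}. ?V p n)) (?K a - 1) (?R a)"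
    proof (rule asy_add_sum[OF V])
      fix p assume "p \<in> exits a - {(c, e)}"
      then obtain c' e' where p: "p = (c', e')" "(c', e') \<in> exits a" by (cases p) auto
      show "\<exists>q' L'. asy (?V p) q' L' \<and> grows_le q' L' (?K a - 1) (?R a)"
        using exit(5)[OF p(2)] dom[OF p(2)] p(1) by blast
    qed (simp add: finite_exits)
    from asy_add[OF this T dom_T] show ?thesis
      unfolding decomp using sum.remove[OF finite_exits ce(1), of "\<lambda>p. ?V p _"] by (simp add: add_ac)
  next
    case False
    \<comment> \<open>Without such an exit an optimal chain counts only the block of
      \<open>a\<close>, whose own walks therefore lead.\<close>
    with varkappa_le[OF a] have "?K a \<le> (if radius a = ?R a then 1 else 0)" by auto
    with varkappa_pos[OF a] have "?K a = 1" "radius a = ?R a" by (auto split: if_splits)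
    then have T': "asy ?T (?K a - 1) (?R a)" using T by simp
    show ?thesis unfolding decomp
    proof (rule asy_add_sum[OF T' finite_exits])
      fix p assume "p \<in> exits a"
      then obtain c' e' where p: "p = (c', e')" "(c', e') \<in> exits a" by (cases p) auto
      show "\<exists>q' L'. asy (?V p) q' L' \<and> grows_le q' L' (?K a - 1) (?R a)"
        using exit(5)[OF p(2)] dom[OF p(2)] p(1) by blast
    qed
  qed
qed

end

section \<open>Degrees and births in the iterated graphs\<close>

text \<open>The empty walk and a single arc would be walks of cost 0 and 1 in the symmetric
  closure.\<close>

lemma undirected_dist_ge_2D:
  fixes G :: "('a, 'b) pre_digraph"
  assumes "wf_digraph G" "2 \<le> undirected_dist G u v" "u \<in> verts G" "v \<in> verts G"
  shows "u \<noteq> v" "e \<in> arcs G \<Longrightarrow> {tail G e, head G e} \<noteq> {u, v}"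
proof -
  interpret G: wf_digraph G by fact
  interpret H: pair_wf_digraph "mk_symmetric G" by (rule G.wellformed_mk_symmetric)
  show "u \<noteq> v"
  proof
    assume "u = v"
    then have "H.awalk u [] v" using assms(3) by (simp add: H.awalk_Nil_iff)
    from order_trans[OF assms(2)[unfolded undirected_dist_def] H.min_cost_le_walk_cost[OF this]]
    show False by simp
  qed
  assume e: "e \<in> arcs G"
  show "{tail G e, head G e} \<noteq> {u, v}"
  proof
    assume "{tail G e, head G e} = {u, v}"
    then have "(u, v) \<in> parcs (mk_symmetric G)"
      using e unfolding parcs_mk_symmetric by (auto simp: doubleton_eq_iff)
    then have "H.awalk u [(u, v)] v" using assms(3,4) by (simp add: H.awalk_Cons_iff H.awalk_Nil_iff)
    from order_trans[OF assms(2)[unfolded undirected_dist_def] H.min_cost_le_walk_cost[OF this]]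
    show False by simp
  qed
qed

lemma connected_imp_incident_arc:
  assumes "wf_digraph G" "connected G" "u \<in> verts G" "w \<in> verts G" "w \<noteq> u"
  obtains e where "e \<in> arcs G" "tail G e = w \<or> head G e = w"
proof -
  interpret G: wf_digraph G by fact
  interpret H: pair_wf_digraph "mk_symmetric G" by (rule G.wellformed_mk_symmetric)
  have "w \<rightarrow>\<^sup>*\<^bsub>mk_symmetric G\<^esub> u" using assms by (auto simp: connected_def strongly_connected_def)
  then obtain x where "w \<rightarrow>\<^bsub>mk_symmetric G\<^esub> x"
    using assms(5) by (cases rule: pre_digraph.converse_reachable_cases) auto
  then have "(w, x) \<in> parcs (mk_symmetric G)" by auto
  then show ?thesis using that unfolding parcs_mk_symmetric by auto
qed

text \<open>The two ends of an arc are treated alike by indexing them by a truth value.\<close>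

definition endpoint :: "bool \<Rightarrow> ('a, 'b) coloured_digraph \<Rightarrow> 'b \<Rightarrow> 'a" where
  "endpoint s G = (if s then tail G else head G)"

definition end_count :: "bool \<Rightarrow> ('a, 'b) coloured_digraph \<Rightarrow> 'a \<Rightarrow> nat \<Rightarrow> nat" where
  "end_count s G v k = card {e \<in> arcs G. endpoint s G e = v \<and> colour G e = k}"

lemma kappa_index: "a < 2 * K \<Longrightarrow> kappa K G v $$ (0, a) = end_count (even a) G v (a div 2)"
  by (simp add: kappa_def end_count_def endpoint_def)

lemma kappa_carrier: "kappa K G v \<in> carrier_mat 1 (2 * K)"
  by (simp add: kappa_def)

lemma dim_kappa: "dim_row (kappa K G v) = 1" "dim_col (kappa K G v) = 2 * K"
  by (simp_all add: kappa_def)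

text \<open>Pairs the outgoing and the incoming coordinate of each colour.\<close>

lemma sum_double_lessThan:
  fixes f :: "nat \<Rightarrow> 'a :: comm_monoid_add"
  shows "(\<Sum>a<2 * K. f a) = (\<Sum>i<K. f (2 * i) + f (2 * i + 1))"
  by (induction K) (simp_all add: add.assoc)

lemma sum_by_colour:
  fixes f :: "nat \<Rightarrow> 'a :: semiring_1"
  assumes "finite A" "\<And>p. p \<in> A \<Longrightarrow> c p < K"
  shows "(\<Sum>p\<in>A. f (c p)) = (\<Sum>i<K. of_nat (card {p \<in> A. c p = i}) * f i)"
proof -
  have "(\<Sum>p\<in>A. f (c p)) = (\<Sum>i<K. \<Sum>p\<in>{p \<in> A. c p = i}. f (c p))"
    using assms by (intro sum.group[symmetric]) auto
  also have "\<dots> = (\<Sum>i<K. of_nat (card {p \<in> A. c p = i}) * f i)"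
    by (intro sum.cong refl) simp
  finally show ?thesis .
qed

section \<open>Structure of the iterated graphs\<close>

locale edge_iterated_system =
  fixes S :: "('v, 'e) edge_igs" and \<iota> :: nat
  assumes igs: "is_edge_igs S" and iota: "\<iota> < num_colours S"
begin

abbreviation "K \<equiv> num_colours S"
abbreviation "R \<equiv> rule_graph S"
abbreviation "bp \<equiv> plant_pos S"
abbreviation "bn \<equiv> plant_neg S"
abbreviation "G n \<equiv> Xi S \<iota> n"
abbreviation "M \<equiv> mass_matrix S"
abbreviation "N \<equiv> degree_matrix S"

lemma rule_graph:
  assumes "i < K"
  shows "finite (verts (R i))" "finite (arcs (R i))"
    "e \<in> arcs (R i) \<Longrightarrow> endpoint s (R i) e \<in> verts (R i)"
    "e \<in> arcs (R i) \<Longrightarrow> tail (R i) e \<noteq> head (R i) e"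
    "e \<in> arcs (R i) \<Longrightarrow> colour (R i) e < K"
    "bp i \<in> verts (R i)" "bn i \<in> verts (R i)" "bp i \<noteq> bn i"
    "e \<in> arcs (R i) \<Longrightarrow> {tail (R i) e, head (R i) e} \<noteq> {bp i, bn i}"
proof -
  let ?U = "uncoloured (R i)"
  have *: "fin_digraph ?U" "loopfree_digraph ?U" "\<forall>e \<in> arcs (R i). colour (R i) e < K"
    "bp i \<in> verts (R i)" "bn i \<in> verts (R i)" "2 \<le> undirected_dist ?U (bp i) (bn i)"
    using igs assms by (auto simp: is_edge_igs_def)
  interpret fin_digraph ?U by (rule *(1))
  have [simp]: "verts ?U = verts (R i)" "arcs ?U = arcs (R i)" "tail ?U = tail (R i)" "head ?U = head (R i)"
    by (simp_all add: pre_digraph.truncate_def)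
  show "finite (verts (R i))" "finite (arcs (R i))" using finite_verts finite_arcs by simp_all
  show "e \<in> arcs (R i) \<Longrightarrow> endpoint s (R i) e \<in> verts (R i)"
    using tail_in_verts[of e] head_in_verts[of e] by (simp add: endpoint_def)
  show "e \<in> arcs (R i) \<Longrightarrow> tail (R i) e \<noteq> head (R i) e"
    using loopfree_digraph.no_loops[OF *(2), of e] by simp
  show "e \<in> arcs (R i) \<Longrightarrow> colour (R i) e < K" "bp i \<in> verts (R i)" "bn i \<in> verts (R i)" using * by auto
  note D = undirected_dist_ge_2D[OF wf_digraph *(6)]
  show "bp i \<noteq> bn i" using D(1) * by simp
  show "e \<in> arcs (R i) \<Longrightarrow> {tail (R i) e, head (R i) e} \<noteq> {bp i, bn i}" using D(2) * by simp
qed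

text \<open>Connectedness keeps interior vertices from being isolated, which makes every birth type
  nonzero.\<close>

lemma interior_incident_arc:
  assumes "i < K" "w \<in> interior_verts S i"
  obtains e s where "e \<in> arcs (R i)" "endpoint s (R i) e = w"
proof -
  let ?U = "uncoloured (R i)"
  have *: "fin_digraph ?U" "connected ?U" using igs assms by (auto simp: is_edge_igs_def)
  have [simp]: "verts ?U = verts (R i)" "arcs ?U = arcs (R i)" "tail ?U = tail (R i)" "head ?U = head (R i)"
    by (simp_all add: pre_digraph.truncate_def)
  have wf: "wf_digraph ?U" using *(1) by (simp add: fin_digraph_def)
  obtain e where e: "e \<in> arcs (R i)" "tail (R i) e = w \<or> head (R i) e = w"
    by (rule connected_imp_incident_arc[OF wf *(2), of "bp i" w])
       (use assms rule_graph(6)[OF assms(1)] in \<open>auto simp: interior_verts_def\<close>)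
  then show ?thesis using that[of e True] that[of e False] by (auto simp: endpoint_def)
qed

lemma planted_simps:
  assumes "colour G' p < K"
  shows "planted S G' p (bp (colour G' p)) = tail G' p" "planted S G' p (bn (colour G' p)) = head G' p"
    "w \<in> interior_verts S (colour G' p) \<Longrightarrow> planted S G' p w = Fresh p w"
  using rule_graph(8)[OF assms] by (auto simp: planted_def interior_verts_def)

lemma verts_rule_cases:
  assumes "i < K" "w \<in> verts (R i)"
  obtains "w = bp i" | "w = bn i" | "w \<in> interior_verts S i"
  using assms by (auto simp: interior_verts_def)

definition arcs_of_colour :: "nat \<Rightarrow> nat \<Rightarrow> nat" where
  "arcs_of_colour n k = card {p \<in> arcs (G n). colour (G n) p = k}"

lemma arcs_Suc: "arcs (G (Suc n)) = {e # p | p e. p \<in> arcs (G n) \<and> e \<in> arcs (R (colour (G n) p))}"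
  and verts_Suc: "verts (G (Suc n)) = verts (G n) \<union> {Fresh p w | p w. p \<in> arcs (G n) \<and> w \<in> interior_verts S (colour (G n) p)}"
  and colour_Suc: "colour (G (Suc n)) (e # p) = colour (R (colour (G n) p)) e"
  and endpoint_Suc: "endpoint s (G (Suc n)) (e # p) = planted S (G n) p (endpoint s (R (colour (G n) p)) e)"
  by (simp_all add: substitute_def endpoint_def)

declare Xi.simps(2) [simp del]

lemma arcs_Suc_Sigma:
  "arcs (G (Suc n)) = (\<lambda>(p, e). e # p) ` (SIGMA p:arcs (G n). arcs (R (colour (G n) p)))"
  by (auto simp: arcs_Suc)

text \<open>The name of an arc determines its generation; this is what makes the names
  \<open>Fresh p w\<close> new in each step.\<close>

lemma arcs_length: "p \<in> arcs (G n) \<Longrightarrow> length p = n"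
  by (induction n arbitrary: p) (auto simp: arcs_Suc)

lemma colour_less: "p \<in> arcs (G n) \<Longrightarrow> colour (G n) p < K"
  by (induction n arbitrary: p) (auto simp: arcs_Suc colour_Suc iota rule_graph)

lemma finite_arcs: "finite (arcs (G n))"
proof (induction n)
  case (Suc n)
  then show ?case unfolding arcs_Suc_Sigma by (intro finite_imageI finite_SigmaI) (auto intro: rule_graph colour_less)
qed simp

lemma verts_eq:
  "verts (G n) = {Source, Sink} \<union> {Fresh p w | p w m. m < n \<and> p \<in> arcs (G m) \<and> w \<in> interior_verts S (colour (G m) p)}"
proof (induction n)
  case (Suc n)
  show ?case unfolding verts_Suc Suc.IH by (auto simp: less_Suc_eq)
qed simp

lemma finite_verts: "finite (verts (G n))"
proof (induction n)
  case (Suc n)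
  have "{Fresh p w | p w. p \<in> arcs (G n) \<and> w \<in> interior_verts S (colour (G n) p)} =
      (\<lambda>(p, w). Fresh p w) ` (SIGMA p:arcs (G n). interior_verts S (colour (G n) p))" by auto
  also have "finite \<dots>" using rule_graph(1) colour_less
    by (intro finite_imageI finite_SigmaI finite_arcs) (auto simp: interior_verts_def)
  finally show ?case using Suc by (simp add: verts_Suc)
qed simp

lemma verts_mono: "m \<le> n \<Longrightarrow> verts (G m) \<subseteq> verts (G n)"
  unfolding verts_eq by (blast intro: less_le_trans)

lemma Fresh_notin_verts: "p \<in> arcs (G n) \<Longrightarrow> Fresh p w \<notin> verts (G n)"
  by (auto simp: verts_eq dest!: arcs_length)

lemma endpoint_in_verts: "p \<in> arcs (G n) \<Longrightarrow> endpoint s (G n) p \<in> verts (G n)"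
proof (induction n arbitrary: p s)
  case (Suc n)
  then obtain q e where p: "p = e # q" "q \<in> arcs (G n)" "e \<in> arcs (R (colour (G n) q))"
    by (auto simp: arcs_Suc)
  note c = colour_less[OF p(2)]
  show ?case unfolding p(1) endpoint_Suc
    using Suc.IH[OF p(2), of True] Suc.IH[OF p(2), of False]
    by (cases rule: verts_rule_cases[OF c rule_graph(3)[OF c p(3), of s]])
       (use p in \<open>auto simp: planted_simps[OF c] verts_Suc endpoint_def\<close>)
qed (simp add: endpoint_def)

text \<open>Fresh vertices never coincide with old ones, so an old vertex is met only at the two
  planting positions.\<close>

lemma planted_eq_old_iff:
  assumes "p \<in> arcs (G n)" "w \<in> verts (R (colour (G n) p))" "v \<in> verts (G n)"
  shows "planted S (G n) p w = v \<longleftrightarrow>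
    w = bp (colour (G n) p) \<and> tail (G n) p = v \<or> w = bn (colour (G n) p) \<and> head (G n) p = v"
  using verts_rule_cases[OF colour_less[OF assms(1)] assms(2)] Fresh_notin_verts[OF assms(1)] assms(3)
    rule_graph(8)[OF colour_less[OF assms(1)]]
  by (auto simp: planted_def)

lemma planted_eq_Fresh_iff:
  assumes "p \<in> arcs (G n)" "w \<in> verts (R (colour (G n) p))" "q \<in> arcs (G n)"
    "x \<in> interior_verts S (colour (G n) q)"
  shows "planted S (G n) p w = Fresh q x \<longleftrightarrow> p = q \<and> w = x"
  using endpoint_in_verts[OF assms(1), of True] endpoint_in_verts[OF assms(1), of False]
    Fresh_notin_verts[OF assms(3), of x] assms(4)
  by (auto simp: planted_def endpoint_def interior_verts_def)

text \<open>With distinct ends, an arc at \<open>v\<close> is replaced by a copy in which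
  \<open>v\<close> takes just one planting position, so the tail and head contributions to its
  degree do not overlap.\<close>

lemma loopfree: "p \<in> arcs (G n) \<Longrightarrow> tail (G n) p \<noteq> head (G n) p"
proof (induction n arbitrary: p)
  case (Suc n)
  then obtain q e where p: "p = e # q" "q \<in> arcs (G n)" "e \<in> arcs (R (colour (G n) q))"
    by (auto simp: arcs_Suc)
  note c = colour_less[OF p(2)]
  have t: "tail (R (colour (G n) q)) e \<in> verts (R (colour (G n) q))"
    "head (R (colour (G n) q)) e \<in> verts (R (colour (G n) q))"
    using rule_graph(3)[OF c p(3), of True] rule_graph(3)[OF c p(3), of False] by (auto simp: endpoint_def)
  have "planted S (G n) q (tail (R (colour (G n) q)) e) \<noteq> planted S (G n) q (head (R (colour (G n) q)) e)"
  proof (cases rule: verts_rule_cases[OF c t(2)])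
    case 1
    then show ?thesis
      using planted_eq_old_iff[OF p(2) t(1), of "tail (G n) q"] endpoint_in_verts[OF p(2), of True]
        Suc.IH[OF p(2)] rule_graph(4)[OF c p(3)] by (simp add: planted_simps[OF c] endpoint_def)
  next
    case 2
    then show ?thesis
      using planted_eq_old_iff[OF p(2) t(1), of "head (G n) q"] endpoint_in_verts[OF p(2), of False]
        Suc.IH[OF p(2)] rule_graph(4)[OF c p(3)] by (simp add: planted_simps[OF c] endpoint_def)
  next
    case 3
    then show ?thesis
      using planted_eq_Fresh_iff[OF p(2) t(1) p(2) 3] rule_graph(4)[OF c p(3)]
      by (simp add: planted_simps[OF c])
  qed
  then show ?case unfolding p(1) using endpoint_Suc[of True n e q] endpoint_Suc[of False n e q]
    by (simp add: endpoint_def)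
qed simp

section \<open>Evolution of coloured degrees\<close>

lemma end_count_Suc:
  "end_count s (G (Suc n)) v k = (\<Sum>p\<in>arcs (G n). card {e \<in> arcs (R (colour (G n) p)).
     planted S (G n) p (endpoint s (R (colour (G n) p)) e) = v \<and> colour (R (colour (G n) p)) e = k})"
proof -
  have "{q \<in> arcs (G (Suc n)). endpoint s (G (Suc n)) q = v \<and> colour (G (Suc n)) q = k} =
    (\<lambda>(p, e). e # p) ` (SIGMA p:arcs (G n). {e \<in> arcs (R (colour (G n) p)).
     planted S (G n) p (endpoint s (R (colour (G n) p)) e) = v \<and> colour (R (colour (G n) p)) e = k})"
    by (auto simp: arcs_Suc endpoint_Suc colour_Suc)
  moreover have "inj_on (\<lambda>(p, e). e # p) A" for A :: "('e list \<times> 'e) set" by (auto simp: inj_on_def)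
  ultimately show ?thesis unfolding end_count_def
    by (simp add: card_image finite_arcs rule_graph(2)[OF colour_less])
qed

text \<open>An outgoing arc at \<open>v\<close> becomes a copy with \<open>v\<close> in the position
  \<open>bp\<close>, an incoming one a copy with \<open>v\<close> in the position \<open>bn\<close>.
  Read over all colours and both directions, this is multiplication by the degree matrix.\<close>

lemma end_count_Suc_old:
  assumes "v \<in> verts (G n)"
  shows "end_count s (G (Suc n)) v k = (\<Sum>i<K. end_count True (G n) v i * end_count s (R i) (bp i) k +
    end_count False (G n) v i * end_count s (R i) (bn i) k)"
proof -
  let ?c = "colour (G n)"
  have "end_count s (G (Suc n)) v k = (\<Sum>p\<in>arcs (G n).
    (if tail (G n) p = v then end_count s (R (?c p)) (bp (?c p)) k else 0) +
    (if head (G n) p = v then end_count s (R (?c p)) (bn (?c p)) k else 0))"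
    unfolding end_count_Suc
  proof (rule sum.cong[OF refl])
    fix p assume p: "p \<in> arcs (G n)"
    have "{e \<in> arcs (R (?c p)). planted S (G n) p (endpoint s (R (?c p)) e) = v \<and> colour (R (?c p)) e = k} =
      {e \<in> arcs (R (?c p)). (endpoint s (R (?c p)) e = bp (?c p) \<and> tail (G n) p = v \<or>
        endpoint s (R (?c p)) e = bn (?c p) \<and> head (G n) p = v) \<and> colour (R (?c p)) e = k}"
      using planted_eq_old_iff[OF p rule_graph(3)[OF colour_less[OF p]] assms] by blast
    then show "card {e \<in> arcs (R (?c p)). planted S (G n) p (endpoint s (R (?c p)) e) = v \<and> colour (R (?c p)) e = k} =
      (if tail (G n) p = v then end_count s (R (?c p)) (bp (?c p)) k else 0) +
      (if head (G n) p = v then end_count s (R (?c p)) (bn (?c p)) k else 0)"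
      using loopfree[OF p] by (auto simp: end_count_def)
  qed
  also have "\<dots> = (\<Sum>p\<in>{p \<in> arcs (G n). tail (G n) p = v}. end_count s (R (?c p)) (bp (?c p)) k) +
      (\<Sum>p\<in>{p \<in> arcs (G n). head (G n) p = v}. end_count s (R (?c p)) (bn (?c p)) k)"
    by (simp add: sum.distrib sum.inter_filter finite_arcs)
  also have "(\<Sum>p\<in>{p \<in> arcs (G n). tail (G n) p = v}. end_count s (R (?c p)) (bp (?c p)) k) =
      (\<Sum>i<K. end_count True (G n) v i * end_count s (R i) (bp i) k)"
    by (subst sum_by_colour[where c = ?c and K = K])
       (auto simp: finite_arcs colour_less end_count_def endpoint_def conj_assoc)
  also have "(\<Sum>p\<in>{p \<in> arcs (G n). head (G n) p = v}. end_count s (R (?c p)) (bn (?c p)) k) =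
      (\<Sum>i<K. end_count False (G n) v i * end_count s (R i) (bn i) k)"
    by (subst sum_by_colour[where c = ?c and K = K])
       (auto simp: finite_arcs colour_less end_count_def endpoint_def conj_assoc)
  finally show ?thesis by (simp add: sum.distrib)
qed

text \<open>Only the copy in which a fresh vertex is created touches it.\<close>

lemma end_count_Fresh:
  assumes "q \<in> arcs (G n)" "x \<in> interior_verts S (colour (G n) q)"
  shows "end_count s (G (Suc n)) (Fresh q x) k = end_count s (R (colour (G n) q)) x k"
proof -
  let ?c = "colour (G n)"
  have "end_count s (G (Suc n)) (Fresh q x) k = (\<Sum>p\<in>arcs (G n). if p = q then end_count s (R (?c q)) x k else 0)"
    unfolding end_count_Suc
  proof (rule sum.cong[OF refl])
    fix p assume p: "p \<in> arcs (G n)"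
    have "{e \<in> arcs (R (?c p)). planted S (G n) p (endpoint s (R (?c p)) e) = Fresh q x \<and> colour (R (?c p)) e = k} =
      {e \<in> arcs (R (?c p)). (p = q \<and> endpoint s (R (?c p)) e = x) \<and> colour (R (?c p)) e = k}"
      using planted_eq_Fresh_iff[OF p rule_graph(3)[OF colour_less[OF p]] assms] by blast
    then show "card {e \<in> arcs (R (?c p)). planted S (G n) p (endpoint s (R (?c p)) e) = Fresh q x \<and> colour (R (?c p)) e = k} =
      (if p = q then end_count s (R (?c q)) x k else 0)"
      by (auto simp: end_count_def)
  qed
  then show ?thesis using assms(1) by (simp add: finite_arcs)
qed

lemma kappa_Fresh:
  assumes "q \<in> arcs (G n)" "x \<in> interior_verts S (colour (G n) q)"
  shows "kappa K (G (Suc n)) (Fresh q x) = kappa K (R (colour (G n) q)) x"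
  by (rule eq_matI) (auto simp: dim_kappa kappa_index end_count_Fresh[OF assms])

lemma degree_matrix_carrier: "N \<in> carrier_mat (2 * K) (2 * K)"
  by (simp add: degree_matrix_def)

lemma degree_matrix_index:
  "a < 2 * K \<Longrightarrow> b < 2 * K \<Longrightarrow> N $$ (a, b) =
    real (end_count (even b) (R (a div 2)) (if even a then bp (a div 2) else bn (a div 2)) (b div 2))"
  by (simp add: degree_matrix_def Let_def kappa_index)

lemma kappa_Suc_old:
  assumes "v \<in> verts (G n)" "b < 2 * K"
  shows "real (kappa K (G (Suc n)) v $$ (0, b)) = (\<Sum>a<2 * K. real (kappa K (G n) v $$ (0, a)) * N $$ (a, b))"
proof -
  have "2 * i + 1 < 2 * K" "2 * i < 2 * K" if "i < K" for i using that by auto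
  then have "(\<Sum>a<2 * K. real (kappa K (G n) v $$ (0, a)) * N $$ (a, b)) =
    (\<Sum>i<K. real (end_count True (G n) v i * end_count (even b) (R i) (bp i) (b div 2) +
      end_count False (G n) v i * end_count (even b) (R i) (bn i) (b div 2)))"
    unfolding sum_double_lessThan using assms(2)
    by (intro sum.cong refl) (simp add: kappa_index degree_matrix_index)
  then show ?thesis using assms by (simp add: kappa_index end_count_Suc_old)
qed

lemma kappa_add_old:
  assumes "v \<in> verts (G m)" "b < 2 * K"
  shows "real (kappa K (G (m + k)) v $$ (0, b)) = (\<Sum>a<2 * K. real (kappa K (G m) v $$ (0, a)) * (N ^\<^sub>m k) $$ (a, b))"
  using assms(2)
proof (induction k arbitrary: b)
  case 0
  have "(\<Sum>a<2 * K. real (kappa K (G m) v $$ (0, a)) * (N ^\<^sub>m 0) $$ (a, b)) =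
    (\<Sum>a<2 * K. if a = b then real (kappa K (G m) v $$ (0, a)) else 0)"
    using 0 by (intro sum.cong refl) (simp add: pow_mat_0_index[OF degree_matrix_carrier])
  then show ?case using 0 by simp
next
  case (Suc k)
  have v: "v \<in> verts (G (m + k))" using assms(1) verts_mono[of m "m + k"] by auto
  have "real (kappa K (G (m + Suc k)) v $$ (0, b)) =
      (\<Sum>c<2 * K. (\<Sum>a<2 * K. real (kappa K (G m) v $$ (0, a)) * (N ^\<^sub>m k) $$ (a, c)) * N $$ (c, b))"
    using kappa_Suc_old[OF v Suc.prems] Suc.IH by simp
  also have "\<dots> = (\<Sum>a<2 * K. real (kappa K (G m) v $$ (0, a)) * (\<Sum>c<2 * K. (N ^\<^sub>m k) $$ (a, c) * N $$ (c, b)))"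
    unfolding sum_distrib_left sum_distrib_right by (subst sum.swap) (simp add: mult.assoc)
  also have "\<dots> = (\<Sum>a<2 * K. real (kappa K (G m) v $$ (0, a)) * (N ^\<^sub>m Suc k) $$ (a, b))"
  proof (intro sum.cong refl)
    fix a assume "a \<in> {..<2 * K}"
    then show "real (kappa K (G m) v $$ (0, a)) * (\<Sum>c<2 * K. (N ^\<^sub>m k) $$ (a, c) * N $$ (c, b)) =
      real (kappa K (G m) v $$ (0, a)) * (N ^\<^sub>m Suc k) $$ (a, b)"
      using pow_mat_add_index[OF degree_matrix_carrier, of a b k 1] Suc.prems
      by (simp add: pow_mat.simps left_mult_one_mat[OF degree_matrix_carrier])
  qed
  finally show ?case .
qed

lemma deg_eq_sum_kappa: "deg (G n) v = (\<Sum>a<2 * K. kappa K (G n) v $$ (0, a))"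
proof -
  have *: "card {e \<in> arcs (G n). endpoint s (G n) e = v} = (\<Sum>i<K. end_count s (G n) v i)" for s
  proof -
    have "card {e \<in> arcs (G n). endpoint s (G n) e = v} = (\<Sum>p\<in>{e \<in> arcs (G n). endpoint s (G n) e = v}. 1)"
      by simp
    also have "\<dots> = (\<Sum>i<K. end_count s (G n) v i)"
      using sum_by_colour[of "{e \<in> arcs (G n). endpoint s (G n) e = v}" "colour (G n)" K "\<lambda>_. 1 :: nat"]
      by (simp add: finite_arcs colour_less end_count_def conj_assoc)
    finally show ?thesis .
  qed
  have "deg (G n) v = card {e \<in> arcs (G n). endpoint True (G n) e = v} + card {e \<in> arcs (G n). endpoint False (G n) e = v}"
    by (simp add: deg_def in_degree_def out_degree_def in_arcs_def out_arcs_def endpoint_def pre_digraph.truncate_def)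
  also have "\<dots> = (\<Sum>i<K. end_count True (G n) v i + end_count False (G n) v i)"
    by (simp only: * sum.distrib)
  also have "\<dots> = (\<Sum>a<2 * K. kappa K (G n) v $$ (0, a))"
    unfolding sum_double_lessThan by (intro sum.cong refl) (simp add: kappa_index)
  finally show ?thesis .
qed

text \<open>The factor 1 makes the inner sum literally a \<open>row_apply\<close> of the constant
  vector.\<close>

definition type_degree :: "nat mat \<Rightarrow> nat \<Rightarrow> real" where
  "type_degree u k = (\<Sum>a<2 * K. real (u $$ (0, a)) * (\<Sum>b<2 * K. (N ^\<^sub>m k) $$ (a, b) * 1))"

lemma deg_eq_type_degree:
  assumes "v \<in> verts (G m)"
  shows "real (deg (G (m + k)) v) = type_degree (kappa K (G m) v) k"
proof -
  have "real (deg (G (m + k)) v) = (\<Sum>b<2 * K. \<Sum>a<2 * K. real (kappa K (G m) v $$ (0, a)) * (N ^\<^sub>m k) $$ (a, b))"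
    unfolding deg_eq_sum_kappa of_nat_sum by (intro sum.cong refl) (simp add: kappa_add_old[OF assms])
  then show ?thesis by (subst (asm) sum.swap) (simp add: type_degree_def sum_distrib_left)
qed

lemma degree_matrix_nonneg: "a < 2 * K \<Longrightarrow> b < 2 * K \<Longrightarrow> N $$ (a, b) \<ge> 0"
  by (simp add: degree_matrix_index)

lemma l1_norm_eq_type_degree:
  assumes "u \<in> carrier_mat 1 (2 * K)"
  shows "l1_norm (map_mat real u * N ^\<^sub>m k) = type_degree u k"
proof -
  have Nk: "N ^\<^sub>m k \<in> carrier_mat (2 * K) (2 * K)" by (rule pow_carrier_mat[OF degree_matrix_carrier])
  have "(map_mat real u * N ^\<^sub>m k) $$ (0, b) = (\<Sum>a<2 * K. real (u $$ (0, a)) * (N ^\<^sub>m k) $$ (a, b))"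
    if "b < 2 * K" for b
    using that carrier_matD[OF assms] carrier_matD[OF Nk] by (simp add: scalar_prod_def atLeast0LessThan)
  moreover have "(\<Sum>a<2 * K. real (u $$ (0, a)) * (N ^\<^sub>m k) $$ (a, b)) \<ge> 0" if "b < 2 * K" for b
    using that pow_mat_nonneg[OF degree_matrix_carrier degree_matrix_nonneg]
    by (intro sum_nonneg mult_nonneg_nonneg) auto
  ultimately have "l1_norm (map_mat real u * N ^\<^sub>m k) =
      (\<Sum>b<2 * K. \<Sum>a<2 * K. real (u $$ (0, a)) * (N ^\<^sub>m k) $$ (a, b))"
    unfolding l1_norm_def using Nk by (intro sum.cong) auto
  then show ?thesis by (subst (asm) sum.swap) (simp add: type_degree_def sum_distrib_left)
qed

section \<open>Arcs by colour, births and the set of types\<close>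

lemma mass_matrix_carrier: "M \<in> carrier_mat K K"
  by (simp add: mass_matrix_def)

lemma mass_matrix_index:
  "i < K \<Longrightarrow> k < K \<Longrightarrow> M $$ (i, k) = real (card {e \<in> arcs (R i). colour (R i) e = k})"
  by (simp add: mass_matrix_def)

lemma arcs_of_colour_Suc:
  "arcs_of_colour (Suc n) k = (\<Sum>i<K. arcs_of_colour n i * card {e \<in> arcs (R i). colour (R i) e = k})"
proof -
  let ?c = "colour (G n)"
  have "{q \<in> arcs (G (Suc n)). colour (G (Suc n)) q = k} =
    (\<lambda>(p, e). e # p) ` (SIGMA p:arcs (G n). {e \<in> arcs (R (?c p)). colour (R (?c p)) e = k})"
    by (auto simp: arcs_Suc colour_Suc)
  moreover have "inj_on (\<lambda>(p, e). e # p) A" for A :: "('e list \<times> 'e) set" by (auto simp: inj_on_def)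
  ultimately have "arcs_of_colour (Suc n) k = (\<Sum>p\<in>arcs (G n). card {e \<in> arcs (R (?c p)). colour (R (?c p)) e = k})"
    unfolding arcs_of_colour_def by (simp add: card_image finite_arcs rule_graph(2)[OF colour_less])
  also have "\<dots> = (\<Sum>i<K. arcs_of_colour n i * card {e \<in> arcs (R i). colour (R i) e = k})"
    by (subst sum_by_colour[where c = ?c and K = K]) (auto simp: finite_arcs colour_less arcs_of_colour_def)
  finally show ?thesis .
qed

lemma arcs_of_colour_eq: "k < K \<Longrightarrow> real (arcs_of_colour n k) = (M ^\<^sub>m n) $$ (\<iota>, k)"
proof (induction n arbitrary: k)
  case 0
  have "{p \<in> arcs (G 0). colour (G 0) p = k} = (if \<iota> = k then {[]} else {})" by auto
  then show ?case using 0 iota by (simp add: arcs_of_colour_def pow_mat_0_index[OF mass_matrix_carrier])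
next
  case (Suc n)
  have "real (arcs_of_colour (Suc n) k) = (\<Sum>i<K. (M ^\<^sub>m n) $$ (\<iota>, i) * M $$ (i, k))"
    unfolding arcs_of_colour_Suc of_nat_sum using Suc by (intro sum.cong refl) (simp add: mass_matrix_index)
  also have "\<dots> = (M ^\<^sub>m Suc n) $$ (\<iota>, k)"
    using pow_mat_add_index[OF mass_matrix_carrier iota Suc.prems, of n 1]
    by (simp add: pow_mat.simps left_mult_one_mat[OF mass_matrix_carrier])
  finally show ?case .
qed

lemma Xi_verts_eq:
  "Xi_verts S \<iota> = {Source, Sink} \<union> {Fresh p w | p w m. p \<in> arcs (G m) \<and> w \<in> interior_verts S (colour (G m) p)}"
  unfolding Xi_verts_def verts_eq by auto

lemma birth_generation_initial: "v \<in> verts (G 0) \<Longrightarrow> birth_generation S \<iota> v = 0"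
  unfolding birth_generation_def by (rule Least_eq_0) simp

lemma birth_Fresh:
  assumes "p \<in> arcs (G m)" "w \<in> interior_verts S (colour (G m) p)"
  shows "birth_generation S \<iota> (Fresh p w) = Suc m"
    and "birth_type S \<iota> (Fresh p w) = kappa K (R (colour (G m) p)) w"
proof -
  show gen: "birth_generation S \<iota> (Fresh p w) = Suc m" unfolding birth_generation_def
  proof (rule Least_equality)
    show "Fresh p w \<in> verts (G (Suc m))" using assms by (auto simp: verts_eq)
    show "Suc m \<le> n" if "Fresh p w \<in> verts (G n)" for n
      using that arcs_length[OF assms(1)] arcs_length by (fastforce simp: verts_eq)
  qed
  show "birth_type S \<iota> (Fresh p w) = kappa K (R (colour (G m) p)) w"
    unfolding birth_type_def gen by (rule kappa_Fresh[OF assms])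
qed

lemma in_verts_birth_generation:
  assumes "v \<in> Xi_verts S \<iota>" shows "v \<in> verts (G (birth_generation S \<iota> v))"
  unfolding birth_generation_def using assms by (auto simp: Xi_verts_def intro: LeastI)

lemma in_verts_iff:
  assumes "v \<in> Xi_verts S \<iota>" shows "v \<in> verts (G n) \<longleftrightarrow> birth_generation S \<iota> v \<le> n"
proof
  assume "v \<in> verts (G n)"
  then show "birth_generation S \<iota> v \<le> n" unfolding birth_generation_def by (rule Least_le)
next
  assume "birth_generation S \<iota> v \<le> n"
  then show "v \<in> verts (G n)" using in_verts_birth_generation[OF assms] verts_mono by blast
qed

lemma deg_of_birth:
  assumes "v \<in> Xi_verts S \<iota>"
  shows "real (deg (G (birth_generation S \<iota> v + k)) v) = type_degree (birth_type S \<iota> v) k"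
  unfolding birth_type_def by (rule deg_eq_type_degree[OF in_verts_birth_generation[OF assms]])

definition interior_of_type :: "nat mat \<Rightarrow> nat \<Rightarrow> nat" where
  "interior_of_type u j = card {w \<in> interior_verts S j. kappa K (R j) w = u}"

text \<open>A vertex of generation \<open>Suc m\<close> is an arc of generation \<open>m\<close>
  together with an interior vertex of its rule graph. The two initial vertices have generation 0 and
  lie outside this formula.\<close>

lemma births_Suc: "real (births S \<iota> u (Suc m)) = (\<Sum>j<K. (M ^\<^sub>m m) $$ (\<iota>, j) * real (interior_of_type u j))"
proof -
  let ?c = "colour (G m)"
  have "{v \<in> Xi_verts S \<iota>. birth_generation S \<iota> v = Suc m \<and> birth_type S \<iota> v = u} =
    (\<lambda>(p, w). Fresh p w) ` (SIGMA p:arcs (G m). {w \<in> interior_verts S (?c p). kappa K (R (?c p)) w = u})"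
    (is "?A = ?B")
  proof
    show "?A \<subseteq> ?B"
    proof
      fix v assume v: "v \<in> ?A"
      then have "v \<notin> verts (G 0)" using birth_generation_initial by fastforce
      then obtain p w n where p: "v = Fresh p w" "p \<in> arcs (G n)" "w \<in> interior_verts S (colour (G n) p)"
        using v by (auto simp: Xi_verts_eq)
      with v birth_Fresh[OF p(2,3)] show "v \<in> ?B" by auto
    qed
    show "?B \<subseteq> ?A"
    proof
      fix v assume "v \<in> ?B"
      then obtain p w where p: "v = Fresh p w" "p \<in> arcs (G m)" "w \<in> interior_verts S (?c p)" "kappa K (R (?c p)) w = u"
        by auto
      with birth_Fresh[OF p(2,3)] show "v \<in> ?A" by (auto simp: Xi_verts_eq)
    qed
  qed
  moreover have "inj_on (\<lambda>(p, w). Fresh p w) A" for A :: "('e list \<times> 'v) set" by (auto simp: inj_on_def)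
  ultimately have "births S \<iota> u (Suc m) = (\<Sum>p\<in>arcs (G m). interior_of_type u (?c p))"
    unfolding births_def interior_of_type_def
    using rule_graph(1)[OF colour_less] by (simp add: card_image finite_arcs interior_verts_def)
  also have "\<dots> = (\<Sum>j<K. arcs_of_colour m j * interior_of_type u j)"
    by (subst sum_by_colour[where c = ?c and K = K]) (auto simp: finite_arcs colour_less arcs_of_colour_def)
  finally show ?thesis by (simp add: arcs_of_colour_eq)
qed

lemma in_reach_mass_iff: "j \<in> reach M \<iota> \<longleftrightarrow> j < K \<and> (\<exists>m. \<exists>p\<in>arcs (G m). colour (G m) p = j)"
proof -
  have "(M ^\<^sub>m m) $$ (\<iota>, j) > 0 \<longleftrightarrow> (\<exists>p\<in>arcs (G m). colour (G m) p = j)" if "j < K" for m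
    using finite_arcs[of m] unfolding arcs_of_colour_eq[OF that, symmetric]
    by (auto simp: arcs_of_colour_def card_gt_0_iff)
  then show ?thesis using mass_matrix_carrier by (auto simp: reach_def)
qed

text \<open>A colour is reachable from \<iota> in \<open>M\<close> exactly if some iterate has an
  arc of that colour, so every listed type is realised by a vertex. In particular a vertex of top
  type exists.\<close>

lemma type_set_eq: "type_set S \<iota> = birth_type S \<iota> ` Xi_verts S \<iota>"
proof
  show "type_set S \<iota> \<subseteq> birth_type S \<iota> ` Xi_verts S \<iota>"
  proof
    fix u assume "u \<in> type_set S \<iota>"
    then consider v where "v \<in> verts (G 0)" "u = kappa K (G 0) v"
      | j w where "j \<in> reach M \<iota>" "w \<in> interior_verts S j" "u = kappa K (R j) w"
      unfolding type_set_def by blast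
    then show "u \<in> birth_type S \<iota> ` Xi_verts S \<iota>"
    proof cases
      case 1
      then show ?thesis
        by (intro image_eqI[of _ _ v]) (simp_all only: birth_type_def birth_generation_initial, auto simp: Xi_verts_def intro: exI[of _ 0])
    next
      case 2
      then obtain m p where "p \<in> arcs (G m)" "colour (G m) p = j" by (auto simp: in_reach_mass_iff)
      then show ?thesis using birth_Fresh[of p m w] 2
        by (intro image_eqI[of _ _ "Fresh p w"]) (auto simp: Xi_verts_eq)
    qed
  qed
  show "birth_type S \<iota> ` Xi_verts S \<iota> \<subseteq> type_set S \<iota>"
  proof
    fix u assume "u \<in> birth_type S \<iota> ` Xi_verts S \<iota>"
    then obtain v where v: "v \<in> Xi_verts S \<iota>" "u = birth_type S \<iota> v" by auto
    show "u \<in> type_set S \<iota>"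
    proof (cases "v \<in> verts (G 0)")
      case True
      then have "u = kappa K (G 0) v" using v birth_generation_initial by (simp add: birth_type_def)
      then show ?thesis unfolding type_set_def using True by blast
    next
      case False
      then obtain p w m where p: "v = Fresh p w" "p \<in> arcs (G m)" "w \<in> interior_verts S (colour (G m) p)"
        using v by (auto simp: Xi_verts_eq)
      then have "colour (G m) p \<in> reach M \<iota>" using colour_less in_reach_mass_iff by blast
      then show ?thesis unfolding type_set_def using p birth_Fresh[OF p(2,3)] v by blast
    qed
  qed
qed

lemma finite_type_set: "finite (type_set S \<iota>)"
  unfolding type_set_def using rule_graph(1)
  by (intro finite_UnI finite_UN_I finite_imageI) (auto simp: interior_verts_def in_reach_mass_iff
    intro: finite_subset[of _ "{..<K}"])

lemma end_count_pos:
  assumes "i < K" "e \<in> arcs (R i)" "endpoint s (R i) e = w"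
  shows "end_count s (R i) w (colour (R i) e) > 0"
  using assms rule_graph(2)[OF assms(1)] by (auto simp: end_count_def card_gt_0_iff)

lemma kappa_pos_of_arc:
  assumes "i < K" "e \<in> arcs (R i)" "endpoint s (R i) e = w"
  shows "2 * colour (R i) e + (if s then 0 else 1) \<in> supp S (kappa K (R i) w)"
  using end_count_pos[OF assms] rule_graph(5)[OF assms(1,2)]
  by (cases s) (auto simp: supp_def kappa_index)

lemma initial_types:
  "kappa K (G 0) ` verts (G 0) = {kappa K (G 0) Source, kappa K (G 0) Sink}"
  "supp S (kappa K (G 0) Source) = {2 * \<iota>}" "supp S (kappa K (G 0) Sink) = {2 * \<iota> + 1}"
proof -
  have 1: "end_count s (G 0) v k = (if (if s then Source else Sink) = v \<and> k = \<iota> then 1 else 0)" for s v k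
    by (auto simp: end_count_def endpoint_def)
  show "supp S (kappa K (G 0) Source) = {2 * \<iota>}" "supp S (kappa K (G 0) Sink) = {2 * \<iota> + 1}"
    using iota by (auto simp: supp_def kappa_index 1 simp del: Xi.simps split: if_splits elim!: evenE oddE)
qed simp

lemma supp_nonempty:
  assumes "u \<in> type_set S \<iota>" shows "supp S u \<noteq> {}"
proof -
  from assms consider "u \<in> {kappa K (G 0) Source, kappa K (G 0) Sink}"
    | j w where "j \<in> reach M \<iota>" "w \<in> interior_verts S j" "u = kappa K (R j) w"
    unfolding type_set_def initial_types(1) by blast
  then show ?thesis
  proof cases
    case 1
    then show ?thesis using initial_types by auto
  next
    case 2
    then have j: "j < K" by (simp add: in_reach_mass_iff)
    obtain e s where "e \<in> arcs (R j)" "endpoint s (R j) e = w" by (rule interior_incident_arc[OF j 2(2)])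
    from kappa_pos_of_arc[OF j this] 2 show ?thesis by auto
  qed
qed

lemma type_carrier: "u \<in> type_set S \<iota> \<Longrightarrow> u \<in> carrier_mat 1 (2 * K)"
  by (auto simp: type_set_def kappa_carrier simp del: One_nat_def Xi.simps)

lemma type_nonzero:
  assumes "u \<in> type_set S \<iota>" shows "u \<noteq> 0\<^sub>m 1 (2 * K)"
  using supp_nonempty[OF assms] by (auto simp: supp_def)

lemma type_set_nonempty: "type_set S \<iota> \<noteq> {}"
  unfolding type_set_def by auto

end

section \<open>The degree scaling limit\<close>

lemma powi_inject:
  fixes x :: real
  assumes "x > 1" shows "x powi a = x powi b \<longleftrightarrow> a = b"
proof
  assume "x powi a = x powi b"
  then have "x powr real_of_int a = x powr real_of_int b"
    using assms by (simp add: powr_real_of_int')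
  then show "a = b" using assms by (simp add: powr_inj)
qed simp

locale frobenius_edge_iterated_system = edge_iterated_system S \<iota>
  for S :: "('v, 'e) edge_igs" and \<iota> :: nat +
  assumes N_prim: "primitive_Frobenius (degree_matrix S)"
    and M_prim: "primitive_Frobenius (mass_matrix S)"
    and Lambda_gt_1: "Lambda_U S \<iota> > 1"
begin

sublocale deg: primitive_Frobenius_mat N "2 * K"
  by unfold_locales (use degree_matrix_carrier degree_matrix_nonneg N_prim in auto)

sublocale mass: primitive_Frobenius_mat M K
  by unfold_locales (use mass_matrix_carrier mass_matrix_index M_prim in auto)

abbreviation "\<Lambda> \<equiv> Lambda_U S \<iota>"

lemma finite_supp: "finite (supp S u)"
  by (simp add: supp_def)

section \<open>Growth of degrees by type\<close>

text \<open>The degree is a positive combination of row sums over the support, so the leading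
  coordinates decide.\<close>

lemma asy_type_degree:
  assumes "u \<in> type_set S \<iota>"
  shows "asy (type_degree u) (type_order S u - 1) (type_rate S u)" "type_order S u \<ge> 1"
proof -
  let ?J = "supp S u" and ?L = "reach_radius N" and ?q = "varkappa N"
  let ?T = "{a \<in> ?J. ?L a = type_rate S u}"
  have J: "?J \<noteq> {}" "finite ?J" using supp_nonempty[OF assms] finite_supp by auto
  have "type_rate S u \<in> ?L ` ?J" unfolding type_rate_def using J by (intro Max_in) auto
  then obtain a where a: "a \<in> ?T" by auto
  then have T: "?q ` ?T \<noteq> {}" "finite (?q ` ?T)" using J by auto
  \<comment> \<open>Truncated subtraction is monotone and hence commutes with the maximum; this
    converts exponents into orders.\<close>
  have "Max ((\<lambda>x. x - 1) ` ?q ` ?T) = Max (?q ` ?T) - 1"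
    using T by (intro mono_Max_commute[symmetric]) (auto simp: mono_def)
  then have order: "Max ((\<lambda>a. ?q a - 1) ` ?T) = type_order S u - 1"
    by (simp add: image_image type_order_def)
  have "asy (\<lambda>k. \<Sum>a\<in>?J. real (u $$ (0, a)) * deg.row_sum a k)
    (Max ((\<lambda>a. ?q a - 1) ` {a \<in> ?J. ?L a = Max (?L ` ?J)})) (Max (?L ` ?J))"
  proof (rule asy_sum_Max[OF J(2,1)])
    fix a assume "a \<in> ?J"
    then have "a < 2 * K" "real (u $$ (0, a)) > 0" by (auto simp: supp_def)
    then show "asy (\<lambda>k. real (u $$ (0, a)) * deg.row_sum a k) (?q a - 1) (?L a)"
      by (intro asy_scale deg.asy_row_sum)
  qed
  then have "asy (\<lambda>k. \<Sum>a\<in>?J. real (u $$ (0, a)) * deg.row_sum a k) (type_order S u - 1) (type_rate S u)"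
    using order by (simp add: type_rate_def)
  moreover have "type_degree u = (\<lambda>k. \<Sum>a\<in>?J. real (u $$ (0, a)) * deg.row_sum a k)"
    unfolding type_degree_def
    by (intro ext sum.mono_neutral_right) (auto simp: supp_def)
  ultimately show "asy (type_degree u) (type_order S u - 1) (type_rate S u)" by simp
  have "1 \<le> ?q a" using a by (intro deg.varkappa_pos) (auto simp: supp_def)
  also have "?q a \<le> type_order S u" unfolding type_order_def using a T(2) by (intro Max_ge) auto
  finally show "type_order S u \<ge> 1" .
qed

text \<open>The types with positive limit degree. In contrast to \<open>I_deg_surv\<close>, a type
  occurring only in generation 0 may belong here.\<close>

definition top_types :: "nat mat set" where
  "top_types = {u \<in> type_set S \<iota>. type_rate S u = \<Lambda> \<and> type_order S u = tau_deg S \<iota>}"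

lemma finite_top_types: "finite top_types"
  using finite_type_set by (simp add: top_types_def)

lemma type_rate_le: "u \<in> type_set S \<iota> \<Longrightarrow> type_rate S u \<le> \<Lambda>"
  unfolding Lambda_U_def using finite_type_set by (intro Max_ge) auto

lemma type_order_le:
  "u \<in> type_set S \<iota> \<Longrightarrow> type_rate S u = \<Lambda> \<Longrightarrow> type_order S u \<le> tau_deg S \<iota>"
  unfolding tau_deg_def using finite_type_set by (intro Max_ge) auto

lemma top_types_nonempty: "top_types \<noteq> {}"
proof -
  let ?T = "{u \<in> type_set S \<iota>. type_rate S u = \<Lambda>}"
  have "\<Lambda> \<in> type_rate S ` type_set S \<iota>"
    unfolding Lambda_U_def using finite_type_set type_set_nonempty by (intro Max_in) auto
  then have "type_order S ` ?T \<noteq> {}" by auto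
  then have "tau_deg S \<iota> \<in> type_order S ` ?T"
    unfolding tau_deg_def using finite_type_set by (intro Max_in) auto
  then show ?thesis by (auto simp: top_types_def)
qed

abbreviation scale :: "nat \<Rightarrow> real" where
  "scale \<equiv> pexp (tau_deg S \<iota> - 1) \<Lambda>"

lemma scale_pos: "scale n > 0"
  using Lambda_gt_1 by (intro pexp_pos) simp

lemma top_type_limit:
  assumes "u \<in> top_types"
  shows "c_deg S u > 0" "(\<lambda>k. type_degree u k / scale k) \<longlonglongrightarrow> c_deg S u"
proof -
  have u: "u \<in> type_set S \<iota>" "type_rate S u = \<Lambda>" "type_order S u = tau_deg S \<iota>"
    using assms by (auto simp: top_types_def)
  obtain c where c: "c > 0" "(\<lambda>k. type_degree u k / scale k) \<longlonglongrightarrow> c"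
    using asy_type_degree(1)[OF u(1)] unfolding u by (rule asyE)
  have "c_deg S u = lim (\<lambda>n. type_degree u n / (real n ^ (tau_deg S \<iota> - 1) * \<Lambda> ^ n))"
    unfolding c_deg_def l1_norm_eq_type_degree[OF type_carrier[OF u(1)]] u ..
  also have "\<dots> = c"
    using c(2) Lambda_gt_1 by (intro limI) (simp add: pexp_limit_iff)
  finally show "c_deg S u > 0" "(\<lambda>k. type_degree u k / scale k) \<longlonglongrightarrow> c_deg S u"
    using c by auto
qed

text \<open>\<open>c_deg\<close> normalises by the growth of the type itself; the weight normalises
  every type by the common \<open>scale\<close>, which sends all lower types to 0.\<close>

definition type_weight :: "nat mat \<Rightarrow> real" where
  "type_weight u = (if u \<in> top_types then c_deg S u else 0)"

lemma type_degree_limit: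
  assumes "u \<in> type_set S \<iota>"
  shows "(\<lambda>k. type_degree u k / scale k) \<longlonglongrightarrow> type_weight u"
proof (cases "u \<in> top_types")
  case True
  then show ?thesis using top_type_limit(2) by (simp add: type_weight_def)
next
  case False
  have "type_rate S u < \<Lambda> \<or> type_rate S u = \<Lambda> \<and> type_order S u < tau_deg S \<iota>"
    using False assms type_rate_le[OF assms] type_order_le[OF assms] by (fastforce simp: top_types_def)
  then have "type_rate S u < \<Lambda> \<or> type_rate S u = \<Lambda> \<and> type_order S u - 1 < tau_deg S \<iota> - 1"
    using asy_type_degree(2)[OF assms] by auto
  from asy_ratio_null[OF asy_type_degree(1)[OF assms] this] False show ?thesis
    by (simp add: type_weight_def)
qed

text \<open>The finitely many individual constants are added up. Uniformity in \<open>u\<close> is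
  what controls the growing set of vertices in \<open>max_deg_limit\<close>.\<close>

lemma type_degree_bound:
  obtains C where "C > 0" "\<And>u k. u \<in> type_set S \<iota> \<Longrightarrow> type_degree u k \<le> C * scale k"
proof -
  have "\<forall>u\<in>type_set S \<iota>. \<exists>C>0. \<forall>k. type_degree u k \<le> C * scale k"
  proof
    fix u assume u: "u \<in> type_set S \<iota>"
    obtain C where C: "C > 0" "\<And>n. \<bar>type_degree u n / scale n\<bar> \<le> C"
      using convergent_imp_Bseq[OF convergentI[OF type_degree_limit[OF u]]] unfolding Bseq_def by auto
    have "type_degree u k \<le> C * scale k" for k
      using C(2)[of k] scale_pos[of k] by (simp add: field_simps)
    with C(1) show "\<exists>C>0. \<forall>k. type_degree u k \<le> C * scale k" by blast
  qed
  from bchoice[OF this] obtain C where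
    C: "\<And>u. u \<in> type_set S \<iota> \<Longrightarrow> C u > 0" "\<And>u k. u \<in> type_set S \<iota> \<Longrightarrow> type_degree u k \<le> C u * scale k"
    by blast
  show ?thesis
  proof
    show "sum C (type_set S \<iota>) > 0"
      using C(1) finite_type_set type_set_nonempty by (intro sum_pos) auto
    fix u k assume u: "u \<in> type_set S \<iota>"
    have "C u \<le> sum C (type_set S \<iota>)"
      using u C(1) finite_type_set by (intro member_le_sum) (auto simp: less_imp_le)
    then have "C u * scale k \<le> sum C (type_set S \<iota>) * scale k"
      using scale_pos[of k] by (intro mult_right_mono) auto
    with C(2)[OF u, of k] show "type_degree u k \<le> sum C (type_set S \<iota>) * scale k" by linarith
  qed
qed

section \<open>Limit degrees of vertices and the maximal degree\<close>

abbreviation "gen \<equiv> birth_generation S \<iota>"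
abbreviation "typ \<equiv> birth_type S \<iota>"

text \<open>The limit of the degree over \<open>scale\<close>: birth in generation
  \<open>gen v\<close> delays the growth and costs a factor
  \<open>\<Lambda> ^ gen v\<close>.\<close>

definition height :: "('v, 'e) xvertex \<Rightarrow> real" where
  "height v = type_weight (typ v) / \<Lambda> ^ gen v"

lemma birth_type_in_type_set: "v \<in> Xi_verts S \<iota> \<Longrightarrow> typ v \<in> type_set S \<iota>"
  by (simp add: type_set_eq)

lemma scaled_deg_limit:
  assumes "v \<in> Xi_verts S \<iota>"
  shows "(\<lambda>n. real (deg (G n) v) / scale n) \<longlonglongrightarrow> height v"
proof (rule LIMSEQ_offset[of _ "gen v"])
  have "(\<lambda>k. type_degree (typ v) k / scale k / (scale (k + gen v) / scale k)) \<longlonglongrightarrow> type_weight (typ v) / \<Lambda> ^ gen v"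
    using Lambda_gt_1 by (intro tendsto_divide type_degree_limit pexp_shift_ratio birth_type_in_type_set assms) auto
  moreover have "type_degree (typ v) k / scale k / (scale (k + gen v) / scale k) =
      real (deg (G (k + gen v)) v) / scale (k + gen v)" for k
    using scale_pos[of k] deg_of_birth[OF assms, of k] by (simp add: add.commute)
  ultimately show "(\<lambda>k. real (deg (G (k + gen v)) v) / scale (k + gen v)) \<longlonglongrightarrow> height v"
    by (simp only: height_def)
qed

text \<open>Rescaled degrees are at most \<open>C / \<Lambda> ^ gen v\<close>, uniformly in
  \<open>n\<close>. Vertices born from generation \<open>m0\<close> on therefore stay below the
  height of one fixed top vertex \<open>v0\<close>, and the maximum is decided on a finite
  set.\<close>

lemma max_deg_limit:
  obtains D where "D > 0" "(\<lambda>n. real (max_deg (G n)) / scale n) \<longlonglongrightarrow> D"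
proof -
  obtain C where C: "C > 0" "\<And>u k. u \<in> type_set S \<iota> \<Longrightarrow> type_degree u k \<le> C * scale k"
    by (rule type_degree_bound) blast
  have late: "real (deg (G n) v) / scale n \<le> C / \<Lambda> ^ gen v"
    if v: "v \<in> verts (G n)" for v n
  proof -
    have vX: "v \<in> Xi_verts S \<iota>" using v by (auto simp: Xi_verts_def)
    then have le: "gen v \<le> n" using v in_verts_iff by blast
    have "real (deg (G n) v) \<le> C * scale (n - gen v)"
      using deg_of_birth[OF vX, of "n - gen v"] C(2)[OF birth_type_in_type_set[OF vX], of "n - gen v"] le by simp
    also have "\<dots> \<le> C * (real (Suc n) ^ (tau_deg S \<iota> - 1) * \<Lambda> ^ (n - gen v))"
      unfolding pexp_def using C(1) Lambda_gt_1 by (intro mult_left_mono mult_right_mono power_mono) auto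
    also have "\<dots> = C / \<Lambda> ^ gen v * scale n"
      unfolding pexp_def using le Lambda_gt_1 by (simp add: power_diff)
    finally show ?thesis using scale_pos[of n] by (simp add: field_simps)
  qed
  obtain u0 where u0: "u0 \<in> top_types" using top_types_nonempty by auto
  then have "u0 \<in> typ ` Xi_verts S \<iota>" unfolding type_set_eq[symmetric] by (simp add: top_types_def)
  then obtain v0 where v0: "v0 \<in> Xi_verts S \<iota>" "typ v0 \<in> top_types" using u0 by auto
  have h0: "height v0 > 0" using top_type_limit(1)[OF v0(2)] v0(2) Lambda_gt_1 by (simp add: height_def type_weight_def)
  obtain m0 where m0: "C / height v0 < \<Lambda> ^ m0" using real_arch_pow[OF Lambda_gt_1] by blast
  have small: "C / \<Lambda> ^ m < height v0" if "m \<ge> m0" for m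
  proof -
    have "\<Lambda> ^ m0 \<le> \<Lambda> ^ m" using that Lambda_gt_1 by (intro power_increasing) auto
    with m0 have "C / height v0 < \<Lambda> ^ m" by linarith
    then show ?thesis using h0 Lambda_gt_1 by (simp add: field_simps)
  qed
  \<comment> \<open>This generation is late enough to contain \<open>v0\<close> as well as every
    vertex born up to \<open>m0\<close>.\<close>
  define W where "W = verts (G (m0 + gen v0))"
  have W: "finite W" "v0 \<in> W" unfolding W_def using finite_verts in_verts_iff[OF v0(1)] by auto
  have WX: "W \<subseteq> Xi_verts S \<iota>" by (auto simp: W_def Xi_verts_def)
  define D where "D = Max (height ` W)"
  have "D \<in> height ` W" unfolding D_def using W by (intro Max_in) auto
  then obtain v1 where v1: "v1 \<in> W" "height v1 = D" by auto
  have Dge: "height v \<le> D" if "v \<in> W" for v unfolding D_def using W that by (intro Max_ge) auto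
  have max_in: "\<exists>v\<in>verts (G n). max_deg (G n) = deg (G n) v" for n
  proof -
    have "verts (G n) \<noteq> {}" by (auto simp: verts_eq)
    then have "max_deg (G n) \<in> deg (G n) ` verts (G n)"
      unfolding max_deg_def using finite_verts by (intro Max_in) auto
    then show ?thesis by auto
  qed
  have "(\<lambda>n. real (max_deg (G n)) / scale n) \<longlonglongrightarrow> D"
  proof (rule order_tendstoI)
    fix a assume "a < D"
    then have "eventually (\<lambda>n. a < real (deg (G n) v1) / scale n) sequentially"
      using scaled_deg_limit[of v1] v1 WX by (intro order_tendstoD(1)[of _ D]) auto
    then show "eventually (\<lambda>n. a < real (max_deg (G n)) / scale n) sequentially"
      using eventually_ge_at_top[of "m0 + gen v0"]
    proof eventually_elim
      case (elim n)
      then have "v1 \<in> verts (G n)" using v1(1) verts_mono[OF elim(2)] by (auto simp: W_def)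
      then have "deg (G n) v1 \<le> max_deg (G n)" unfolding max_deg_def using finite_verts by (intro Max_ge) auto
      then have "real (deg (G n) v1) / scale n \<le> real (max_deg (G n)) / scale n"
        using scale_pos[of n] by (intro divide_right_mono) auto
      with elim show ?case by linarith
    qed
  next
    fix a assume a: "a > D"
    have "eventually (\<lambda>n. \<forall>v\<in>W. real (deg (G n) v) / scale n < a) sequentially"
    proof (intro eventually_ball_finite W ballI)
      fix v assume "v \<in> W"
      then show "eventually (\<lambda>n. real (deg (G n) v) / scale n < a) sequentially"
        using scaled_deg_limit[of v] Dge[of v] a WX by (intro order_tendstoD(2)[of _ "height v"]) auto
    qed
    then show "eventually (\<lambda>n. real (max_deg (G n)) / scale n < a) sequentially"
    proof eventually_elim
      case (elim n)
      obtain v where v: "v \<in> verts (G n)" "max_deg (G n) = deg (G n) v" using max_in by blast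
      show ?case
      proof (cases "v \<in> W")
        case False
        then have "gen v \<ge> m0" using in_verts_iff[of v "m0 + gen v0"] v(1) by (force simp: W_def Xi_verts_def)
        from late[OF v(1)] small[OF this] Dge[OF W(2)] a v(2) show ?thesis by simp
      qed (use elim v in simp)
    qed
  qed
  moreover have "D > 0" using Dge[OF W(2)] h0 by simp
  ultimately show ?thesis using that by blast
qed

definition max_height :: real where
  "max_height = lim (\<lambda>n. real (max_deg (G n)) / scale n)"

lemma max_height: "max_height > 0" "(\<lambda>n. real (max_deg (G n)) / scale n) \<longlonglongrightarrow> max_height"
proof -
  obtain D where "D > 0" "(\<lambda>n. real (max_deg (G n)) / scale n) \<longlonglongrightarrow> D" by (rule max_deg_limit)
  moreover from this have "max_height = D" unfolding max_height_def by (intro limI)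
  ultimately show "max_height > 0" "(\<lambda>n. real (max_deg (G n)) / scale n) \<longlonglongrightarrow> max_height" by auto
qed

lemma deg_hat_eq:
  assumes "v \<in> Xi_verts S \<iota>"
  shows "deg_hat S \<iota> v = height v / max_height"
proof -
  have "(\<lambda>n. real (deg (G n) v) / scale n / (real (max_deg (G n)) / scale n)) \<longlonglongrightarrow> height v / max_height"
    using max_height by (intro tendsto_divide scaled_deg_limit assms) auto
  moreover have "real (deg (G n) v) / scale n / (real (max_deg (G n)) / scale n) =
      real (deg (G n) v) / real (max_deg (G n))" for n
    using scale_pos[of n] by simp
  ultimately show ?thesis unfolding deg_hat_def by (intro limI) (simp only:)
qed

text \<open>The limit degree shared by all vertices of top type \<open>u\<close> born in generation
  \<open>m\<close>.\<close>

definition level :: "nat mat \<Rightarrow> nat \<Rightarrow> real" where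
  "level u m = c_deg S u / (max_height * \<Lambda> ^ m)"

lemma level_pos: "u \<in> top_types \<Longrightarrow> level u m > 0"
  using top_type_limit(1) max_height(1) Lambda_gt_1 by (simp add: level_def)

lemma deg_hat_eq_pos_iff:
  assumes "v \<in> Xi_verts S \<iota>" "l > 0"
  shows "deg_hat S \<iota> v = l \<longleftrightarrow> typ v \<in> top_types \<and> l = level (typ v) (gen v)"
  using assms by (auto simp: deg_hat_eq height_def type_weight_def level_def mult.commute)

section \<open>Surviving types\<close>

abbreviation "surv \<equiv> I_deg_surv S \<iota>"

lemma surv_iff: "u \<in> surv \<longleftrightarrow> u \<in> top_types \<and> (\<forall>n. \<exists>m\<ge>n. births S \<iota> u m > 0)"
  using type_nonzero by (auto simp: I_deg_surv_def top_types_def)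

lemma finite_surv: "finite surv"
  by (rule finite_subset[OF _ finite_top_types]) (auto simp: surv_iff)

lemma finite_births: "finite {v \<in> Xi_verts S \<iota>. gen v = m \<and> typ v = u}"
  by (rule finite_subset[OF _ finite_verts[of m]]) (use in_verts_iff in auto)

text \<open>A single birth after generation 0 excludes the zero alternative in the matrix formula; a
  birth in generation 0 would say nothing about it.\<close>

lemma asy_births:
  assumes "births S \<iota> u (Suc m) > 0"
  obtains q L where "asy (\<lambda>m. real (births S \<iota> u m)) q L"
proof -
  have "zero_or_asy (mass.row_apply (\<lambda>j. real (interior_of_type u j)) \<iota>)"
    by (rule mass.zero_or_asy_row_apply) (auto simp: iota)
  then have "zero_or_asy (\<lambda>m. real (births S \<iota> u (m + 1)))" by (simp add: births_Suc)
  then obtain q L where "asy (\<lambda>m. real (births S \<iota> u (m + 1))) q L"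
    using assms by (auto simp: zero_or_asy_def)
  then show ?thesis using asy_shift_iff[of "\<lambda>m. real (births S \<iota> u m)" 1] that by blast
qed

lemma surv_of_births:
  assumes "u \<in> top_types" "births S \<iota> u (Suc m) > 0" shows "u \<in> surv"
proof -
  obtain q L where "asy (\<lambda>m. real (births S \<iota> u m)) q L" by (rule asy_births[OF assms(2)])
  from asy_eventually_pos[OF this] obtain k where k: "\<And>m. m \<ge> k \<Longrightarrow> births S \<iota> u m > 0"
    by (auto simp: eventually_sequentially)
  have "\<exists>m\<ge>n. births S \<iota> u m > 0" for n using k[of "max n k"] by (intro exI[of _ "max n k"]) auto
  then show ?thesis using assms(1) by (simp add: surv_iff)
qed

text \<open>Uniqueness of the rate resolves the definite description. The rate is at least 1 because
  the counts are eventually positive integers, whose logarithms are nonnegative.\<close>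

lemma Lambda_M_deg:
  assumes "u \<in> surv"
  obtains q where "asy (\<lambda>m. real (births S \<iota> u m)) q (Lambda_M_deg S \<iota> u)" "Lambda_M_deg S \<iota> u \<ge> 1"
proof -
  let ?b = "\<lambda>m. real (births S \<iota> u m)"
  from assms obtain m where "m \<ge> 1" "births S \<iota> u m > 0" by (auto simp: surv_iff)
  then have "births S \<iota> u (Suc (m - 1)) > 0" by simp
  then obtain q L where qL: "asy ?b q L" by (rule asy_births)
  then have L: "L > 0" by (simp add: asy_def)
  have "Lambda_M_deg S \<iota> u = L" unfolding Lambda_M_deg_def
  proof (rule the_equality)
    show "L > 0 \<and> (\<exists>q::nat. q \<ge> 1 \<and> asymp_const ?b (\<lambda>m. real m ^ (q - 1) * L ^ m))"
      using L qL by (auto intro!: exI[of _ "Suc q"] simp: asymp_const_iff_asy)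
    fix L' assume L': "L' > 0 \<and> (\<exists>q::nat. q \<ge> 1 \<and> asymp_const ?b (\<lambda>m. real m ^ (q - 1) * L' ^ m))"
    then obtain q' :: nat where "asy ?b (q' - 1) L'" by (auto simp: asymp_const_iff_asy)
    from asy_growth_unique[OF this qL] show "L' = L" .
  qed
  moreover have "L \<ge> 1"
  proof -
    have "eventually (\<lambda>m. ln (?b m) / real m \<ge> 0) sequentially"
      using asy_eventually_pos[OF qL] by eventually_elim simp
    then have "ln L \<ge> 0" by (intro tendsto_lowerbound[OF asy_ln_tendsto[OF qL]]) auto
    then show ?thesis using L by (simp add: ln_ge_zero_iff)
  qed
  ultimately show ?thesis using that qL by blast
qed

text \<open>A positive entry of \<open>N\<close> is witnessed by an arc of a rule graph, and
  \<open>M\<close> counts that arc too; so walks of \<open>N\<close> project to walks of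
  \<open>M\<close>.\<close>

lemma reach_colour:
  assumes "a < 2 * K" "b \<in> reach N a"
  shows "b div 2 \<in> reach M (a div 2)"
proof -
  from assms(2) obtain n where n: "deg.entry n a b > 0" and b: "b < 2 * K" by (auto simp: deg.reach_iff)
  show ?thesis using assms(1) n
  proof (induction n arbitrary: a)
    case 0
    then have "a = b" using b by (auto simp: deg.entry_0 split: if_splits)
    then show ?case using b by (simp add: mass.reach_refl)
  next
    case (Suc n)
    have "\<exists>l<2 * K. N $$ (a, l) * deg.entry n l b > 0"
    proof (rule ccontr)
      assume "\<not> ?thesis"
      then have "deg.entry (Suc n) a b \<le> 0" unfolding deg.entry_Suc[OF Suc.prems(1) b]
        by (intro sum_nonpos) (meson lessThan_iff not_less)
      then show False using Suc.prems by simp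
    qed
    then obtain l where l: "l < 2 * K" "N $$ (a, l) > 0" "deg.entry n l b > 0"
      using deg.nonneg[OF Suc.prems(1)] deg.entry_nonneg[OF _ b] by (force simp: zero_less_mult_iff)
    have i: "a div 2 < K" "l div 2 < K" using Suc.prems(1) l(1) by auto
    from l(2) obtain e where "e \<in> arcs (R (a div 2))" "colour (R (a div 2)) e = l div 2"
      unfolding degree_matrix_index[OF Suc.prems(1) l(1)] by (auto simp: end_count_def card_gt_0_iff)
    then have "M $$ (a div 2, l div 2) > 0"
      using rule_graph(2)[OF i(1)] i by (auto simp: mass_matrix_index card_gt_0_iff)
    then have "l div 2 \<in> reach M (a div 2)" using i by (intro mass.reach_step)
    moreover have "b div 2 \<in> reach M (l div 2)" using Suc.IH[OF l(1,3)] .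
    ultimately show ?case using i(1) mass.reach_trans by blast
  qed
qed

text \<open>If only the two initial vertices had top type, say because of the end \<open>a\<close> of the initial arc, then
  the opposite end \<open>a'\<close> of colour \<open>\<iota>\<close> recurs in the degree dynamics; the arc witnessing this joins a
  planting vertex to an interior vertex, and the latter carries the end \<open>a\<close>.\<close>

lemma interior_end_exists:
  assumes "a < 2 * K" "a div 2 = \<iota>"
  obtains j w where "j \<in> reach M \<iota>" "w \<in> interior_verts S j" "a \<in> supp S (kappa K (R j) w)"
proof -
  define a' where "a' = (if even a then a + 1 else a - 1)"
  have a': "a' < 2 * K" "a' div 2 = \<iota>" "even a' \<longleftrightarrow> odd a"
    using assms by (auto simp: a'_def elim!: evenE oddE)
  \<comment> \<open>Here primitivity is used also for a block of size one: the index
    \<open>a'\<close> recurs at all late times.\<close>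
  have "asy (\<lambda>k. deg.entry k a' a') 0 (deg.radius a')"
    by (intro deg.asy_block_entry a' deg.block_of_refl)
  from asy_eventually_pos[OF this] obtain k where "\<And>n. n \<ge> k \<Longrightarrow> deg.entry n a' a' > 0"
    by (auto simp: eventually_sequentially)
  then have "deg.entry (k + 1) a' a' > 0" by simp
  then have "(\<Sum>c<2 * K. deg.entry k a' c * deg.entry 1 c a') > 0"
    using pow_mat_add_index[OF degree_matrix_carrier a'(1) a'(1), of k 1] by simp
  then obtain c where c: "c < 2 * K" "deg.entry k a' c * deg.entry 1 c a' > 0"
    by (meson lessThan_iff not_less sum_nonpos)
  then have c': "deg.entry k a' c > 0" "N $$ (c, a') > 0"
    using deg.entry_nonneg[OF a'(1) c(1), of k]
    by (auto simp: zero_less_mult_iff pow_mat.simps left_mult_one_mat[OF degree_matrix_carrier])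
  let ?j = "c div 2"
  have j: "?j < K" using c by auto
  have "c \<in> reach N a'" using c' c by (auto simp: deg.reach_iff)
  from reach_colour[OF a'(1) this] a' have jr: "?j \<in> reach M \<iota>" by simp
  let ?\<beta> = "if even c then bp ?j else bn ?j"
  from c'(2) obtain e where e: "e \<in> arcs (R ?j)" "endpoint (even a') (R ?j) e = ?\<beta>" "colour (R ?j) e = \<iota>"
    unfolding degree_matrix_index[OF c(1) a'(1)] a'(2) by (auto simp: end_count_def card_gt_0_iff)
  define w where "w = endpoint (even a) (R ?j) e"
  \<comment> \<open>One end of \<open>e\<close> is a planting vertex. The other is neither the same
    one, as there are no loops, nor the opposite one, as the planting vertices are at distance at
    least 2.\<close>
  have "w \<in> interior_verts S ?j"
    using rule_graph(3)[OF j e(1), of "even a"] rule_graph(4,9)[OF j e(1)] e(2) a'(3)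
    by (auto simp: interior_verts_def w_def endpoint_def split: if_splits)
  moreover have "a \<in> supp S (kappa K (R ?j) w)"
  proof -
    have "2 * \<iota> + (if even a then 0 else 1) = a" using assms(2) by (auto elim!: evenE oddE)
    then show ?thesis using kappa_pos_of_arc[OF j e(1) w_def[symmetric]] e(3) by simp
  qed
  ultimately show ?thesis using that jr by blast
qed

text \<open>No type exceeds the top rate and order, so a single coordinate attaining both forces the
  whole type to the top.\<close>

lemma top_type_of_supp:
  assumes "u \<in> type_set S \<iota>" "a \<in> supp S u" "reach_radius N a = \<Lambda>" "varkappa N a = tau_deg S \<iota>"
  shows "u \<in> top_types"
proof -
  have "\<Lambda> \<le> type_rate S u" unfolding type_rate_def assms(3)[symmetric]
    using assms(2) finite_supp by (intro Max_ge) auto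
  then have rate: "type_rate S u = \<Lambda>" using type_rate_le[OF assms(1)] by simp
  have "tau_deg S \<iota> \<le> type_order S u" unfolding type_order_def assms(4)[symmetric]
    using assms(2,3) finite_supp rate by (intro Max_ge) auto
  then show ?thesis using type_order_le[OF assms(1) rate] rate assms(1) by (simp add: top_types_def)
qed

lemma interior_type_births:
  assumes "j \<in> reach M \<iota>" "w \<in> interior_verts S j"
  shows "kappa K (R j) w \<in> type_set S \<iota>" "\<exists>m. births S \<iota> (kappa K (R j) w) (Suc m) > 0"
proof -
  show "kappa K (R j) w \<in> type_set S \<iota>" unfolding type_set_def using assms by blast
  obtain m p where p: "p \<in> arcs (G m)" "colour (G m) p = j" using assms(1) by (auto simp: in_reach_mass_iff)
  have "Fresh p w \<in> {v \<in> Xi_verts S \<iota>. gen v = Suc m \<and> typ v = kappa K (R j) w}"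
    using birth_Fresh[of p m w] p assms(2) by (auto simp: Xi_verts_eq)
  then have "births S \<iota> (kappa K (R j) w) (Suc m) > 0"
    unfolding births_def using finite_births card_gt_0_iff by blast
  then show "\<exists>m. births S \<iota> (kappa K (R j) w) (Suc m) > 0" ..
qed

text \<open>Needed for small degrees to be attained at all. An interior top type survives as soon as
  it occurs; an initial one is supported on a single coordinate, and
  \<open>interior_end_exists\<close> supplies an interior type that contains this coordinate and is
  then also a top type.\<close>

lemma surv_nonempty: "surv \<noteq> {}"
proof -
  obtain u where u: "u \<in> top_types" using top_types_nonempty by auto
  then have "u \<in> type_set S \<iota>" by (simp add: top_types_def)
  then consider "u \<in> {kappa K (G 0) Source, kappa K (G 0) Sink}"
    | j w where "j \<in> reach M \<iota>" "w \<in> interior_verts S j" "u = kappa K (R j) w"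
    unfolding type_set_def initial_types(1) by blast
  then show ?thesis
  proof cases
    case 1
    then obtain a where a: "supp S u = {a}" "a div 2 = \<iota>" using initial_types(2,3) by force
    then have "a < 2 * K" by (auto simp: supp_def)
    then obtain j w where jw: "j \<in> reach M \<iota>" "w \<in> interior_verts S j" "a \<in> supp S (kappa K (R j) w)"
      using interior_end_exists a(2) by blast
    have "type_rate S u = reach_radius N a" using a by (simp add: type_rate_def)
    moreover have "type_order S u = varkappa N a"
      using a calculation by (simp add: type_order_def conj_disj_distribR Collect_conv_if)
    ultimately have "reach_radius N a = \<Lambda>" "varkappa N a = tau_deg S \<iota>" using u by (auto simp: top_types_def)
    from top_type_of_supp[OF interior_type_births(1)[OF jw(1,2)] jw(3) this] interior_type_births(2)[OF jw(1,2)]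
    show ?thesis using surv_of_births by blast
  next
    case 2
    then show ?thesis using interior_type_births(2)[OF 2(1,2)] surv_of_births u by blast
  qed
qed

section \<open>Classes and the number of vertices at a level\<close>

definition deg_class :: "nat mat \<Rightarrow> nat mat set" where
  "deg_class u = sim_deg S \<iota> `` {u}"

lemma K_deg_eq: "K_deg S \<iota> = deg_class ` surv"
  by (auto simp: K_deg_def quotient_def deg_class_def)

lemma deg_class_iff:
  assumes "u \<in> surv"
  shows "w \<in> deg_class u \<longleftrightarrow> w \<in> surv \<and> (\<exists>k::int. c_deg S u / c_deg S w = \<Lambda> powi k)"
  using assms by (auto simp: deg_class_def sim_deg_def)

lemma deg_class_refl: "u \<in> surv \<Longrightarrow> u \<in> deg_class u"
  using top_type_limit(1)[of u] by (auto simp: deg_class_iff surv_iff intro!: exI[of _ 0])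

lemma finite_deg_class: "u \<in> surv \<Longrightarrow> finite (deg_class u)"
  by (rule finite_subset[OF _ finite_surv]) (auto simp: deg_class_iff)

text \<open>Equality of two levels says that the quotient of the constants is the power of \<Lambda>
  given by the difference of the generations; this places the type in the class of \<open>u\<close>
  and fixes its offset \<open>k w\<close>. The hypothesis \<open>late\<close> excludes initial
  vertices, whose type might be a top type that does not survive.\<close>

lemma deg_count_level:
  assumes u: "u \<in> surv"
    and k: "\<And>w. w \<in> deg_class u \<Longrightarrow> c_deg S w / c_deg S u = \<Lambda> powi k w"
    and m: "\<And>w. w \<in> deg_class u \<Longrightarrow> int m + k w \<ge> 0"
    and late: "\<And>w. w \<in> top_types \<Longrightarrow> c_deg S u < c_deg S w * \<Lambda> ^ m"
  shows "deg_count S \<iota> (level u m) = (\<Sum>w\<in>deg_class u. births S \<iota> w (nat (int m + k w)))"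
proof -
  have pos: "c_deg S w > 0" if "w \<in> top_types" for w using that by (rule top_type_limit)
  have top: "w \<in> top_types" if "w \<in> surv" for w using that by (simp add: surv_iff)
  have L0: "\<Lambda> > 0" using Lambda_gt_1 by simp
  let ?B = "\<lambda>w. {v \<in> Xi_verts S \<iota>. gen v = nat (int m + k w) \<and> typ v = w}"
  have "{v \<in> Xi_verts S \<iota>. deg_hat S \<iota> v = level u m} = (\<Union>w\<in>deg_class u. ?B w)"
  proof (intro equalityI subsetI)
    fix v assume "v \<in> {v \<in> Xi_verts S \<iota>. deg_hat S \<iota> v = level u m}"
    then have v: "v \<in> Xi_verts S \<iota>" "typ v \<in> top_types" "level u m = level (typ v) (gen v)"
      using deg_hat_eq_pos_iff[OF _ level_pos[OF top[OF u]]] by auto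
    let ?w = "typ v"
    have eq: "c_deg S u * \<Lambda> ^ gen v = c_deg S ?w * \<Lambda> ^ m"
      using v(3) L0 max_height(1) by (simp add: level_def field_simps)
    have "gen v \<noteq> 0"
      using eq late[OF v(2)] by (intro notI) simp
    then obtain b where b: "gen v = Suc b" by (cases "gen v") auto
    have "births S \<iota> ?w (Suc b) > 0"
      unfolding births_def using finite_births[of "Suc b" ?w] v(1) b by (auto simp: card_gt_0_iff)
    then have ws: "?w \<in> surv" by (rule surv_of_births[OF v(2)])
    have ratio: "c_deg S ?w / c_deg S u = \<Lambda> powi (int (gen v) - int m)"
      using eq pos[OF top[OF u]] L0 by (simp add: power_int_diff field_simps)
    have "c_deg S u / c_deg S ?w = inverse (c_deg S ?w / c_deg S u)" by simp
    also have "\<dots> = \<Lambda> powi (- (int (gen v) - int m))" unfolding ratio by (simp only: power_int_minus)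
    finally have wc: "?w \<in> deg_class u" using ws by (auto simp: deg_class_iff[OF u])
    have "\<Lambda> powi k ?w = \<Lambda> powi (int (gen v) - int m)" using k[OF wc] ratio by simp
    then have "k ?w = int (gen v) - int m"
      using powi_inject[OF Lambda_gt_1] by simp
    then show "v \<in> (\<Union>w\<in>deg_class u. ?B w)" using wc v(1) by auto
  next
    fix v assume "v \<in> (\<Union>w\<in>deg_class u. ?B w)"
    then have v: "v \<in> Xi_verts S \<iota>" "typ v \<in> deg_class u" "gen v = nat (int m + k (typ v))" by auto
    then have w: "typ v \<in> top_types" using deg_class_iff[OF u] top by auto
    have "int (gen v) = int m + k (typ v)" using v(3) m[OF v(2)] by simp
    then have "\<Lambda> ^ gen v = \<Lambda> powi (int m + k (typ v))" by (metis power_int_of_nat)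
    also have "\<dots> = \<Lambda> ^ m * (c_deg S (typ v) / c_deg S u)"
      using L0 k[OF v(2)] by (simp add: power_int_add)
    finally have "level u m = level (typ v) (gen v)"
      using pos[OF w] pos[OF top[OF u]] L0 max_height(1) by (simp add: level_def field_simps)
    then have "deg_hat S \<iota> v = level u m"
      using deg_hat_eq_pos_iff[OF v(1) level_pos[OF top[OF u]], of m] w by blast
    then show "v \<in> {v \<in> Xi_verts S \<iota>. deg_hat S \<iota> v = level u m}"
      using v(1) by simp
  qed
  then show ?thesis unfolding deg_count_def births_def
    by (simp add: card_UN_disjoint finite_deg_class[OF u] finite_births)
       (subst card_UN_disjoint, auto simp: finite_deg_class[OF u] finite_births)
qed

lemma level_tendsto_0: "level u \<longlonglongrightarrow> 0"
proof -
  have "(\<lambda>m. c_deg S u / max_height * (1 / \<Lambda>) ^ m) \<longlonglongrightarrow> c_deg S u / max_height * 0"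
    using Lambda_gt_1 by (intro tendsto_intros LIMSEQ_realpow_zero) auto
  then show ?thesis by (simp add: level_def[abs_def] power_divide)
qed

text \<open>The class is finite, so for large \<open>m\<close> all offsets are admissible. The
  shifted birth counts keep their rates, and the largest of these is the effective rate of the
  class.\<close>

lemma asy_deg_count_level:
  assumes u: "u \<in> surv"
  obtains q where "asy (\<lambda>m. real (deg_count S \<iota> (level u m))) q (Lambda_M_deg_eff S \<iota> (deg_class u))"
proof -
  have ut: "u \<in> top_types" using u by (simp add: surv_iff)
  note cu = top_type_limit(1)[OF ut]
  have "\<forall>w\<in>deg_class u. \<exists>k::int. c_deg S w / c_deg S u = \<Lambda> powi k"
  proof
    fix w assume "w \<in> deg_class u"
    then obtain k where "c_deg S u / c_deg S w = \<Lambda> powi k" by (auto simp: deg_class_iff[OF u])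
    then have "c_deg S w / c_deg S u = \<Lambda> powi (- k)" by (metis inverse_divide power_int_minus)
    then show "\<exists>k::int. c_deg S w / c_deg S u = \<Lambda> powi k" ..
  qed
  from bchoice[OF this] obtain k where k: "\<And>w. w \<in> deg_class u \<Longrightarrow> c_deg S w / c_deg S u = \<Lambda> powi k w"
    by auto
  have "\<forall>w\<in>deg_class u. \<exists>q. asy (\<lambda>m. real (births S \<iota> w m)) q (Lambda_M_deg S \<iota> w)"
    using Lambda_M_deg deg_class_iff[OF u] by metis
  from bchoice[OF this] obtain q where
    q: "\<And>w. w \<in> deg_class u \<Longrightarrow> asy (\<lambda>m. real (births S \<iota> w m)) (q w) (Lambda_M_deg S \<iota> w)" by auto
  have asy: "asy (\<lambda>m. \<Sum>w\<in>deg_class u. real (births S \<iota> w (nat (int m + k w))))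
    (Max (q ` {w \<in> deg_class u. Lambda_M_deg S \<iota> w = Max (Lambda_M_deg S \<iota> ` deg_class u)}))
    (Max (Lambda_M_deg S \<iota> ` deg_class u))"
    using deg_class_refl[OF u] by (intro asy_sum_Max finite_deg_class u asy_int_shift q) auto
  have "eventually (\<lambda>m. \<forall>w\<in>deg_class u. int m + k w \<ge> 0) sequentially"
  proof (intro eventually_ball_finite finite_deg_class u ballI)
    fix w show "eventually (\<lambda>m. int m + k w \<ge> 0) sequentially"
      using eventually_ge_at_top[of "nat (- k w)"] by eventually_elim simp
  qed
  moreover have "eventually (\<lambda>m. \<forall>w\<in>top_types. c_deg S u < c_deg S w * \<Lambda> ^ m) sequentially"
  proof (intro eventually_ball_finite finite_top_types ballI)
    fix w assume "w \<in> top_types"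
    then have cw: "c_deg S w > 0" by (rule top_type_limit)
    obtain n where n: "c_deg S u / c_deg S w < \<Lambda> ^ n" using real_arch_pow[OF Lambda_gt_1] by blast
    show "eventually (\<lambda>m. c_deg S u < c_deg S w * \<Lambda> ^ m) sequentially"
      using eventually_ge_at_top[of n]
    proof eventually_elim
      case (elim m)
      have "\<Lambda> ^ n \<le> \<Lambda> ^ m" using elim Lambda_gt_1 by (intro power_increasing) auto
      with n have "c_deg S u / c_deg S w < \<Lambda> ^ m" by linarith
      then show ?case using cw by (simp add: field_simps)
    qed
  qed
  ultimately have "eventually (\<lambda>m. real (deg_count S \<iota> (level u m)) =
      (\<Sum>w\<in>deg_class u. real (births S \<iota> w (nat (int m + k w))))) sequentially"
    by eventually_elim (subst deg_count_level[OF u k], auto)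
  from asy_cong[OF this] asy that show ?thesis unfolding Lambda_M_deg_eff_def by blast
qed

lemma level_attained:
  assumes u: "u \<in> surv"
  shows "eventually (\<lambda>m. level u m \<in> attained_degs S \<iota>) sequentially"
proof -
  obtain q where "asy (\<lambda>m. real (deg_count S \<iota> (level u m))) q (Lambda_M_deg_eff S \<iota> (deg_class u))"
    by (rule asy_deg_count_level[OF u])
  from asy_eventually_pos[OF this] show ?thesis
    by eventually_elim (use level_pos u in \<open>auto simp: attained_degs_def surv_iff\<close>)
qed

lemma filterlim_level:
  assumes u: "u \<in> surv"
  shows "filterlim (level u) (at 0 within attained_degs S \<iota>) sequentially"
  unfolding filterlim_at
proof
  show "eventually (\<lambda>m. level u m \<in> attained_degs S \<iota> \<and> level u m \<noteq> 0) sequentially"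
    using level_attained[OF u] by eventually_elim (auto simp: attained_degs_def)
qed (rule level_tendsto_0)

text \<open>Numerator and denominator are divided by \<open>m\<close>; the constant factor of the
  level then contributes only a term of order \<open>1 / m\<close>.\<close>

lemma log_ratio_level:
  assumes u: "u \<in> surv"
  shows "(\<lambda>m. log_ratio S \<iota> (level u m)) \<longlonglongrightarrow> ln (Lambda_M_deg_eff S \<iota> (deg_class u)) / ln \<Lambda>"
proof -
  obtain q where "asy (\<lambda>m. real (deg_count S \<iota> (level u m))) q (Lambda_M_deg_eff S \<iota> (deg_class u))"
    by (rule asy_deg_count_level[OF u])
  note num = asy_ln_tendsto[OF this]
  have c: "c_deg S u / max_height > 0" using u top_type_limit(1) max_height(1) by (simp add: surv_iff)
  have "(\<lambda>m. ln \<Lambda> - ln (c_deg S u / max_height) * (1 / real m)) \<longlonglongrightarrow> ln \<Lambda> - ln (c_deg S u / max_height) * 0"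
    by (intro tendsto_intros lim_1_over_n)
  then have "(\<lambda>m. ln \<Lambda> - ln (c_deg S u / max_height) * (1 / real m)) \<longlonglongrightarrow> ln \<Lambda>" by simp
  with num have "(\<lambda>m. ln (real (deg_count S \<iota> (level u m))) / real m /
      (ln \<Lambda> - ln (c_deg S u / max_height) * (1 / real m))) \<longlonglongrightarrow> ln (Lambda_M_deg_eff S \<iota> (deg_class u)) / ln \<Lambda>"
    using Lambda_gt_1 by (intro tendsto_divide) auto
  then show ?thesis
  proof (rule Lim_transform_eventually)
    show "\<forall>\<^sub>F m in sequentially. ln (real (deg_count S \<iota> (level u m))) / real m /
      (ln \<Lambda> - ln (c_deg S u / max_height) * (1 / real m)) = log_ratio S \<iota> (level u m)"
      using eventually_gt_at_top[of 0]
    proof eventually_elim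
      case (elim m)
      define x where "x = c_deg S u / max_height"
      have "level u m = x / \<Lambda> ^ m" by (simp add: level_def x_def)
      moreover have "ln (x / \<Lambda> ^ m) = ln x - real m * ln \<Lambda>"
        using c Lambda_gt_1 by (subst ln_div) (simp_all add: ln_realpow flip: x_def)
      ultimately have "- ln (level u m) = real m * ln \<Lambda> - ln (c_deg S u / max_height)"
        by (simp add: x_def)
      also have "\<dots> = real m * (ln \<Lambda> - ln (c_deg S u / max_height) * (1 / real m))"
        using elim by (simp add: right_diff_distrib)
      finally show ?case by (simp add: log_ratio_def)
    qed
  qed
qed

lemma attained_small:
  obtains l0 where "l0 > 0"
    "\<And>l. l \<in> attained_degs S \<iota> \<Longrightarrow> l < l0 \<Longrightarrow> \<exists>u\<in>surv. \<exists>m\<ge>n. l = level u m"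
proof -
  \<comment> \<open>The least level in generation \<open>n\<close>. Levels decrease with the
    generation, so a smaller degree comes from a later birth, which is never generation 0 and hence
    has a surviving type.\<close>
  define l0 where "l0 = Min ((\<lambda>w. level w n) ` top_types)"
  have "l0 > 0" unfolding l0_def
    using finite_top_types top_types_nonempty level_pos by (subst Min_gr_iff) auto
  moreover have "\<exists>u\<in>surv. \<exists>m\<ge>n. l = level u m" if l: "l \<in> attained_degs S \<iota>" "l < l0" for l
  proof -
    from l(1) have "l > 0" "card {v \<in> Xi_verts S \<iota>. deg_hat S \<iota> v = l} > 0"
      by (auto simp: attained_degs_def deg_count_def)
    then obtain v where v: "v \<in> Xi_verts S \<iota>" "deg_hat S \<iota> v = l" by (auto simp: card_gt_0_iff)
    then have w: "typ v \<in> top_types" "l = level (typ v) (gen v)" using deg_hat_eq_pos_iff[OF v(1) \<open>l > 0\<close>] by auto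
    have "gen v > n"
    proof (rule ccontr)
      assume "\<not> gen v > n"
      then have "\<Lambda> ^ gen v \<le> \<Lambda> ^ n" using Lambda_gt_1 by (intro power_increasing) auto
      then have "level (typ v) n \<le> level (typ v) (gen v)"
        unfolding level_def using top_type_limit(1)[OF w(1)] max_height(1) Lambda_gt_1
        by (intro divide_left_mono mult_left_mono) auto
      moreover have "l0 \<le> level (typ v) n" unfolding l0_def using finite_top_types w(1) by (intro Min_le) auto
      ultimately show False using l(2) w(2) by linarith
    qed
    then obtain b where b: "gen v = Suc b" by (cases "gen v") auto
    have "births S \<iota> (typ v) (Suc b) > 0"
      unfolding births_def using finite_births[of "Suc b" "typ v"] v(1) b by (auto simp: card_gt_0_iff)
    then have "typ v \<in> surv" by (rule surv_of_births[OF w(1)])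
    then show ?thesis using w(2) \<open>gen v > n\<close> by (intro bexI[of _ "typ v"] exI[of _ "gen v"]) auto
  qed
  ultimately show ?thesis using that by blast
qed

section \<open>The logarithmic limit along the attained degrees\<close>

text \<open>The levels of any surviving type are eventually attained and tend to 0.\<close>

lemma at_0_within_attained_nontrivial: "at 0 within attained_degs S \<iota> \<noteq> bot"
proof
  assume "at 0 within attained_degs S \<iota> = bot"
  moreover obtain u where "u \<in> surv" using surv_nonempty by auto
  ultimately have "filterlim (level u) bot sequentially" using filterlim_level by metis
  then show False by (simp add: filterlim_def bot_unique filtermap_bot_iff)
qed

text \<open>Near 0 the attained degrees are covered by finitely many sequences of levels, each
  tending to 0. A limit along the set is therefore the same as a common limit along all these
  sequences.\<close>

lemma log_ratio_tendsto_iff: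
  "(log_ratio S \<iota> \<longlongrightarrow> d) (at 0 within attained_degs S \<iota>) \<longleftrightarrow>
    (\<forall>u\<in>surv. ln (Lambda_M_deg_eff S \<iota> (deg_class u)) / ln \<Lambda> = d)"
proof (intro iffI ballI)
  fix u assume lim: "(log_ratio S \<iota> \<longlongrightarrow> d) (at 0 within attained_degs S \<iota>)" and u: "u \<in> surv"
  have "(\<lambda>m. log_ratio S \<iota> (level u m)) \<longlonglongrightarrow> d"
    by (rule filterlim_compose[OF lim filterlim_level[OF u]])
  then show "ln (Lambda_M_deg_eff S \<iota> (deg_class u)) / ln \<Lambda> = d"
    using log_ratio_level[OF u] LIMSEQ_unique by blast
next
  assume d: "\<forall>u\<in>surv. ln (Lambda_M_deg_eff S \<iota> (deg_class u)) / ln \<Lambda> = d"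
  show "(log_ratio S \<iota> \<longlongrightarrow> d) (at 0 within attained_degs S \<iota>)"
  proof (rule tendstoI)
    fix e :: real assume e: "e > 0"
    have "eventually (\<lambda>m. \<forall>u\<in>surv. dist (log_ratio S \<iota> (level u m)) d < e) sequentially"
    proof (intro eventually_ball_finite finite_surv ballI)
      fix u assume "u \<in> surv"
      then have "(\<lambda>m. log_ratio S \<iota> (level u m)) \<longlonglongrightarrow> d" using log_ratio_level d by metis
      from tendstoD[OF this e] show "eventually (\<lambda>m. dist (log_ratio S \<iota> (level u m)) d < e) sequentially" .
    qed
    then obtain n where n: "\<And>m u. m \<ge> n \<Longrightarrow> u \<in> surv \<Longrightarrow> dist (log_ratio S \<iota> (level u m)) d < e"
      by (auto simp: eventually_sequentially)
    obtain l0 where l0: "l0 > 0"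
      "\<And>l. l \<in> attained_degs S \<iota> \<Longrightarrow> l < l0 \<Longrightarrow> \<exists>u\<in>surv. \<exists>m\<ge>n. l = level u m"
      by (rule attained_small[of n]) blast
    show "eventually (\<lambda>l. dist (log_ratio S \<iota> l) d < e) (at 0 within attained_degs S \<iota>)"
      unfolding eventually_at
    proof (intro exI[of _ l0] conjI ballI impI l0(1))
      fix l assume l: "l \<in> attained_degs S \<iota>" "l \<noteq> 0 \<and> dist l 0 < l0"
      then have "l < l0" by (auto simp: dist_real_def)
      then obtain u m where "u \<in> surv" "m \<ge> n" "l = level u m" using l0(2)[OF l(1)] by blast
      then show "dist (log_ratio S \<iota> l) d < e" using n by simp
    qed
  qed
qed

abbreviation eff :: "nat mat set \<Rightarrow> real" where
  "eff \<equiv> Lambda_M_deg_eff S \<iota>"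

lemma eff_ge_1:
  assumes "u \<in> surv" shows "eff (deg_class u) \<ge> 1"
proof -
  have "1 \<le> Lambda_M_deg S \<iota> u" using Lambda_M_deg[OF assms] by blast
  also have "\<dots> \<le> eff (deg_class u)" unfolding Lambda_M_deg_eff_def
    using finite_deg_class[OF assms] deg_class_refl[OF assms] by (intro Max_ge) auto
  finally show ?thesis .
qed

lemma Max_eff_attained:
  obtains u where "u \<in> surv" "Max (eff ` K_deg S \<iota>) = eff (deg_class u)"
proof -
  have "Max (eff ` K_deg S \<iota>) \<in> eff ` K_deg S \<iota>"
    using finite_surv surv_nonempty by (intro Max_in) (auto simp: K_deg_eq)
  then show ?thesis using that by (auto simp: K_deg_eq)
qed

lemma not_BEDM_iff: "\<not> BEDM S \<iota> \<longleftrightarrow> (\<forall>u\<in>surv. eff (deg_class u) = Max (eff ` K_deg S \<iota>))"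
proof -
  obtain u0 where u0: "u0 \<in> surv" "Max (eff ` K_deg S \<iota>) = eff (deg_class u0)" by (rule Max_eff_attained)
  have "\<not> BEDM S \<iota> \<longleftrightarrow> (\<forall>u\<in>surv. \<forall>v\<in>surv. eff (deg_class u) = eff (deg_class v))"
    by (auto simp: BEDM_def K_deg_eq)
  then show ?thesis using u0 by metis
qed

text \<open>Effective rates are at least 1, so the logarithm separates them and is positive exactly
  for rates above 1. Equality of the limits over all classes is thus the failure of
  \<open>BEDM\<close>, and positivity of the common limit is the condition on the maximum.\<close>

lemma scale_free_iff:
  "scale_free S \<iota> \<longleftrightarrow> \<not> BEDM S \<iota> \<and> Max (eff ` K_deg S \<iota>) > 1"
  and degree_dimension_eq:
  "scale_free S \<iota> \<Longrightarrow> degree_dimension S \<iota> = ln (Max (eff ` K_deg S \<iota>)) / ln \<Lambda>"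
proof -
  let ?m = "Max (eff ` K_deg S \<iota>)"
  obtain u0 where u0: "u0 \<in> surv" "?m = eff (deg_class u0)" by (rule Max_eff_attained)
  have lnL: "ln \<Lambda> > 0" using Lambda_gt_1 by simp
  have m1: "?m \<ge> 1" using eff_ge_1[OF u0(1)] u0(2) by simp
  have lim_iff: "(log_ratio S \<iota> \<longlongrightarrow> d) (at 0 within attained_degs S \<iota>) \<longleftrightarrow>
      \<not> BEDM S \<iota> \<and> d = ln ?m / ln \<Lambda>" for d
  proof -
    have "(\<forall>u\<in>surv. ln (eff (deg_class u)) / ln \<Lambda> = d) \<longleftrightarrow>
        (\<forall>u\<in>surv. ln (eff (deg_class u)) = ln ?m) \<and> d = ln ?m / ln \<Lambda>"
      using u0 lnL by (metis divide_cancel_right less_irrefl)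
    also have "(\<forall>u\<in>surv. ln (eff (deg_class u)) = ln ?m) \<longleftrightarrow> \<not> BEDM S \<iota>"
      unfolding not_BEDM_iff
    proof (intro ball_cong refl)
      fix u assume "u \<in> surv"
      then have "eff (deg_class u) > 0" "?m > 0" using eff_ge_1[of u] m1 by auto
      then show "ln (eff (deg_class u)) = ln ?m \<longleftrightarrow> eff (deg_class u) = ?m" by (rule ln_inj_iff)
    qed
    finally show ?thesis unfolding log_ratio_tendsto_iff .
  qed
  have "ln ?m / ln \<Lambda> > 0 \<longleftrightarrow> ?m > 1" using lnL m1 by (simp add: zero_less_divide_iff)
  then show sf: "scale_free S \<iota> \<longleftrightarrow> \<not> BEDM S \<iota> \<and> ?m > 1"
    unfolding scale_free_def lim_iff using at_0_within_attained_nontrivial by blast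
  assume "scale_free S \<iota>"
  then have "(log_ratio S \<iota> \<longlongrightarrow> ln ?m / ln \<Lambda>) (at 0 within attained_degs S \<iota>)"
    unfolding lim_iff sf by simp
  then show "degree_dimension S \<iota> = ln ?m / ln \<Lambda>"
    unfolding degree_dimension_def by (rule tendsto_Lim[OF at_0_within_attained_nontrivial])
qed

end

theorem theorem4p10:
  fixes S :: "('v, 'e) edge_igs" and \<iota> :: nat
  assumes "is_edge_igs S"
    and "\<iota> < num_colours S"
    and "primitive_Frobenius (degree_matrix S)"
    and "primitive_Frobenius (mass_matrix S)"
    and "Lambda_U S \<iota> > 1"
  shows "(scale_free S \<iota> \<longleftrightarrow>
           \<not> BEDM S \<iota> \<and> Max (Lambda_M_deg_eff S \<iota> ` K_deg S \<iota>) > 1) \<and>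
         (scale_free S \<iota> \<longrightarrow>
           degree_dimension S \<iota> =
             ln (Max (Lambda_M_deg_eff S \<iota> ` K_deg S \<iota>)) / ln (Lambda_U S \<iota>))"
proof -
  interpret frobenius_edge_iterated_system S \<iota>
    using assms by unfold_locales
  show ?thesis using scale_free_iff degree_dimension_eq by blast
qed

end
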